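(* Let $F$ be a simplicial set. Then the probability-law map $p_F : L(F) \to |F|$ is a homotopy equivalence. In particular, $L(F)$ has the homotopy type of a CW-complex. Moreover, for every topological space $X$, the simplicial set $\mathrm{Sing}_{RV} X$ is a Kan complex.
   Context: $(\Omega,\lambda)$ is a fixed atomless complete probability space. $[n] = \{0,\dots,n\}$; $\mathbf{\Delta}$ is the category with objects the $[n]$, $n\ge 0$, and weakly increasing maps. A simplicial set is a functor $F : \mathbf{\Delta}^{op} \to \mathbf{Set}$, $F_n = F([n])$, and for $\sigma : [n]\to[m]$ and $\alpha \in F_m$ one writes $\alpha\sigma = F(\sigma)(\alpha) \in F_n$. $\mathbf{Top}$ is a convenient category of topological spaces containing the metrizable ones (for instance weakly Hausdorff compactly generated spaces). $\nabla_n = L^1(\Omega,[n])$ is the set of measurable maps $f : \Omega \to [n]$ modulo almost everywhere equality, with the topology of the metric $d(f,g) = \lambda(\{t : f(t)\neq g(t)\})$; for $\sigma : [n]\to[m]$, $\nabla(\sigma) : \nabla_n \to \nabla_m$ is $f \mapsto \sigma\circ f$. $\Delta_n = \{(x_0,\dots,x_n) \in [0,1]^{n+1} : \sum x_i = 1\}$ and $\Delta(\sigma)(x_0,\dots,x_n) = (\sum_{j\in\sigma^{-1}(i)} x_j)_{i=0,\dots,m}$. $L(F)$ is the quotient space of $\bigsqcup_n F_n \times \nabla_n$ ($F_n$ discrete) by the equivalence relation generated by $(\alpha\sigma,a) \sim (\alpha,\nabla(\sigma)(a))$ for all morphisms $\sigma$ of $\mathbf{\Delta}$. $|F|$ is the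 usual geometric realization, i.e. the quotient of $\bigsqcup_n F_n\times\Delta_n$ by the relation generated by $(\alpha\sigma,a)\sim(\alpha,\Delta(\sigma)(a))$. The maps $p_n : \nabla_n \to \Delta_n$, $f \mapsto (\lambda(f^{-1}(i)))_{i=0,\dots,n}$, are natural in $[n]$ and induce the probability-law map $p_F : L(F) \to |F|$, the class of $(\alpha,a)$ being mapped to the class of $(\alpha,p_n(a))$. $\mathrm{Sing}_{RV} X$ is the simplicial set with $(\mathrm{Sing}_{RV}X)_n$ the set of continuous maps $\nabla_n \to X$, with $f\cdot\sigma = f\circ\nabla(\sigma)$. *)

theory Defs
  imports "HOL-Probability.Probability_Measure" "HOL-Homology.Simplices"
begin

section \<open>Simplicial sets and Kan complexes\<close>

text \<open>Morphisms of the simplex category are taken extensional (undefined outside \<^term>\<open>{..n}\<close>),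
  so that HOL equality of functions is equality of morphisms.\<close>

definition Delta_hom :: "nat \<Rightarrow> nat \<Rightarrow> (nat \<Rightarrow> nat) set" where
  "Delta_hom n m = {\<sigma> \<in> {..n} \<rightarrow>\<^sub>E {..m}. mono_on {..n} \<sigma>}"

text \<open>For \<open>\<sigma> : [n] \<rightarrow> [m]\<close> and an \<open>m\<close>-simplex \<open>\<alpha>\<close>, the \<open>n\<close>-simplex \<open>\<alpha>\<sigma>\<close> is \<open>act F n m \<sigma> \<alpha>\<close>.\<close>

record 'a sset =
  simplices :: "nat \<Rightarrow> 'a set"
  act :: "nat \<Rightarrow> nat \<Rightarrow> (nat \<Rightarrow> nat) \<Rightarrow> 'a \<Rightarrow> 'a"

definition simplicial_set :: "'a sset \<Rightarrow> bool" where
  "simplicial_set F \<longleftrightarrow>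
     (\<forall>n m. \<forall>\<sigma>\<in>Delta_hom n m. act F n m \<sigma> \<in> simplices F m \<rightarrow> simplices F n) \<and>
     (\<forall>n. \<forall>\<alpha>\<in>simplices F n. act F n n (restrict id {..n}) \<alpha> = \<alpha>) \<and>
     (\<forall>l n m. \<forall>\<sigma>\<in>Delta_hom l n. \<forall>\<tau>\<in>Delta_hom n m. \<forall>\<alpha>\<in>simplices F m.
        act F l m (compose {..l} \<tau> \<sigma>) \<alpha> = act F l n \<sigma> (act F n m \<tau> \<alpha>))"

definition simplicial_map :: "'a sset \<Rightarrow> 'b sset \<Rightarrow> (nat \<Rightarrow> 'a \<Rightarrow> 'b) \<Rightarrow> bool" where
  "simplicial_map F G f \<longleftrightarrow>
     (\<forall>n. f n \<in> simplices F n \<rightarrow> simplices G n) \<and>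
     (\<forall>n m. \<forall>\<sigma>\<in>Delta_hom n m. \<forall>\<alpha>\<in>simplices F m. f n (act F n m \<sigma> \<alpha>) = act G n m \<sigma> (f m \<alpha>))"

definition std_sset :: "nat \<Rightarrow> (nat \<Rightarrow> nat) sset" where
  "std_sset n = \<lparr>simplices = (\<lambda>m. Delta_hom m n), act = (\<lambda>l m \<sigma> \<tau>. compose {..l} \<tau> \<sigma>)\<rparr>"

text \<open>The horn \<open>\<Lambda>\<^sub>k[n]\<close> is the union of the faces of \<open>\<Delta>[n]\<close> opposite to the vertices \<open>i \<noteq> k\<close>.\<close>

definition horn :: "nat \<Rightarrow> nat \<Rightarrow> (nat \<Rightarrow> nat) sset" where
  "horn n k = \<lparr>simplices = (\<lambda>m. {\<tau> \<in> Delta_hom m n. \<exists>i\<le>n. i \<noteq> k \<and> i \<notin> \<tau> ` {..m}}),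
               act = act (std_sset n)\<rparr>"

definition kan_complex :: "'a sset \<Rightarrow> bool" where
  "kan_complex F \<longleftrightarrow> simplicial_set F \<and>
     (\<forall>n k f. 1 \<le> n \<and> k \<le> n \<and> simplicial_map (horn n k) F f \<longrightarrow>
        (\<exists>g. simplicial_map (std_sset n) F g \<and>
             (\<forall>m. \<forall>\<tau>\<in>simplices (horn n k) m. g m \<tau> = f m \<tau>)))"

section \<open>Quotient spaces, homotopy equivalences and CW-complexes\<close>

definition quotient_top :: "'a topology \<Rightarrow> ('a \<times> 'a) set \<Rightarrow> 'a set topology" where
  "quotient_top X R =
     topology (\<lambda>U. U \<subseteq> topspace X // R \<and> openin X {x \<in> topspace X. R `` {x} \<in> U})"

lemma openin_quotient_top:
  "openin (quotient_top X R) U \<longleftrightarrow>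
     U \<subseteq> topspace X // R \<and> openin X {x \<in> topspace X. R `` {x} \<in> U}"
proof -
  have 1: "{x \<in> topspace X. R `` {x} \<in> S \<inter> T} =
      {x \<in> topspace X. R `` {x} \<in> S} \<inter> {x \<in> topspace X. R `` {x} \<in> T}" for S T
    by auto
  have 2: "{x \<in> topspace X. R `` {x} \<in> \<Union>K} = (\<Union>S\<in>K. {x \<in> topspace X. R `` {x} \<in> S})" for K
    by auto
  have "istopology (\<lambda>U. U \<subseteq> topspace X // R \<and> openin X {x \<in> topspace X. R `` {x} \<in> U})"
    unfolding istopology_def 1 2 by blast
  then show ?thesis
    by (simp add: quotient_top_def)
qed

lemma topspace_quotient_top [simp]: "topspace (quotient_top X R) = topspace X // R"
proof -
  have "{x \<in> topspace X. R `` {x} \<in> topspace X // R} = topspace X"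
    by (auto simp: quotient_def)
  then have "openin (quotient_top X R) (topspace X // R)"
    by (simp add: openin_quotient_top)
  then show ?thesis
    by (meson openin_quotient_top openin_subset openin_topspace subset_antisym)
qed

lemma quotient_map_quotient_top: "quotient_map X (quotient_top X R) (\<lambda>x. R `` {x})"
  by (auto simp: quotient_map_def openin_quotient_top quotient_def)

definition homotopy_equivalence_map :: "'a topology \<Rightarrow> 'b topology \<Rightarrow> ('a \<Rightarrow> 'b) \<Rightarrow> bool" where
  "homotopy_equivalence_map X Y f \<longleftrightarrow> continuous_map X Y f \<and>
     (\<exists>g. continuous_map Y X g \<and>
          homotopic_with (\<lambda>_. True) X X (g \<circ> f) id \<and>
          homotopic_with (\<lambda>_. True) Y Y (f \<circ> g) id)"

definition closed_disc :: "nat \<Rightarrow> (nat \<Rightarrow> real) set" where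
  "closed_disc n = {x \<in> topspace (Euclidean_space n). (\<Sum>i<n. (x i)\<^sup>2) \<le> 1}"

definition open_disc :: "nat \<Rightarrow> (nat \<Rightarrow> real) set" where
  "open_disc n = {x \<in> topspace (Euclidean_space n). (\<Sum>i<n. (x i)\<^sup>2) < 1}"

text \<open>Whitehead's definition. The set \<open>C\<close> consists of pairs \<open>(n, \<phi>)\<close> of a dimension and the
  characteristic map of an \<open>n\<close>-cell, the cell being \<open>\<phi> ` open_disc n\<close> and its closure
  \<open>\<phi> ` closed_disc n\<close>.\<close>

definition CW_complex :: "'a topology \<Rightarrow> bool" where
  "CW_complex X \<longleftrightarrow> Hausdorff_space X \<and>
     (\<exists>C :: (nat \<times> ((nat \<Rightarrow> real) \<Rightarrow> 'a)) set.
        (\<forall>(n, \<phi>)\<in>C. continuous_map (subtopology (Euclidean_space n) (closed_disc n)) X \<phi> \<and>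
                    embedding_map (subtopology (Euclidean_space n) (open_disc n)) X \<phi>) \<and>
        disjoint_family_on (\<lambda>(n, \<phi>). \<phi> ` open_disc n) C \<and>
        (\<Union>(n, \<phi>)\<in>C. \<phi> ` open_disc n) = topspace X \<and>
        (\<forall>(n, \<phi>)\<in>C. \<exists>D\<subseteq>C. finite D \<and> (\<forall>(m, \<psi>)\<in>D. m < n) \<and>
           \<phi> ` (closed_disc n - open_disc n) \<subseteq> (\<Union>(m, \<psi>)\<in>D. \<psi> ` open_disc m)) \<and>
        (\<forall>S\<subseteq>topspace X.
           closedin X S \<longleftrightarrow> (\<forall>(n, \<phi>)\<in>C. closedin X (S \<inter> \<phi> ` closed_disc n))))"

section \<open>Realization of a simplicial set along a cosimplicial space\<close>

text \<open>A cosimplicial space is given by spaces \<open>Y n\<close> and, for \<open>\<sigma> : [n] \<rightarrow> [m]\<close>, maps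
  \<open>Ym n m \<sigma> : Y n \<rightarrow> Y m\<close>. A point of the disjoint union is a triple \<open>(n, \<alpha>, a)\<close>.\<close>

definition presum :: "'a sset \<Rightarrow> (nat \<Rightarrow> 'b topology) \<Rightarrow> (nat \<times> 'a \<times> 'b) topology" where
  "presum F Y = sum_topology (\<lambda>n. prod_topology (discrete_topology (simplices F n)) (Y n)) UNIV"

definition gen_rel :: "'a sset \<Rightarrow> (nat \<Rightarrow> 'b topology) \<Rightarrow>
    (nat \<Rightarrow> nat \<Rightarrow> (nat \<Rightarrow> nat) \<Rightarrow> 'b \<Rightarrow> 'b) \<Rightarrow> ((nat \<times> 'a \<times> 'b) \<times> (nat \<times> 'a \<times> 'b)) set" where
  "gen_rel F Y Ym = {((n, act F n m \<sigma> \<alpha>, a), (m, \<alpha>, Ym n m \<sigma> a)) | n m \<sigma> \<alpha> a.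
     \<sigma> \<in> Delta_hom n m \<and> \<alpha> \<in> simplices F m \<and> a \<in> topspace (Y n)}"

definition real_rel :: "'a sset \<Rightarrow> (nat \<Rightarrow> 'b topology) \<Rightarrow>
    (nat \<Rightarrow> nat \<Rightarrow> (nat \<Rightarrow> nat) \<Rightarrow> 'b \<Rightarrow> 'b) \<Rightarrow> ((nat \<times> 'a \<times> 'b) \<times> (nat \<times> 'a \<times> 'b)) set" where
  "real_rel F Y Ym = (gen_rel F Y Ym \<union> (gen_rel F Y Ym)\<inverse>)\<^sup>*"

definition realization :: "'a sset \<Rightarrow> (nat \<Rightarrow> 'b topology) \<Rightarrow>
    (nat \<Rightarrow> nat \<Rightarrow> (nat \<Rightarrow> nat) \<Rightarrow> 'b \<Rightarrow> 'b) \<Rightarrow> (nat \<times> 'a \<times> 'b) set topology" where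
  "realization F Y Ym = quotient_top (presum F Y) (real_rel F Y Ym)"

text \<open>The map \<open>[(\<alpha>, a)] \<mapsto> [(\<alpha>, p n a)]\<close> between realizations induced by a natural family
  \<open>p n : Y n \<rightarrow> Z n\<close>; see \<open>realization_map_class\<close> below.\<close>

definition realization_map :: "'a sset \<Rightarrow> (nat \<Rightarrow> 'c topology) \<Rightarrow>
    (nat \<Rightarrow> nat \<Rightarrow> (nat \<Rightarrow> nat) \<Rightarrow> 'c \<Rightarrow> 'c) \<Rightarrow> (nat \<Rightarrow> 'b \<Rightarrow> 'c) \<Rightarrow>
    (nat \<times> 'a \<times> 'b) set \<Rightarrow> (nat \<times> 'a \<times> 'c) set" where
  "realization_map F Z Zm p c = real_rel F Z Zm `` ((\<lambda>(n, \<alpha>, a). (n, \<alpha>, p n a)) ` c)"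

lemma sym_real_rel: "sym (real_rel F Y Ym)"
  unfolding real_rel_def by (intro sym_rtrancl sym_Un_converse)

lemma realization_map_class:
  fixes F :: "'a sset" and Y :: "nat \<Rightarrow> 'b topology" and Z :: "nat \<Rightarrow> 'c topology"
  assumes p: "\<And>n a. a \<in> topspace (Y n) \<Longrightarrow> p n a \<in> topspace (Z n)"
    and nat: "\<And>n m \<sigma> a. \<lbrakk>\<sigma> \<in> Delta_hom n m; a \<in> topspace (Y n)\<rbrakk>
                 \<Longrightarrow> p m (Ym n m \<sigma> a) = Zm n m \<sigma> (p n a)"
  shows "realization_map F Z Zm p (real_rel F Y Ym `` {(n, \<alpha>, a)}) = real_rel F Z Zm `` {(n, \<alpha>, p n a)}"
proof -
  define P where "P = (\<lambda>(n, \<alpha>::'a, a). (n::nat, \<alpha>, p n a))"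
  have gen: "(P x, P y) \<in> gen_rel F Z Zm" if "(x, y) \<in> gen_rel F Y Ym" for x y :: "nat \<times> 'a \<times> 'b"
    using that p nat unfolding gen_rel_def P_def by fastforce
  have P: "(P x, P y) \<in> real_rel F Z Zm" if "(x, y) \<in> real_rel F Y Ym" for x y :: "nat \<times> 'a \<times> 'b"
    using that unfolding real_rel_def
  proof (induction rule: rtrancl_induct)
    case (step y z)
    then have "(P y, P z) \<in> gen_rel F Z Zm \<union> (gen_rel F Z Zm)\<inverse>"
      using gen by blast
    with step.IH show ?case
      by (rule rtrancl_into_rtrancl)
  qed simp
  have trans: "trans (real_rel F Z Zm)" and refl: "(x, x) \<in> real_rel F Y Ym" for x
    by (simp_all add: real_rel_def trans_rtrancl)
  have "real_rel F Z Zm `` (P ` (real_rel F Y Ym `` {x})) = real_rel F Z Zm `` {P x}" for x :: "nat \<times> 'a \<times> 'b"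
    using P [of x] refl [of x] transD [OF trans] symD [OF sym_real_rel, of _ _ F Z Zm] by blast
  from this [of "(n, \<alpha>, a)"] show ?thesis
    by (simp add: realization_map_def P_def)
qed

section \<open>The spaces of random variables and the standard simplices\<close>

text \<open>Points of \<open>nabla M n\<close> are a.e.-equality classes. Distance, functoriality and law are defined on
  chosen representatives \<open>rep A\<close>; independence of the choice is \<open>nabla_dist_class\<close>,
  \<open>nabla_map_class\<close>, \<open>law_class\<close>.\<close>

definition atomless :: "'w measure \<Rightarrow> bool" where
  "atomless M \<longleftrightarrow> (\<forall>A\<in>sets M. 0 < emeasure M A \<longrightarrow>
     (\<exists>B\<in>sets M. B \<subseteq> A \<and> 0 < emeasure M B \<and> emeasure M B < emeasure M A))"

definition rv :: "'w measure \<Rightarrow> nat \<Rightarrow> ('w \<Rightarrow> nat) set" where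
  "rv M n = measurable M (count_space {..n})"

definition ae_rel :: "'w measure \<Rightarrow> nat \<Rightarrow> (('w \<Rightarrow> nat) \<times> ('w \<Rightarrow> nat)) set" where
  "ae_rel M n = {(f, g). f \<in> rv M n \<and> g \<in> rv M n \<and> (AE t in M. f t = g t)}"

definition rep :: "('w \<Rightarrow> nat) set \<Rightarrow> 'w \<Rightarrow> nat" where
  "rep A = (SOME f. f \<in> A)"

definition nabla_dist :: "'w measure \<Rightarrow> ('w \<Rightarrow> nat) set \<Rightarrow> ('w \<Rightarrow> nat) set \<Rightarrow> real" where
  "nabla_dist M A B = measure M {t \<in> space M. rep A t \<noteq> rep B t}"

definition nabla :: "'w measure \<Rightarrow> nat \<Rightarrow> ('w \<Rightarrow> nat) set topology" where
  "nabla M n = Metric_space.mtopology (rv M n // ae_rel M n) (nabla_dist M)"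

definition nabla_map :: "'w measure \<Rightarrow> nat \<Rightarrow> nat \<Rightarrow> (nat \<Rightarrow> nat) \<Rightarrow> ('w \<Rightarrow> nat) set \<Rightarrow> ('w \<Rightarrow> nat) set" where
  "nabla_map M n m \<sigma> A = ae_rel M m `` {\<sigma> \<circ> rep A}"

definition simplex_top :: "nat \<Rightarrow> (nat \<Rightarrow> real) topology" where
  "simplex_top n = subtopology (powertop_real UNIV) (standard_simplex n)"

definition simplex_top_map :: "nat \<Rightarrow> nat \<Rightarrow> (nat \<Rightarrow> nat) \<Rightarrow> (nat \<Rightarrow> real) \<Rightarrow> nat \<Rightarrow> real" where
  "simplex_top_map n m \<sigma> x = (\<lambda>i. \<Sum>j | j \<le> n \<and> \<sigma> j = i. x j)"

definition law :: "'w measure \<Rightarrow> nat \<Rightarrow> ('w \<Rightarrow> nat) set \<Rightarrow> nat \<Rightarrow> real" where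
  "law M n A = (\<lambda>i. measure M {t \<in> space M. rep A t = i})"

definition L_space :: "'w measure \<Rightarrow> 'a sset \<Rightarrow> (nat \<times> 'a \<times> ('w \<Rightarrow> nat) set) set topology" where
  "L_space M F = realization F (nabla M) (nabla_map M)"

definition geom_realization :: "'a sset \<Rightarrow> (nat \<times> 'a \<times> (nat \<Rightarrow> real)) set topology" where
  "geom_realization F = realization F simplex_top simplex_top_map"

definition law_map :: "'w measure \<Rightarrow> 'a sset \<Rightarrow>
    (nat \<times> 'a \<times> ('w \<Rightarrow> nat) set) set \<Rightarrow> (nat \<times> 'a \<times> (nat \<Rightarrow> real)) set" where
  "law_map M F = realization_map F simplex_top simplex_top_map (law M)"

text \<open>Simplices are extensional functions, so that equal continuous maps are equal elements.\<close>

definition Sing_RV :: "'w measure \<Rightarrow> 'x topology \<Rightarrow> (('w \<Rightarrow> nat) set \<Rightarrow> 'x) sset" where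
  "Sing_RV M X =
     \<lparr>simplices = (\<lambda>n. {f \<in> extensional (topspace (nabla M n)). continuous_map (nabla M n) X f}),
      act = (\<lambda>n m \<sigma> f. restrict (f \<circ> nabla_map M n m \<sigma>) (topspace (nabla M n)))\<rparr>"

subsection \<open>Independence of the choice of representatives\<close>

lemma equiv_ae_rel: "equiv (rv M n) (ae_rel M n)"
proof (intro equivI)
  show "trans (ae_rel M n)"
  proof (rule transI)
    fix f g h assume "(f, g) \<in> ae_rel M n" and "(g, h) \<in> ae_rel M n"
    then have "f \<in> rv M n" "h \<in> rv M n" "AE t in M. f t = g t" "AE t in M. g t = h t"
      by (auto simp: ae_rel_def)
    moreover from this(3,4) have "AE t in M. f t = h t"
      by eventually_elim simp
    ultimately show "(f, h) \<in> ae_rel M n"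
      by (simp add: ae_rel_def)
  qed
  show "sym (ae_rel M n)"
    by (rule symI) (auto simp: ae_rel_def eq_commute)
qed (auto simp: ae_rel_def refl_on_def)

lemma rep_class:
  assumes "f \<in> rv M n"
  shows "rep (ae_rel M n `` {f}) \<in> rv M n" "AE t in M. f t = rep (ae_rel M n `` {f}) t"
proof -
  have "f \<in> ae_rel M n `` {f}"
    using assms by (simp add: ae_rel_def)
  then have "rep (ae_rel M n `` {f}) \<in> ae_rel M n `` {f}"
    unfolding rep_def by (rule someI [where P = "\<lambda>x. x \<in> ae_rel M n `` {f}"])
  then show "rep (ae_rel M n `` {f}) \<in> rv M n" "AE t in M. f t = rep (ae_rel M n `` {f}) t"
    by (auto simp: ae_rel_def)
qed

lemma rep_in:
  assumes "A \<in> rv M n // ae_rel M n"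
  shows "rep A \<in> rv M n" "A = ae_rel M n `` {rep A}"
proof -
  from assms obtain f where f: "f \<in> rv M n" "A = ae_rel M n `` {f}"
    by (rule quotientE)
  with rep_class [of f M n] show "rep A \<in> rv M n"
    by simp
  show "A = ae_rel M n `` {rep A}"
    using rep_class [OF f(1)] f equiv_class_eq [OF equiv_ae_rel, of f "rep A" M n]
    by (simp add: ae_rel_def)
qed

lemma rv_measurable:
  assumes "f \<in> rv M n" shows "f \<in> measurable M (count_space UNIV)"
  using assms unfolding rv_def
  by (rule measurable_compose) (simp add: measurable_count_space_eq1)

lemma rv_neq_measurable:
  assumes "f \<in> rv M n" "g \<in> rv M n"
  shows "{t \<in> space M. f t \<noteq> g t} \<in> sets M"
proof -
  note [measurable] = rv_measurable [OF assms(1)] rv_measurable [OF assms(2)]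
  have "{t \<in> space M. f t \<noteq> g t} = (\<Union>i. {t \<in> space M. f t = i} - {t \<in> space M. g t = i})"
    by auto
  also have "\<dots> \<in> sets M"
    by (intro sets.countable_UN image_subsetI sets.Diff) measurable
  finally show ?thesis .
qed

lemma nabla_dist_class:
  assumes "f \<in> rv M n" "g \<in> rv M n"
  shows "nabla_dist M (ae_rel M n `` {f}) (ae_rel M n `` {g}) = measure M {t \<in> space M. f t \<noteq> g t}"
proof -
  note rep = rep_class [OF assms(1)] rep_class [OF assms(2)]
  have "AE t in M. (t \<in> {t \<in> space M. rep (ae_rel M n `` {f}) t \<noteq> rep (ae_rel M n `` {g}) t}) =
                   (t \<in> {t \<in> space M. f t \<noteq> g t})"
    using rep(2,4) by eventually_elim simp
  then show ?thesis
    unfolding nabla_dist_def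
    by (rule measure_eq_AE) (rule rv_neq_measurable [OF rep(1,3)] rv_neq_measurable [OF assms])+
qed

lemma Metric_space_nabla:
  assumes "prob_space M"
  shows "Metric_space (rv M n // ae_rel M n) (nabla_dist M)"
proof
  interpret prob_space M by fact
  fix A B C
  show "0 \<le> nabla_dist M A B" "nabla_dist M A B = nabla_dist M B A"
    by (simp_all add: nabla_dist_def eq_commute)
  assume A: "A \<in> rv M n // ae_rel M n" and B: "B \<in> rv M n // ae_rel M n"
  have "nabla_dist M A B = 0 \<longleftrightarrow> (AE t in M. \<not> rep A t \<noteq> rep B t)"
    using prob_eq_0 [OF rv_neq_measurable [OF rep_in(1) [OF A] rep_in(1) [OF B]]] AE_space
    by (auto simp: nabla_dist_def elim!: eventually_elim2)
  also have "\<dots> \<longleftrightarrow> (rep A, rep B) \<in> ae_rel M n"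
    by (simp add: ae_rel_def rep_in(1) [OF A] rep_in(1) [OF B])
  also have "\<dots> \<longleftrightarrow> A = B"
    using eq_equiv_class_iff [OF equiv_ae_rel rep_in(1) [OF A] rep_in(1) [OF B]]
      rep_in(2) [OF A] rep_in(2) [OF B] by simp
  finally show "nabla_dist M A B = 0 \<longleftrightarrow> A = B" .
  assume C: "C \<in> rv M n // ae_rel M n"
  note neq = rv_neq_measurable [OF rep_in(1) [OF A] rep_in(1) [OF B]]
    rv_neq_measurable [OF rep_in(1) [OF B] rep_in(1) [OF C]]
  have "nabla_dist M A C \<le> prob ({t \<in> space M. rep A t \<noteq> rep B t} \<union> {t \<in> space M. rep B t \<noteq> rep C t})"
    unfolding nabla_dist_def by (rule finite_measure_mono) (use neq in auto)
  also have "\<dots> \<le> nabla_dist M A B + nabla_dist M B C"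
    unfolding nabla_dist_def by (rule measure_Un_le) (fact neq)+
  finally show "nabla_dist M A C \<le> nabla_dist M A B + nabla_dist M B C" .
qed

lemma topspace_nabla:
  "prob_space M \<Longrightarrow> topspace (nabla M n) = rv M n // ae_rel M n"
  by (simp add: nabla_def Metric_space.topspace_mtopology Metric_space_nabla)

lemma nabla_map_rv:
  assumes "\<sigma> \<in> Delta_hom n m" "f \<in> rv M n" shows "\<sigma> \<circ> f \<in> rv M m"
  using assms unfolding rv_def Delta_hom_def
  by (auto intro!: measurable_comp [of f M "count_space {..n}"])

lemma nabla_map_class:
  assumes \<sigma>: "\<sigma> \<in> Delta_hom n m" and f: "f \<in> rv M n"
  shows "nabla_map M n m \<sigma> (ae_rel M n `` {f}) = ae_rel M m `` {\<sigma> \<circ> f}"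
proof -
  have "AE t in M. \<sigma> (rep (ae_rel M n `` {f}) t) = \<sigma> (f t)"
    using rep_class(2) [OF f] by eventually_elim simp
  then have "(\<sigma> \<circ> rep (ae_rel M n `` {f}), \<sigma> \<circ> f) \<in> ae_rel M m"
    using nabla_map_rv [OF \<sigma> f] nabla_map_rv [OF \<sigma> rep_class(1) [OF f]] by (simp add: ae_rel_def)
  then show ?thesis
    unfolding nabla_map_def by (rule equiv_class_eq [OF equiv_ae_rel])
qed

lemma law_class:
  assumes "f \<in> rv M n"
  shows "law M n (ae_rel M n `` {f}) i = measure M {t \<in> space M. f t = i}"
proof -
  note [measurable] = rv_measurable [OF assms] rv_measurable [OF rep_class(1) [OF assms]]
  have "AE t in M. (t \<in> {t \<in> space M. rep (ae_rel M n `` {f}) t = i}) = (t \<in> {t \<in> space M. f t = i})"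
    using rep_class(2) [OF assms] by eventually_elim simp
  then show ?thesis
    unfolding law_def by (rule measure_eq_AE) measurable
qed

lemma law_in_simplex:
  assumes "prob_space M" and A: "A \<in> topspace (nabla M n)"
  shows "law M n A \<in> topspace (simplex_top n)"
proof -
  interpret prob_space M by fact
  have A': "A \<in> rv M n // ae_rel M n"
    using assms topspace_nabla by auto
  have r: "rep A t \<le> n" if "t \<in> space M" for t
    using measurable_space [OF rep_in(1) [OF A', unfolded rv_def] that] by simp
  note [measurable] = rv_measurable [OF rep_in(1) [OF A']]
  have "(\<Sum>i\<le>n. law M n A i) = prob (\<Union>i\<le>n. {t \<in> space M. rep A t = i})"
    unfolding law_def by (rule finite_measure_finite_Union [symmetric]) (auto simp: disjoint_family_on_def)
  also have "(\<Union>i\<le>n. {t \<in> space M. rep A t = i}) = space M"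
    using r by auto
  finally have "(\<Sum>i\<le>n. law M n A i) = 1"
    by (simp add: prob_space)
  moreover have "law M n A i = 0" if "i > n" for i
  proof -
    have "{t \<in> space M. rep A t = i} = {}"
      using r that by fastforce
    then show ?thesis by (simp only: law_def measure_empty)
  qed
  ultimately show ?thesis
    by (simp add: simplex_top_def standard_simplex_def law_def)
qed

lemma law_natural:
  assumes "prob_space M" and \<sigma>: "\<sigma> \<in> Delta_hom n m" and A: "A \<in> topspace (nabla M n)"
  shows "law M m (nabla_map M n m \<sigma> A) = simplex_top_map n m \<sigma> (law M n A)"
proof
  fix i
  interpret prob_space M by fact
  have A': "A \<in> rv M n // ae_rel M n"
    using assms topspace_nabla by auto
  have r: "rep A t \<le> n" if "t \<in> space M" for t
    using measurable_space [OF rep_in(1) [OF A', unfolded rv_def] that] by simp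
  note [measurable] = rv_measurable [OF rep_in(1) [OF A']]
  have "law M m (nabla_map M n m \<sigma> A) i = prob {t \<in> space M. \<sigma> (rep A t) = i}"
    unfolding nabla_map_def using law_class [OF nabla_map_rv [OF \<sigma> rep_in(1) [OF A']]] by simp
  also have "{t \<in> space M. \<sigma> (rep A t) = i} = (\<Union>j\<in>{j. j \<le> n \<and> \<sigma> j = i}. {t \<in> space M. rep A t = j})"
    using r by auto
  also have "prob \<dots> = (\<Sum>j | j \<le> n \<and> \<sigma> j = i. law M n A j)"
    unfolding law_def by (rule finite_measure_finite_Union) (auto simp: disjoint_family_on_def)
  finally show "law M m (nabla_map M n m \<sigma> A) i = simplex_top_map n m \<sigma> (law M n A) i"
    by (simp add: simplex_top_map_def)
qed

lemma law_map_class: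
  assumes "prob_space M"
  shows "law_map M F (real_rel F (nabla M) (nabla_map M) `` {(n, \<alpha>, a)}) =
         real_rel F simplex_top simplex_top_map `` {(n, \<alpha>, law M n a)}"
  unfolding law_map_def
  by (rule realization_map_class) (use assms law_in_simplex law_natural in auto)

end

theory Submission
  imports Defs
begin

text \<open>
  Since \<open>\<Omega>\<close> is atomless, it carries a uniformly distributed \<open>U : \<Omega> \<rightarrow> [0,1)\<close>. A point
  \<open>x \<in> \<Delta>\<^sub>n\<close> is the same thing as the increasing step function \<open>step x : [0,1) \<rightarrow> [n]\<close> taking the value
  \<open>i\<close> on an interval of length \<open>x i\<close>, and because the morphisms of the simplex category are increasing
  this description is natural: \<open>step (\<Delta>(\<sigma>) x) = \<sigma> \<circ> step x\<close> (\<open>step_natural\<close>). Everything rests on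
  this naturality.

  \<^emph>\<open>Homotopy equivalence.\<close> The maps \<open>x \<mapsto> step x \<circ> U\<close> are continuous and natural, and have law \<open>x\<close>, so they
  induce a section of the probability-law map. Replacing \<open>f\<close> on the event \<open>U < t\<close> by the
  rearrangement \<open>step (law f) \<circ> U\<close> is, for each \<open>t\<close>, again natural in \<open>[n]\<close>; letting \<open>t\<close> run from 0 to 1
  joins the identity of \<open>L(F)\<close> to the section composed with the law map
  (\<open>homotopy_equivalence_law_map\<close>).

  \<^emph>\<open>CW structure.\<close> It remains to see that \<open>|F|\<close> itself is a CW-complex, with one cell for each
  nondegenerate simplex. For \<open>u\<^sub>0 \<le> \<dots> \<le> u\<^sub>m\<close> in \<open>[0,1)\<close> the assignment
  \<open>(\<alpha>, a) \<mapsto> \<alpha> \<cdot> (i \<mapsto> step a (u\<^sub>i))\<close> is, by naturality, well defined on \<open>|F|\<close> with values in \<open>F\<^sub>m\<close>.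
  These sampling maps show that a representative by a nondegenerate simplex and an interior point is
  unique (\<open>compare_normal_form\<close>), so that the open cells are disjoint, and the boundary of a cell
  meets only finitely many open cells, all of lower dimension. Averaging them over a random choice of the \<open>u\<^sub>i\<close>
  yields enough continuous real functions to make \<open>|F|\<close> Hausdorff
  (\<open>Hausdorff_geom_realization\<close>), and a radial map \<open>disc_map\<close> from the disc to the simplex
  supplies the characteristic maps.

  \<^emph>\<open>Kan property.\<close> A map from the horn \<open>\<Lambda>\<^sub>k[n]\<close> to \<open>Sing\<^sub>R\<^sub>V X\<close> amounts to a continuous map to \<open>X\<close> from the
  closed set of those \<open>f \<in> \<nabla>\<^sub>n\<close> that almost surely omit some value \<open>i \<noteq> k\<close>. This set is a
  retract of \<open>\<nabla>\<^sub>n\<close>: with \<open>m\<close> the least of the probabilities of the values \<open>i \<noteq> k\<close>, the part of measure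
  \<open>m\<close> of each \<open>f = i\<close> on which \<open>U\<close> is smallest is sent to \<open>k\<close>
  (\<open>continuous_horn_retraction\<close>). Composing with the retraction fills the horn.
\<close>

section \<open>A uniformly distributed random variable\<close>

text \<open>The variable \<open>U\<close> is built from a chain of events of all measures. Requiring
  comparable events to be equal or of different measure lets limits of chain members be adjoined without
  comparing events that differ by a null set.\<close>

definition strict_cmp :: "'w measure \<Rightarrow> 'w set \<Rightarrow> 'w set \<Rightarrow> bool" where
  "strict_cmp M A B \<longleftrightarrow>
     A = B \<or> (A \<subseteq> B \<and> measure M A < measure M B) \<or> (B \<subseteq> A \<and> measure M B < measure M A)"

text \<open>A chain for this comparison to which no further event can be added.\<close>

definition max_chain :: "'w measure \<Rightarrow> 'w set set \<Rightarrow> bool" where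
  "max_chain M C \<longleftrightarrow> C \<subseteq> sets M \<and> (\<forall>A\<in>C. \<forall>B\<in>C. strict_cmp M A B) \<and>
     (\<forall>D\<in>sets M. (\<forall>A\<in>C. strict_cmp M A D) \<longrightarrow> D \<in> C)"

lemma strict_cmp_commute: "strict_cmp M A B \<longleftrightarrow> strict_cmp M B A"
  by (auto simp: strict_cmp_def)

lemma ex_max_chain: "\<exists>C. max_chain M C"
proof -
  define G where "G = {C. C \<subseteq> sets M \<and> (\<forall>A\<in>C. \<forall>B\<in>C. strict_cmp M A B)}"
  have "\<exists>C\<in>G. \<forall>X\<in>G. C \<subseteq> X \<longrightarrow> X = C"
  proof (rule subset_Zorn')
    fix \<C> assume "subset.chain G \<C>"
    then have sub: "\<C> \<subseteq> G" and tot: "\<And>X Y. X \<in> \<C> \<Longrightarrow> Y \<in> \<C> \<Longrightarrow> X \<subseteq> Y \<or> Y \<subseteq> X"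
      by (auto simp: subset_chain_def)
    have "strict_cmp M A B" if "X \<in> \<C>" "A \<in> X" "Y \<in> \<C>" "B \<in> Y" for A B X Y
      using tot[OF that(1,3)] sub that unfolding G_def by blast
    then show "\<Union>\<C> \<in> G"
      using sub unfolding G_def by blast
  qed
  then obtain C where C: "C \<in> G" and max: "\<And>X. X \<in> G \<Longrightarrow> C \<subseteq> X \<Longrightarrow> X = C"
    by blast
  have "D \<in> C" if D: "D \<in> sets M" "\<forall>A\<in>C. strict_cmp M A D" for D
  proof -
    have "strict_cmp M D A" if "A \<in> C" for A
      using D that strict_cmp_commute[of M D A] by simp
    moreover have "strict_cmp M D D"
      by (simp add: strict_cmp_def)
    ultimately have "insert D C \<in> G"
      using C D unfolding G_def by blast
    then show ?thesis
      using max by blast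
  qed
  then show ?thesis
    using C unfolding max_chain_def G_def by blast
qed

text \<open>A random variable with the uniform law on the unit interval. Asking \<open>U < 1\<close> everywhere, not
  only almost surely, makes the step functions below total on the range of \<open>U\<close>.\<close>

locale uniform_rv = prob_space M for M :: "'w measure" +
  fixes U :: "'w \<Rightarrow> real"
  assumes U_measurable [measurable]: "U \<in> borel_measurable M"
    and U_ge_0: "\<And>\<omega>. 0 \<le> U \<omega>"
    and U_less_1: "\<And>\<omega>. U \<omega> < 1"
    and U_uniform: "\<And>t. 0 \<le> t \<Longrightarrow> t \<le> 1 \<Longrightarrow> prob {\<omega> \<in> space M. U \<omega> < t} = t"

context prob_space
begin

lemma max_chain_compl:
  assumes "max_chain M C"
  shows "max_chain M ((-) (space M) ` C)"
proof -
  have sets: "C \<subseteq> sets M" and cmp: "\<And>A B. A \<in> C \<Longrightarrow> B \<in> C \<Longrightarrow> strict_cmp M A B"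
    and ins: "\<And>D. D \<in> sets M \<Longrightarrow> (\<And>A. A \<in> C \<Longrightarrow> strict_cmp M A D) \<Longrightarrow> D \<in> C"
    using assms by (auto simp: max_chain_def)
  have compl: "strict_cmp M (space M - A) (space M - B)"
    if "A \<in> sets M" "B \<in> sets M" "strict_cmp M A B" for A B
    using that by (auto simp: strict_cmp_def prob_compl)
  have "D \<in> (-) (space M) ` C"
    if D: "D \<in> sets M" and *: "\<forall>A\<in>(-) (space M) ` C. strict_cmp M A D" for D
  proof -
    have "strict_cmp M A (space M - D)" if "A \<in> C" for A
    proof -
      have "strict_cmp M (space M - A) D"
        using * that by blast
      then have "strict_cmp M (space M - (space M - A)) (space M - D)"
        using sets that D by (intro compl) auto
      moreover have "space M - (space M - A) = A"
        using sets that sets.sets_into_space by blast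
      ultimately show ?thesis by simp
    qed
    then have "space M - D \<in> C"
      using D by (intro ins) auto
    moreover have "D = space M - (space M - D)"
      using D sets.sets_into_space by blast
    ultimately show ?thesis by blast
  qed
  then show ?thesis
    unfolding max_chain_def using sets cmp compl subsetD[OF sets] by (simp add: image_subset_iff)
qed

text \<open>If the supremum of the measures at most \<open>t\<close> were not attained in the chain, the union of a
  sequence approaching it could be added.\<close>

lemma max_chain_lower:
  assumes C: "max_chain M C" and t: "0 \<le> t"
  shows "\<exists>D\<in>C. prob D \<le> t \<and> (\<forall>A\<in>C. prob A \<le> t \<longrightarrow> A \<subseteq> D)"
proof -
  have sets: "C \<subseteq> sets M" and cmp: "\<And>A B. A \<in> C \<Longrightarrow> B \<in> C \<Longrightarrow> strict_cmp M A B"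
    and ins: "\<And>D. D \<in> sets M \<Longrightarrow> (\<And>A. A \<in> C \<Longrightarrow> strict_cmp M A D) \<Longrightarrow> D \<in> C"
    using C by (auto simp: max_chain_def)
  define S where "S = {A \<in> C. prob A \<le> t}"
  have "S \<noteq> {}"
  proof
    assume "S = {}"
    then have "strict_cmp M A {}" if "A \<in> C" for A
      using that t by (fastforce simp: S_def strict_cmp_def)
    then have "{} \<in> C"
      by (intro ins) auto
    then show False
      using t \<open>S = {}\<close> by (auto simp: S_def)
  qed
  have bdd: "bdd_above (prob ` S)"
    by (intro bdd_aboveI[of _ t]) (auto simp: S_def)
  define a where "a = Sup (prob ` S)"
  have le_a: "prob A \<le> a" if "A \<in> S" for A
    unfolding a_def using that bdd by (intro cSup_upper) auto
  have a_le: "a \<le> t"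
    unfolding a_def using \<open>S \<noteq> {}\<close> by (intro cSup_least) (auto simp: S_def)
  have "\<exists>D\<in>S. prob D = a"
  proof (rule ccontr)
    assume "\<not> ?thesis"
    then have less: "prob A < a" if "A \<in> S" for A
      using le_a[OF that] that by force
    have "\<exists>A\<in>S. a - 1 / Suc n < prob A" for n
      using less_cSup_iff[OF _ bdd, of "a - 1 / Suc n"] \<open>S \<noteq> {}\<close> by (auto simp: a_def)
    then obtain A where A: "\<And>n. A n \<in> S" "\<And>n. a - 1 / Suc n < prob (A n)"
      by metis
    define D where "D = (\<Union>n. A n)"
    define B where "B = (\<lambda>n. \<Union>k\<le>n. A k)"
    have B: "B n \<in> S" for n
    proof (induction n)
      case (Suc n)
      have "B (Suc n) = B n \<union> A (Suc n)"
        by (auto simp: B_def le_Suc_eq)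
      moreover have "strict_cmp M (B n) (A (Suc n))"
        using Suc A(1)[of "Suc n"] cmp by (auto simp: S_def)
      ultimately have "B (Suc n) = B n \<or> B (Suc n) = A (Suc n)"
        by (auto simp: strict_cmp_def)
      then show ?case
        using Suc A(1) by metis
    qed (simp add: B_def A)
    have Dsets: "D \<in> sets M"
      using A sets unfolding D_def S_def by blast
    have "(\<lambda>n. prob (B n)) \<longlonglongrightarrow> prob (\<Union>n. B n)"
    proof (rule finite_Lim_measure_incseq)
      show "range B \<subseteq> sets M"
        using B sets by (auto simp: S_def)
      show "incseq B"
        by (auto simp: incseq_def B_def intro: order_trans)
    qed
    then have "prob (\<Union>n. B n) \<le> a"
      by (rule LIMSEQ_le_const2) (use B le_a in auto)
    moreover have "(\<Union>n. B n) = D"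
      by (auto simp: B_def D_def)
    ultimately have Da: "prob D \<le> a"
      by simp
    have Aprob: "prob (A n) \<le> prob D" for n
      using Dsets by (intro finite_measure_mono) (auto simp: D_def)
    have "strict_cmp M X D" if X: "X \<in> C" for X
    proof (cases "X \<in> S")
      case True
      then obtain n where "1 / Suc n < a - prob X"
        using nat_approx_posE[of "a - prob X"] less by (metis diff_gt_0_iff_gt)
      then have n: "prob X < prob (A n)"
        using A(2)[of n] by linarith
      moreover have "strict_cmp M X (A n)"
        using cmp X A(1) by (auto simp: S_def)
      ultimately have "X \<subseteq> A n"
        by (auto simp: strict_cmp_def)
      then have "X \<subseteq> D"
        by (auto simp: D_def)
      then show ?thesis
        using n Aprob[of n] by (simp add: strict_cmp_def)
    next
      case False
      then have Xt: "t < prob X"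
        using X by (auto simp: S_def)
      have "A n \<subseteq> X" for n
        using cmp[of "A n" X] A(1)[of n] X Xt by (auto simp: S_def strict_cmp_def)
      then show ?thesis
        using Da a_le Xt by (auto simp: strict_cmp_def D_def)
    qed
    then have "D \<in> C"
      using Dsets by (intro ins)
    then have "D \<in> S"
      using Da a_le by (simp add: S_def)
    then obtain n where "1 / Suc n < a - prob D"
      using nat_approx_posE[of "a - prob D"] less by (metis diff_gt_0_iff_gt)
    then show False
      using A(2)[of n] Aprob[of n] by linarith
  qed
  then obtain D where D: "D \<in> C" "prob D \<le> t" "prob D = a"
    by (auto simp: S_def)
  have "X \<subseteq> D" if "X \<in> C" "prob X \<le> t" for X
    using cmp[OF that(1) D(1)] le_a[of X] that D by (auto simp: S_def strict_cmp_def)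
  then show ?thesis
    using D by blast
qed

lemma max_chain_upper:
  assumes C: "max_chain M C" and t: "t \<le> 1"
  shows "\<exists>E\<in>C. t \<le> prob E \<and> (\<forall>A\<in>C. t \<le> prob A \<longrightarrow> E \<subseteq> A)"
proof -
  have sets: "C \<subseteq> sets M"
    using C by (simp add: max_chain_def)
  obtain E where E: "E \<in> C" "prob (space M - E) \<le> 1 - t"
    and max: "\<And>A. A \<in> C \<Longrightarrow> prob (space M - A) \<le> 1 - t \<Longrightarrow> space M - A \<subseteq> space M - E"
    using max_chain_lower[OF max_chain_compl[OF C], of "1 - t"] t by auto
  have compl: "prob (space M - A) = 1 - prob A" "A \<subseteq> space M" if "A \<in> C" for A
    using that sets prob_compl sets.sets_into_space by blast+
  show ?thesis
    using E compl max by (intro bexI[of _ E]) (auto; blast)+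
qed

text \<open>Otherwise there is a gap around \<open>t\<close> in the chain, and atomlessness inserts an event into it.\<close>

lemma max_chain_attains:
  assumes C: "max_chain M C" and atomless: "atomless M" and t: "0 \<le> t" "t \<le> 1"
  shows "\<exists>A\<in>C. prob A = t"
proof (rule ccontr)
  assume none: "\<not> ?thesis"
  have sets: "C \<subseteq> sets M" and cmp: "\<And>A B. A \<in> C \<Longrightarrow> B \<in> C \<Longrightarrow> strict_cmp M A B"
    and ins: "\<And>D. D \<in> sets M \<Longrightarrow> (\<And>A. A \<in> C \<Longrightarrow> strict_cmp M A D) \<Longrightarrow> D \<in> C"
    using C by (auto simp: max_chain_def)
  obtain D where D: "D \<in> C" "prob D \<le> t" and D_max: "\<And>A. A \<in> C \<Longrightarrow> prob A \<le> t \<Longrightarrow> A \<subseteq> D"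
    using max_chain_lower[OF C t(1)] by blast
  obtain E where E: "E \<in> C" "t \<le> prob E" and E_min: "\<And>A. A \<in> C \<Longrightarrow> t \<le> prob A \<Longrightarrow> E \<subseteq> A"
    using max_chain_upper[OF C t(2)] by blast
  have lt: "prob D < t" "t < prob E"
    using none D E by (metis order_le_imp_less_or_eq)+
  have DE: "D \<subseteq> E" and DEs: "D \<in> sets M" "E \<in> sets M"
    using cmp[OF D(1) E(1)] lt sets D E by (auto simp: strict_cmp_def)
  have pED: "prob (E - D) = prob E - prob D"
    using DE DEs by (simp add: finite_measure_Diff)
  then have "0 < emeasure M (E - D)"
    using lt by (simp add: emeasure_eq_measure)
  then obtain B where B: "B \<in> sets M" "B \<subseteq> E - D" "0 < emeasure M B" "emeasure M B < emeasure M (E - D)"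
    using atomless DEs unfolding atomless_def by blast
  then have pB: "0 < prob B" "prob B < prob E - prob D"
    by (simp_all add: emeasure_eq_measure pED ennreal_less_iff)
  have pDB: "prob (D \<union> B) = prob D + prob B"
    using B DEs by (intro finite_measure_Union) auto
  have DBE: "D \<union> B \<subseteq> E"
    using B DE by auto
  have "strict_cmp M X (D \<union> B)" if X: "X \<in> C" for X
  proof (cases "prob X \<le> t")
    case True
    then have "X \<subseteq> D"
      using D_max X by blast
    moreover from this have "prob X \<le> prob D"
      using DEs by (intro finite_measure_mono)
    ultimately show ?thesis
      using pB pDB by (auto simp: strict_cmp_def)
  next
    case False
    then have "E \<subseteq> X"
      using E_min X by auto
    moreover from this have "prob E \<le> prob X"
      using X sets by (intro finite_measure_mono) auto
    ultimately show ?thesis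
      using pB pDB DBE by (auto simp: strict_cmp_def)
  qed
  then have DB: "D \<union> B \<in> C"
    using B DEs by (intro ins) auto
  show False
  proof (cases "prob (D \<union> B) \<le> t")
    case True
    then have "prob (D \<union> B) \<le> prob D"
      using D_max[OF DB] DEs by (intro finite_measure_mono)
    then show False
      using pB pDB by simp
  next
    case False
    then have "prob E \<le> prob (D \<union> B)"
      using E_min[OF DB] DEs B by (intro finite_measure_mono) auto
    then show False
      using pB pDB by simp
  qed
qed

text \<open>The maximal chain contains sets \<open>A t\<close> of every measure \<open>t\<close>, increasing in \<open>t\<close>; a point is sent to
  the infimum of the rational \<open>q\<close> for which it lies in \<open>A q\<close>.\<close>

proposition ex_uniform_rv:
  assumes "atomless M"
  shows "\<exists>U. uniform_rv M U"
proof -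
  obtain C where C: "max_chain M C"
    using ex_max_chain by blast
  have sets: "C \<subseteq> sets M" and cmp: "\<And>A B. A \<in> C \<Longrightarrow> B \<in> C \<Longrightarrow> strict_cmp M A B"
    using C by (auto simp: max_chain_def)
  obtain A where A: "\<And>t. 0 \<le> t \<Longrightarrow> t \<le> 1 \<Longrightarrow> A t \<in> C" "\<And>t. 0 \<le> t \<Longrightarrow> t \<le> 1 \<Longrightarrow> prob (A t) = t"
    using max_chain_attains[OF C assms] by metis
  have A_mono: "A s \<subseteq> A t" if "0 \<le> s" "s < t" "t \<le> 1" for s t
    using cmp[of "A s" "A t"] A[of s] A[of t] that by (auto simp: strict_cmp_def)
  define Q where "Q = \<rat> \<inter> {0..1::real}"
  define V where "V = (\<lambda>\<omega>. Inf (insert 1 {q \<in> Q. \<omega> \<in> A q}))"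
  have bdd: "bdd_below (insert 1 {q \<in> Q. \<omega> \<in> A q})" for \<omega>
    by (intro bdd_belowI[of _ 0]) (auto simp: Q_def)
  have V_less: "V \<omega> < t \<longleftrightarrow> 1 < t \<or> (\<exists>q\<in>Q. q < t \<and> \<omega> \<in> A q)" for \<omega> t
    unfolding V_def using bdd by (subst cInf_less_iff) auto
  have V0: "0 \<le> V \<omega>" for \<omega>
    using V_less[of \<omega> 0] by (force simp: Q_def)
  have Asets: "A q \<in> sets M" if "q \<in> Q" for q
    using that A sets by (auto simp: Q_def)
  have V_set: "{\<omega> \<in> space M. V \<omega> < t} = (if 1 < t then space M else (\<Union>q\<in>{q\<in>Q. q < t}. A q))" for t
    by (auto simp: V_less dest: subsetD[OF sets.sets_into_space[OF Asets]])
  have count: "countable {q\<in>Q. q < t}" for t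
    unfolding Q_def by (rule countable_subset[OF _ countable_rat]) auto
  have Vmeas: "V \<in> borel_measurable M"
    by (rule borel_measurableI_less) (auto simp: V_set intro!: sets.countable_UN' count Asets)
  have Vprob: "prob {\<omega> \<in> space M. V \<omega> < t} = t" if t: "0 \<le> t" "t \<le> 1" for t
  proof (rule antisym)
    have m: "{\<omega> \<in> space M. V \<omega> < t} \<in> sets M"
      using Vmeas by measurable
    have At: "A t \<in> sets M"
      using A t sets by blast
    have "A q \<subseteq> A t" if "q \<in> Q" "q < t" for q
      using that t by (intro A_mono) (auto simp: Q_def)
    then have "{\<omega> \<in> space M. V \<omega> < t} \<subseteq> A t"
      using t by (auto simp: V_set)
    then have "prob {\<omega> \<in> space M. V \<omega> < t} \<le> prob (A t)"
      using At by (intro finite_measure_mono)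
    then show "prob {\<omega> \<in> space M. V \<omega> < t} \<le> t"
      using A t by simp
    show "t \<le> prob {\<omega> \<in> space M. V \<omega> < t}"
    proof (rule ccontr)
      assume "\<not> ?thesis"
      then obtain q where q: "q \<in> \<rat>" "prob {\<omega> \<in> space M. V \<omega> < t} < q" "q < t"
        using Rats_dense_in_real[of "prob {\<omega> \<in> space M. V \<omega> < t}" t] by auto
      moreover have "0 \<le> q"
        using q(2) measure_nonneg[of M "{\<omega> \<in> space M. V \<omega> < t}"] by linarith
      ultimately have "q \<in> Q"
        using t by (auto simp: Q_def)
      then have "A q \<subseteq> {\<omega> \<in> space M. V \<omega> < t}"
        using q t by (auto simp: V_set)
      then have "prob (A q) \<le> prob {\<omega> \<in> space M. V \<omega> < t}"
        using m by (intro finite_measure_mono)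
      then show False
        using q \<open>q \<in> Q\<close> A(2)[of q] by (auto simp: Q_def)
    qed
  qed
  \<comment> \<open>the value 1, taken with probability 0, is moved to 0\<close>
  define U where "U = (\<lambda>\<omega>. if V \<omega> < 1 then V \<omega> else 0)"
  note [measurable] = Vmeas
  have Umeas [measurable]: "U \<in> borel_measurable M"
    unfolding U_def by measurable
  have "AE \<omega> in M. V \<omega> < 1"
    using AE_prob_1[of "{\<omega> \<in> space M. V \<omega> < 1}"] Vprob[of 1] by simp
  then have eq: "AE \<omega> in M. U \<omega> = V \<omega>"
    by eventually_elim (simp add: U_def)
  have "prob {\<omega> \<in> space M. U \<omega> < t} = t" if "0 \<le> t" "t \<le> 1" for t
  proof -
    have "prob {\<omega> \<in> space M. U \<omega> < t} = prob {\<omega> \<in> space M. V \<omega> < t}"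
    proof (rule measure_eq_AE)
      show "AE \<omega> in M. (\<omega> \<in> {\<omega> \<in> space M. U \<omega> < t}) = (\<omega> \<in> {\<omega> \<in> space M. V \<omega> < t})"
        using eq by eventually_elim simp
    qed (measurable, measurable)
    then show ?thesis
      using Vprob that by simp
  qed
  then have "uniform_rv M U"
    by unfold_locales (simp_all add: U_def V0 Vmeas)
  then show ?thesis
    by blast
qed

end

section \<open>Points of a simplex as step functions\<close>

text \<open>The right endpoint of the interval on which the step function of \<open>x\<close> takes the value \<open>k\<close>; the
  interval is closed on the left and open on the right.\<close>

definition psum :: "(nat \<Rightarrow> real) \<Rightarrow> nat \<Rightarrow> real" where
  "psum x k = (\<Sum>j\<le>k. x j)"

text \<open>The step function of \<open>x\<close>, that is, the quantile function of the law \<open>x\<close>. It is only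
  meaningful for \<open>0 \<le> u < 1\<close>.\<close>

definition step :: "(nat \<Rightarrow> real) \<Rightarrow> real \<Rightarrow> nat" where
  "step x u = (LEAST i. u < psum x i)"

lemma psum_mono:
  assumes "x \<in> standard_simplex n" "i \<le> j"
  shows "psum x i \<le> psum x j"
  unfolding psum_def using assms by (intro sum_mono2) (auto simp: standard_simplex_def)

lemma psum_bounds:
  assumes "x \<in> standard_simplex n"
  shows "0 \<le> psum x k" "psum x k \<le> 1"
proof -
  show "0 \<le> psum x k"
    unfolding psum_def using assms by (intro sum_nonneg) (auto simp: standard_simplex_def)
  have "psum x (max k n) = (\<Sum>j\<le>n. x j)"
    unfolding psum_def by (rule sum.mono_neutral_right) (use assms in \<open>auto simp: standard_simplex_def\<close>)
  then show "psum x k \<le> 1"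
    using psum_mono[OF assms, of k "max k n"] assms by (simp add: standard_simplex_def)
qed

lemma psum_top:
  assumes "x \<in> standard_simplex n"
  shows "psum x n = 1"
  using assms by (simp add: standard_simplex_def psum_def)

lemma step_le_iff:
  assumes x: "x \<in> standard_simplex n" and u: "u < 1"
  shows "step x u \<le> k \<longleftrightarrow> u < psum x k"
proof
  have "u < psum x n"
    using u psum_top[OF x] by simp
  then have "u < psum x (step x u)"
    unfolding step_def by (rule LeastI)
  then show "u < psum x k" if "step x u \<le> k"
    using psum_mono[OF x that] by linarith
  show "step x u \<le> k" if "u < psum x k"
    unfolding step_def using that by (rule Least_le)
qed

lemma step_le: "x \<in> standard_simplex n \<Longrightarrow> u < 1 \<Longrightarrow> step x u \<le> n"
  by (simp add: step_le_iff psum_top)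

lemma step_mono:
  assumes x: "x \<in> standard_simplex n" and "u \<le> v" "v < 1"
  shows "step x u \<le> step x v"
proof -
  have "v < psum x (step x v)"
    using step_le_iff[OF x, of v "step x v"] assms by simp
  then show ?thesis
    using step_le_iff[OF x, of u "step x v"] assms by simp
qed

lemma step_eqD:
  assumes x: "x \<in> standard_simplex n" and u: "0 \<le> u" "u < 1" and i: "step x u = i"
  shows "psum x i - x i \<le> u" "u < psum x i" "0 < x i"
proof -
  show 1: "u < psum x i"
    using step_le_iff[OF x u(2), of i] i by simp
  show 2: "psum x i - x i \<le> u"
  proof (cases i)
    case (Suc k)
    then have "psum x k \<le> u"
      using step_le_iff[OF x u(2), of k] i by simp
    then show ?thesis
      by (simp add: Suc psum_def)
  qed (use u in \<open>simp add: psum_def\<close>)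
  show "0 < x i"
    using 1 2 by linarith
qed

lemma step_eqI:
  assumes x: "x \<in> standard_simplex n" and u: "u < 1" "psum x i - x i \<le> u" "u < psum x i"
  shows "step x u = i"
proof (rule antisym)
  show "step x u \<le> i"
    using step_le_iff[OF x u(1)] u by simp
  show "i \<le> step x u"
  proof (rule ccontr)
    assume "\<not> ?thesis"
    then obtain k where k: "i = Suc k" "step x u \<le> k"
      by (metis less_Suc_eq_le linorder_not_le not0_implies_Suc not_less_zero)
    then have "u < psum x k"
      using step_le_iff[OF x u(1)] by simp
    then show False
      using u by (simp add: k psum_def)
  qed
qed

lemma simplex_eqI:
  assumes x: "x \<in> standard_simplex n" and y: "y \<in> standard_simplex n"
    and eq: "\<And>u. 0 \<le> u \<Longrightarrow> u < 1 \<Longrightarrow> step x u = step y u"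
  shows "x = y"
proof -
  have le: "psum x k \<le> psum y k"
    if x: "x \<in> standard_simplex n" and y: "y \<in> standard_simplex n"
      and eq: "\<And>u. 0 \<le> u \<Longrightarrow> u < 1 \<Longrightarrow> step x u = step y u" for x y k
  proof (rule ccontr)
    assume less: "\<not> ?thesis"
    then have "psum y k < 1" "0 \<le> psum y k"
      using psum_bounds[OF x, of k] psum_bounds[OF y, of k] by auto
    then show False
      using less step_le_iff[OF x, of "psum y k" k] step_le_iff[OF y, of "psum y k" k]
        eq[of "psum y k"] by simp
  qed
  have ps: "psum x k = psum y k" for k
    using le[OF x y eq] le[OF y x eq[symmetric]] by (simp add: antisym)
  show "x = y"
  proof
    fix i
    show "x i = y i"
    proof (cases i)
      case 0
      then show ?thesis
        using ps[of 0] by (simp add: psum_def)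
    next
      case (Suc k)
      then show ?thesis
        using ps[of "Suc k"] ps[of k] by (simp add: psum_def)
    qed
  qed
qed

lemma step_differ_subset:
  assumes x: "x \<in> standard_simplex n" and y: "y \<in> standard_simplex n" and u: "u < 1"
    and differ: "step x u \<noteq> step y u"
  shows "\<exists>i\<le>n. min (psum x i) (psum y i) \<le> u \<and> u < max (psum x i) (psum y i)"
proof -
  have *: "\<exists>i\<le>n. psum y i \<le> u \<and> u < psum x i"
    if x: "x \<in> standard_simplex n" and y: "y \<in> standard_simplex n" and "step x u < step y u" for x y
    using step_le_iff[OF x u, of "step x u"] step_le_iff[OF y u, of "step x u"] step_le[OF x u] that
    by (intro exI[of _ "step x u"]) auto
  then show ?thesis
    using *[OF x y] *[OF y x] differ by (auto simp: min_le_iff_disj less_max_iff_disj neq_iff)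
qed

lemma continuous_psum: "continuous_map (simplex_top n) euclideanreal (\<lambda>x. psum x i)"
  unfolding psum_def simplex_top_def
  by (intro continuous_map_sum continuous_map_from_subtopology continuous_map_product_projection) auto

lemma continuous_sum_psum_diff:
  assumes "continuous_map X (simplex_top n) f"
  shows "continuous_map X euclideanreal (\<lambda>y. \<Sum>i\<le>n. \<bar>c i - psum (f y) i\<bar>)"
  using continuous_map_compose[OF assms continuous_psum]
  by (intro continuous_map_sum continuous_map_real_abs continuous_map_diff) (auto simp: o_def)

lemma topspace_simplex_top: "topspace (simplex_top n) = standard_simplex n"
  by (simp add: simplex_top_def)

lemma Delta_homD:
  assumes "\<sigma> \<in> Delta_hom n m"
  shows "i \<le> n \<Longrightarrow> \<sigma> i \<le> m" "i \<le> j \<Longrightarrow> j \<le> n \<Longrightarrow> \<sigma> i \<le> \<sigma> j" "\<not> i \<le> n \<Longrightarrow> \<sigma> i = undefined"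
    "\<sigma> \<in> extensional {..n}"
proof -
  have *: "\<sigma> \<in> {..n} \<rightarrow>\<^sub>E {..m}" "mono_on {..n} \<sigma>"
    using assms by (auto simp: Delta_hom_def)
  show "i \<le> n \<Longrightarrow> \<sigma> i \<le> m"
    using * by (auto dest: PiE_mem)
  show "i \<le> j \<Longrightarrow> j \<le> n \<Longrightarrow> \<sigma> i \<le> \<sigma> j"
    using * by (auto intro: monotone_onD)
  show "\<not> i \<le> n \<Longrightarrow> \<sigma> i = undefined" "\<sigma> \<in> extensional {..n}"
    using * by (auto simp: PiE_def extensional_def)
qed

lemma Delta_homI:
  assumes "\<And>i. i \<le> n \<Longrightarrow> \<sigma> i \<le> m" "\<And>i j. i \<le> j \<Longrightarrow> j \<le> n \<Longrightarrow> \<sigma> i \<le> \<sigma> j"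
  shows "restrict \<sigma> {..n} \<in> Delta_hom n m"
  using assms by (auto simp: Delta_hom_def intro!: monotone_onI)

lemma Delta_hom_compose:
  assumes "\<sigma> \<in> Delta_hom l n" "\<tau> \<in> Delta_hom n m"
  shows "compose {..l} \<tau> \<sigma> \<in> Delta_hom l m"
  unfolding compose_def by (rule Delta_homI) (simp_all add: Delta_homD[OF assms(1)] Delta_homD[OF assms(2)])

lemma finite_Delta_hom: "finite (Delta_hom n m)"
  by (rule finite_subset[of _ "{..n} \<rightarrow>\<^sub>E {..m}"]) (auto simp: Delta_hom_def intro: finite_PiE)

lemma simplex_top_map_simplex:
  assumes \<sigma>: "\<sigma> \<in> Delta_hom n m" and x: "x \<in> standard_simplex n"
  shows "simplex_top_map n m \<sigma> x \<in> standard_simplex m"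
proof -
  have nonneg: "0 \<le> x j" for j
    using x by (simp add: standard_simplex_def)
  have sum_all: "(\<Sum>i\<le>m. simplex_top_map n m \<sigma> x i) = 1"
  proof -
    have "(\<Sum>i\<le>m. simplex_top_map n m \<sigma> x i) = (\<Sum>i\<in>{..m}. \<Sum>j\<in>{j \<in> {..n}. \<sigma> j = i}. x j)"
      by (simp add: simplex_top_map_def)
    also have "\<dots> = (\<Sum>j\<le>n. x j)"
      by (rule sum.group) (auto simp: Delta_homD[OF \<sigma>])
    also have "\<dots> = 1"
      using x by (simp add: standard_simplex_def)
    finally show ?thesis .
  qed
  have ge0: "0 \<le> simplex_top_map n m \<sigma> x i" for i
    unfolding simplex_top_map_def by (intro sum_nonneg nonneg)
  have zero: "simplex_top_map n m \<sigma> x i = 0" if "m < i" for i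
  proof -
    have "{j. j \<le> n \<and> \<sigma> j = i} = {}"
      using that Delta_homD(1)[OF \<sigma>] by force
    then show ?thesis
      unfolding simplex_top_map_def by (metis sum.empty)
  qed
  have le1: "simplex_top_map n m \<sigma> x i \<le> 1" for i
  proof (cases "i \<le> m")
    case True
    then have "simplex_top_map n m \<sigma> x i \<le> (\<Sum>i\<le>m. simplex_top_map n m \<sigma> x i)"
      by (intro member_le_sum) (auto simp: ge0)
    then show ?thesis
      using sum_all by simp
  qed (simp add: zero)
  show ?thesis
    using ge0 le1 zero sum_all by (simp add: standard_simplex_def)
qed

lemma psum_simplex_top_map:
  "psum (simplex_top_map n m \<sigma> x) k = (\<Sum>j | j \<le> n \<and> \<sigma> j \<le> k. x j)"
proof -
  have "psum (simplex_top_map n m \<sigma> x) k = (\<Sum>i\<in>{..k}. \<Sum>j\<in>{j \<in> {j. j \<le> n \<and> \<sigma> j \<le> k}. \<sigma> j = i}. x j)"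
    unfolding psum_def simplex_top_map_def by (intro sum.cong refl) auto
  also have "\<dots> = (\<Sum>j | j \<le> n \<and> \<sigma> j \<le> k. x j)"
    by (rule sum.group) auto
  finally show ?thesis .
qed

text \<open>For increasing \<open>\<sigma>\<close> the set of \<open>j\<close> with \<open>\<sigma> j \<le> k\<close> is an initial segment of \<open>[n]\<close>, so both
  sides are at most \<open>k\<close> exactly when \<open>u\<close> is less than one and the same partial sum.\<close>

lemma step_natural:
  assumes \<sigma>: "\<sigma> \<in> Delta_hom n m" and x: "x \<in> standard_simplex n" and u: "0 \<le> u" "u < 1"
  shows "step (simplex_top_map n m \<sigma> x) u = \<sigma> (step x u)"
proof -
  have iff: "step (simplex_top_map n m \<sigma> x) u \<le> k \<longleftrightarrow> \<sigma> (step x u) \<le> k" for k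
  proof -
    have "step (simplex_top_map n m \<sigma> x) u \<le> k \<longleftrightarrow> u < (\<Sum>j | j \<le> n \<and> \<sigma> j \<le> k. x j)"
      by (simp add: step_le_iff[OF simplex_top_map_simplex[OF \<sigma> x] u(2)] psum_simplex_top_map)
    also have "\<dots> \<longleftrightarrow> \<sigma> (step x u) \<le> k"
    proof (cases "\<sigma> 0 \<le> k")
      case False
      then have "\<not> \<sigma> j \<le> k" if "j \<le> n" for j
        using Delta_homD(2)[OF \<sigma>, of 0 j] that by simp
      moreover from this have "{j. j \<le> n \<and> \<sigma> j \<le> k} = {}"
        by auto
      ultimately show ?thesis
        using u step_le[OF x u(2)] by (simp only: sum.empty) auto
    next
      case True
      define J where "J = {j. j \<le> n \<and> \<sigma> j \<le> k}"
      have J: "finite J" "J \<noteq> {}"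
        using True by (auto simp: J_def)
      have Max: "Max J \<in> J"
        using J by (rule Max_in)
      have "j \<in> J" if "j \<le> Max J" for j
        using Delta_homD(2)[OF \<sigma> that] that Max by (auto simp: J_def)
      then have eq: "J = {..Max J}"
        using J by (auto intro: Max_ge)
      have "u < (\<Sum>j | j \<le> n \<and> \<sigma> j \<le> k. x j) \<longleftrightarrow> u < psum x (Max J)"
        unfolding psum_def J_def[symmetric] by (subst eq) simp
      also have "\<dots> \<longleftrightarrow> step x u \<in> J"
        by (subst (2) eq) (simp add: step_le_iff[OF x u(2)])
      also have "\<dots> \<longleftrightarrow> \<sigma> (step x u) \<le> k"
        using step_le[OF x u(2)] by (simp add: J_def)
      finally show ?thesis .
    qed
    finally show ?thesis .
  qed
  show ?thesis
    using iff[of "\<sigma> (step x u)"] iff[of "step (simplex_top_map n m \<sigma> x) u"] by simp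
qed

text \<open>The morphism \<open>[m] \<rightarrow> [n]\<close> obtained by evaluating the step function of \<open>x \<in> \<Delta>\<^sub>n\<close> at
  \<open>u 0 \<le> \<dots> \<le> u m\<close>.\<close>

definition sample :: "nat \<Rightarrow> (nat \<Rightarrow> real) \<Rightarrow> (nat \<Rightarrow> real) \<Rightarrow> nat \<Rightarrow> nat" where
  "sample m x u = (\<lambda>i\<in>{..m}. step x (u i))"

definition sampling :: "nat \<Rightarrow> (nat \<Rightarrow> real) \<Rightarrow> bool" where
  "sampling m u \<longleftrightarrow> mono_on {..m} u \<and> (\<forall>i\<le>m. 0 \<le> u i \<and> u i < 1)"

lemma sample_hom:
  assumes "x \<in> standard_simplex n" "sampling m u"
  shows "sample m x u \<in> Delta_hom m n"
  unfolding sample_def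
proof (rule Delta_homI)
  have u: "mono_on {..m} u" "\<And>i. i \<le> m \<Longrightarrow> u i < 1"
    using assms by (auto simp: sampling_def)
  show "step x (u i) \<le> n" if "i \<le> m" for i
    using step_le[OF assms(1)] u that by simp
  show "step x (u i) \<le> step x (u j)" if "i \<le> j" "j \<le> m" for i j
    using that u by (intro step_mono[OF assms(1)]) (auto intro: monotone_onD)
qed

lemma sample_natural:
  assumes "\<sigma> \<in> Delta_hom n k" "x \<in> standard_simplex n" "sampling m u"
  shows "sample m (simplex_top_map n k \<sigma> x) u = compose {..m} \<sigma> (sample m x u)"
  using assms step_natural by (auto simp: sample_def compose_def sampling_def)

text \<open>The interior of the standard simplex.\<close>

definition open_simplex :: "nat \<Rightarrow> (nat \<Rightarrow> real) set" where
  "open_simplex n = {x \<in> standard_simplex n. \<forall>i\<le>n. 0 < x i}"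

text \<open>The point at proportion \<open>t\<close> of the interval on which the step function of \<open>b\<close> has the value
  \<open>i\<close>. For interior \<open>b\<close>, sampling \<open>b\<close> at these points gives the identity of \<open>[m]\<close>.\<close>

definition spread :: "(nat \<Rightarrow> real) \<Rightarrow> real \<Rightarrow> nat \<Rightarrow> real" where
  "spread b t i = psum b i - b i + t * b i"

lemma spread_bounds:
  assumes b: "b \<in> open_simplex m" and t: "0 \<le> t" "t < 1" and i: "i \<le> m"
  shows "psum b i - b i \<le> spread b t i" "spread b t i < psum b i" "0 \<le> spread b t i" "spread b t i < 1"
proof -
  have bs: "b \<in> standard_simplex m" and pos: "0 < b i"
    using b i by (auto simp: open_simplex_def)
  show 1: "psum b i - b i \<le> spread b t i"
    using t pos by (simp add: spread_def)
  show 2: "spread b t i < psum b i"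
    using t pos mult_strict_right_mono[of t 1 "b i"] by (simp add: spread_def)
  show "spread b t i < 1"
    using 2 psum_bounds[OF bs, of i] by linarith
  have "0 \<le> psum b i - b i"
    by (cases i) (use psum_bounds(1)[OF bs] in \<open>simp_all add: psum_def\<close>)
  then show "0 \<le> spread b t i"
    using 1 by linarith
qed

lemma step_spread:
  assumes "b \<in> open_simplex m" "0 \<le> t" "t < 1" "i \<le> m"
  shows "step b (spread b t i) = i"
  using spread_bounds[OF assms] assms(1) by (intro step_eqI[of _ m]) (auto simp: open_simplex_def)

lemma sampling_spread:
  assumes b: "b \<in> open_simplex m" and t: "0 \<le> t" "t < 1"
  shows "sampling m (spread b t)"
proof -
  have bs: "b \<in> standard_simplex m"
    using b by (auto simp: open_simplex_def)
  have "spread b t i \<le> spread b t j" if ij: "i \<le> j" "j \<le> m" for i j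
  proof (cases "i = j")
    case False
    with ij obtain k where "j = Suc k"
      by (cases j) auto
    with ij False have k: "j = Suc k" "i \<le> k"
      by auto
    have "spread b t i \<le> psum b k"
      using spread_bounds(2)[OF b t, of i] psum_mono[OF bs, of i k] that k by simp
    also have "\<dots> \<le> spread b t j"
      using spread_bounds(1)[OF b t, of j] that k by (simp add: psum_def)
    finally show ?thesis .
  qed simp
  then show ?thesis
    using spread_bounds[OF b t] by (auto simp: sampling_def intro!: monotone_onI)
qed

lemma ex_spread:
  assumes b: "b \<in> open_simplex m" and v: "0 \<le> v" "v < 1"
  obtains t where "0 \<le> t" "t < 1" "v = spread b t (step b v)" "step b v \<le> m"
proof -
  define i where "i = step b v"
  have bs: "b \<in> standard_simplex m"
    using b by (auto simp: open_simplex_def)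
  note * = step_eqD[OF bs v i_def[symmetric]]
  show thesis
  proof (rule that[of "(v - (psum b i - b i)) / b i"])
    show "v = spread b ((v - (psum b i - b i)) / b i) (step b v)"
      using * by (simp add: spread_def flip: i_def)
    show "step b v \<le> m"
      by (rule step_le[OF bs v(2)])
  qed (use * in \<open>auto simp: field_simps\<close>)
qed

lemma strict_mono_endo_eq_id:
  assumes \<tau>: "\<tau> \<in> Delta_hom m m" and inj: "inj_on \<tau> {..m}" and i: "i \<le> m"
  shows "\<tau> i = i"
proof -
  have less: "\<tau> i < \<tau> j" if "i < j" "j \<le> m" for i j
    using Delta_homD(2)[OF \<tau>, of i j] inj that by (metis atMost_iff inj_onD less_imp_le_nat nat_less_le order.trans)
  have lower: "i \<le> \<tau> i" if "i \<le> m" for i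
    using that
  proof (induction i)
    case (Suc i)
    then show ?case
      using less[of i "Suc i"] by simp
  qed simp
  have upper: "\<tau> (m - k) \<le> m - k" if "k \<le> m" for k
    using that
  proof (induction k)
    case 0
    then show ?case
      using Delta_homD(1)[OF \<tau>, of m] by simp
  next
    case (Suc k)
    then show ?case
      using less[of "m - Suc k" "m - k"] by fastforce
  qed
  show ?thesis
    using lower[OF i] upper[of "m - i"] i by simp
qed

section \<open>Realizations and natural families of maps\<close>

lemma equiv_real_rel: "equiv UNIV (real_rel F Y Ym)"
  by (intro equivI sym_real_rel) (auto simp: real_rel_def trans_rtrancl refl_rtrancl)

lemma real_rel_class_eq:
  assumes "\<sigma> \<in> Delta_hom n m" "\<alpha> \<in> simplices F m" "a \<in> topspace (Y n)"
  shows "real_rel F Y Ym `` {(n, act F n m \<sigma> \<alpha>, a)} = real_rel F Y Ym `` {(m, \<alpha>, Ym n m \<sigma> a)}"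
proof (rule equiv_class_eq[OF equiv_real_rel])
  show "((n, act F n m \<sigma> \<alpha>, a), (m, \<alpha>, Ym n m \<sigma> a)) \<in> real_rel F Y Ym"
    unfolding real_rel_def gen_rel_def using assms by (intro r_into_rtrancl) blast
qed

lemma real_rel_invariant:
  assumes rel: "real_rel F Y Ym `` {x} = real_rel F Y Ym `` {y}"
    and inv: "\<And>n m \<sigma> \<alpha> a. \<sigma> \<in> Delta_hom n m \<Longrightarrow> \<alpha> \<in> simplices F m \<Longrightarrow> a \<in> topspace (Y n) \<Longrightarrow>
                f (n, act F n m \<sigma> \<alpha>, a) = f (m, \<alpha>, Ym n m \<sigma> a)"
  shows "f x = f y"
proof -
  have "(x, y) \<in> real_rel F Y Ym"
    using rel eq_equiv_class_iff[OF equiv_real_rel, of x y F Y Ym] by simp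
  then show ?thesis
    unfolding real_rel_def
  proof (induction rule: rtrancl_induct)
    case (step y z)
    then have "f y = f z"
      using inv unfolding gen_rel_def by fastforce
    then show ?case
      using step by simp
  qed simp
qed

lemma topspace_presum:
  "topspace (presum F Y) = (SIGMA n:UNIV. simplices F n \<times> topspace (Y n))"
  by (auto simp: presum_def)

lemma openin_presum:
  "openin (presum F Y) U \<longleftrightarrow> U \<subseteq> topspace (presum F Y) \<and>
     (\<forall>n. \<forall>\<alpha>\<in>simplices F n. openin (Y n) {a. (n, \<alpha>, a) \<in> U})"
proof -
  have "openin (prod_topology (discrete_topology S) T) W \<longleftrightarrow>
      W \<subseteq> S \<times> topspace T \<and> (\<forall>\<alpha>\<in>S. openin T {a. (\<alpha>, a) \<in> W})" (is "?lhs \<longleftrightarrow> ?rhs")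
    for S and T :: "'b topology" and W :: "('a \<times> 'b) set"
  proof
    assume L: ?lhs
    have "continuous_map T (prod_topology (discrete_topology S) T) (\<lambda>a. (\<alpha>, a))" if "\<alpha> \<in> S" for \<alpha>
      using that by (simp add: continuous_map_pairwise o_def)
    then have "openin T {a \<in> topspace T. (\<alpha>, a) \<in> W}" if "\<alpha> \<in> S" for \<alpha>
      using L that openin_continuous_map_preimage by fastforce
    moreover have sub: "W \<subseteq> S \<times> topspace T"
      using openin_subset[OF L] by simp
    moreover have "{a \<in> topspace T. (\<alpha>, a) \<in> W} = {a. (\<alpha>, a) \<in> W}" for \<alpha>
      using sub by blast
    ultimately show ?rhs
      by simp
  next
    assume R: ?rhs
    then have "W = (\<Union>\<alpha>\<in>S. {\<alpha>} \<times> {a. (\<alpha>, a) \<in> W})"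
      by blast
    also have "openin (prod_topology (discrete_topology S) T) \<dots>"
      using R by (intro openin_Union) (auto simp: openin_prod_Times_iff)
    finally show ?lhs .
  qed
  then show ?thesis
    unfolding topspace_presum unfolding presum_def openin_sum_topology by auto
qed

lemma closedin_presum:
  "closedin (presum F Y) U \<longleftrightarrow> U \<subseteq> topspace (presum F Y) \<and>
     (\<forall>n. \<forall>\<alpha>\<in>simplices F n. closedin (Y n) {a. (n, \<alpha>, a) \<in> U})"
proof (cases "U \<subseteq> topspace (presum F Y)")
  case True
  have "{a. (n, \<alpha>, a) \<in> topspace (presum F Y) - U} = topspace (Y n) - {a. (n, \<alpha>, a) \<in> U}"
    "{a. (n, \<alpha>, a) \<in> U} \<subseteq> topspace (Y n)"
    if "\<alpha> \<in> simplices F n" for n \<alpha>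
    using True that by (auto simp: topspace_presum)
  then show ?thesis
    unfolding closedin_def openin_presum using True by auto
qed (auto simp: closedin_def)

lemma continuous_map_from_presum:
  assumes "\<And>n \<alpha>. \<alpha> \<in> simplices F n \<Longrightarrow> continuous_map (Y n) Z (\<lambda>a. f (n, \<alpha>, a))"
  shows "continuous_map (presum F Y) Z f"
  unfolding continuous_map_alt
proof (intro conjI allI impI)
  show "f \<in> topspace (presum F Y) \<rightarrow> topspace Z"
    using assms by (fastforce simp: topspace_presum continuous_map_def Pi_iff)
  fix U assume U: "openin Z U"
  have "{a. (n, \<alpha>, a) \<in> f -` U \<inter> topspace (presum F Y)} = (\<lambda>a. f (n, \<alpha>, a)) -` U \<inter> topspace (Y n)"
    if "\<alpha> \<in> simplices F n" for n \<alpha>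
    using that by (auto simp: topspace_presum)
  then show "openin (presum F Y) (f -` U \<inter> topspace (presum F Y))"
    using assms U by (simp add: openin_presum continuous_map_alt)
qed

lemma continuous_map_class:
  assumes "\<alpha> \<in> simplices F n"
  shows "continuous_map (Y n) (realization F Y Ym) (\<lambda>a. real_rel F Y Ym `` {(n, \<alpha>, a)})"
proof -
  have "continuous_map (Y n) (presum F Y) (\<lambda>a. (n, \<alpha>, a))"
    using assms
    by (auto simp: continuous_map_def topspace_presum openin_presum Collect_conj_eq openin_Int
          intro: openin_subopen[THEN iffD2])
  then show ?thesis
    using continuous_map_compose[OF _ quotient_imp_continuous_map[OF quotient_map_quotient_top],
        of "Y n" "presum F Y" "\<lambda>a. (n, \<alpha>, a)" "real_rel F Y Ym"]
    by (simp add: realization_def o_def)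
qed

lemma continuous_map_from_realization:
  assumes "\<And>n \<alpha>. \<alpha> \<in> simplices F n \<Longrightarrow>
             continuous_map (Y n) Z (\<lambda>a. f (real_rel F Y Ym `` {(n, \<alpha>, a)}))"
  shows "continuous_map (realization F Y Ym) Z f"
  unfolding realization_def
proof (rule continuous_compose_quotient_map[OF quotient_map_quotient_top])
  show "continuous_map (presum F Y) Z (f \<circ> (\<lambda>x. real_rel F Y Ym `` {x}))"
    by (rule continuous_map_from_presum) (simp add: assms)
qed

lemma topspace_realization:
  "topspace (realization F Y Ym) =
     {real_rel F Y Ym `` {(n, \<alpha>, a)} | n \<alpha> a. \<alpha> \<in> simplices F n \<and> a \<in> topspace (Y n)}"
  by (force simp: realization_def topspace_presum quotient_def)

lemma realization_cases:
  assumes "z \<in> topspace (realization F Y Ym)"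
  obtains n \<alpha> a where "\<alpha> \<in> simplices F n" "a \<in> topspace (Y n)" "z = real_rel F Y Ym `` {(n, \<alpha>, a)}"
  using assms by (auto simp: topspace_realization)

lemma closedin_realization:
  "closedin (realization F Y Ym) S \<longleftrightarrow> S \<subseteq> topspace (realization F Y Ym) \<and>
     (\<forall>n. \<forall>\<alpha>\<in>simplices F n. closedin (Y n) {a \<in> topspace (Y n). real_rel F Y Ym `` {(n, \<alpha>, a)} \<in> S})"
proof -
  have "quotient_map (presum F Y) (realization F Y Ym) (\<lambda>x. real_rel F Y Ym `` {x})"
    unfolding realization_def by (rule quotient_map_quotient_top)
  then have "closedin (realization F Y Ym) S \<longleftrightarrow> S \<subseteq> topspace (realization F Y Ym) \<and>
      closedin (presum F Y) {x \<in> topspace (presum F Y). real_rel F Y Ym `` {x} \<in> S}"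
    unfolding quotient_map_closedin by (meson closedin_subset)
  then show ?thesis
    by (simp add: closedin_presum topspace_presum cong: conj_cong)
qed

text \<open>A family \<open>p n : Y n \<rightarrow> Z n\<close> of continuous maps commuting with the structure maps.\<close>

definition natural_family :: "(nat \<Rightarrow> 'b topology) \<Rightarrow> (nat \<Rightarrow> nat \<Rightarrow> (nat \<Rightarrow> nat) \<Rightarrow> 'b \<Rightarrow> 'b) \<Rightarrow>
    (nat \<Rightarrow> 'c topology) \<Rightarrow> (nat \<Rightarrow> nat \<Rightarrow> (nat \<Rightarrow> nat) \<Rightarrow> 'c \<Rightarrow> 'c) \<Rightarrow> (nat \<Rightarrow> 'b \<Rightarrow> 'c) \<Rightarrow> bool" where
  "natural_family Y Ym Z Zm p \<longleftrightarrow> (\<forall>n. continuous_map (Y n) (Z n) (p n)) \<and>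
     (\<forall>n m. \<forall>\<sigma>\<in>Delta_hom n m. \<forall>a\<in>topspace (Y n). p m (Ym n m \<sigma> a) = Zm n m \<sigma> (p n a))"

lemma natural_family_topspace:
  "natural_family Y Ym Z Zm p \<Longrightarrow> a \<in> topspace (Y n) \<Longrightarrow> p n a \<in> topspace (Z n)"
  unfolding natural_family_def continuous_map_def by blast

lemma realization_map_natural:
  assumes "natural_family Y Ym Z Zm p"
  shows "realization_map F Z Zm p (real_rel F Y Ym `` {(n, \<alpha>, a)}) = real_rel F Z Zm `` {(n, \<alpha>, p n a)}"
  using assms natural_family_topspace[OF assms]
  by (intro realization_map_class) (auto simp: natural_family_def)

lemma continuous_realization_map:
  assumes "natural_family Y Ym Z Zm p"
  shows "continuous_map (realization F Y Ym) (realization F Z Zm) (realization_map F Z Zm p)"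
proof (rule continuous_map_from_realization)
  fix n \<alpha> assume "\<alpha> \<in> simplices F n"
  then have "continuous_map (Y n) (realization F Z Zm) ((\<lambda>a. real_rel F Z Zm `` {(n, \<alpha>, a)}) \<circ> p n)"
    using assms by (intro continuous_map_compose[OF _ continuous_map_class]) (auto simp: natural_family_def)
  then show "continuous_map (Y n) (realization F Z Zm)
      (\<lambda>a. realization_map F Z Zm p (real_rel F Y Ym `` {(n, \<alpha>, a)}))"
    by (simp add: realization_map_natural[OF assms] o_def)
qed

text \<open>Since the unit interval is locally compact, its product with the quotient map onto a
  realization is again a quotient map, so a homotopy may be defined on representatives.\<close>

lemma homotopic_realization_map:
  assumes cont: "\<And>n. continuous_map (prod_topology (top_of_set {0..1}) (Y n)) (Z n) (\<lambda>(t, a). h t n a)"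
    and nat: "\<And>t. t \<in> {0..1::real} \<Longrightarrow> natural_family Y Ym Z Zm (h t)"
  shows "homotopic_with (\<lambda>_. True) (realization F Y Ym) (realization F Z Zm)
           (realization_map F Z Zm (h 0)) (realization_map F Z Zm (h 1))"
proof -
  let ?I = "top_of_set {0..1::real}"
  let ?H = "\<lambda>(t, c). realization_map F Z Zm (h t) c"
  have qm: "quotient_map (prod_topology ?I (presum F Y)) (prod_topology ?I (realization F Y Ym))
      (\<lambda>(t, x). (t, real_rel F Y Ym `` {x}))"
    unfolding realization_def
  proof (rule quotient_map_prod_right[OF _ _ quotient_map_quotient_top])
    show "locally_compact_space ?I"
      by (simp add: compact_imp_locally_compact_space compact_space_subtopology)
    show "Hausdorff_space ?I \<or> regular_space ?I"
      by (simp add: Hausdorff_space_subtopology)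
  qed
  have "continuous_map (prod_topology ?I (presum F Y)) (realization F Z Zm)
      (\<lambda>(t, x). case x of (n, \<alpha>, a) \<Rightarrow> real_rel F Z Zm `` {(n, \<alpha>, h t n a)})" (is "continuous_map ?P ?R ?G")
    unfolding continuous_map_def
  proof (intro conjI allI impI)
    show "?G \<in> topspace ?P \<rightarrow> topspace ?R"
      using nat[THEN natural_family_topspace] by (fastforce simp: topspace_realization topspace_presum)
    fix W assume W: "openin ?R W"
    show "openin ?P {x \<in> topspace ?P. ?G x \<in> W}"
      unfolding openin_prod_topology_alt
    proof (intro allI impI)
      fix t x assume tx: "(t, x) \<in> {x \<in> topspace ?P. ?G x \<in> W}"
      obtain n \<alpha> a where x: "x = (n, \<alpha>, a)"
        by (metis prod_cases3)
      have t: "t \<in> {0..1}" and \<alpha>: "\<alpha> \<in> simplices F n" and a: "a \<in> topspace (Y n)"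
        and inW: "real_rel F Z Zm `` {(n, \<alpha>, h t n a)} \<in> W"
        using tx by (auto simp: x topspace_presum)
      have "continuous_map (prod_topology ?I (Y n)) ?R
          ((\<lambda>a. real_rel F Z Zm `` {(n, \<alpha>, a)}) \<circ> (\<lambda>(t, a). h t n a))"
        by (rule continuous_map_compose[OF cont continuous_map_class[OF \<alpha>]])
      note open_preimage = openin_continuous_map_preimage[OF this W]
      have "(t, a) \<in> {x \<in> topspace (prod_topology ?I (Y n)).
            ((\<lambda>a. real_rel F Z Zm `` {(n, \<alpha>, a)}) \<circ> (\<lambda>(t, a). h t n a)) x \<in> W}"
        using t a inW by simp
      from openin_prod_topology_alt[THEN iffD1, OF open_preimage, rule_format, OF this]
      obtain T V where TV: "openin ?I T" "openin (Y n) V" "t \<in> T" "a \<in> V"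
        "T \<times> V \<subseteq> {x \<in> topspace (prod_topology ?I (Y n)).
            ((\<lambda>a. real_rel F Z Zm `` {(n, \<alpha>, a)}) \<circ> (\<lambda>(t, a). h t n a)) x \<in> W}"
        by (elim exE conjE) (rule that; assumption)
      have "openin (presum F Y) ({n} \<times> {\<alpha>} \<times> V)"
        unfolding openin_presum
      proof (intro conjI allI ballI)
        show "{n} \<times> {\<alpha>} \<times> V \<subseteq> topspace (presum F Y)"
          using \<alpha> openin_subset[OF TV(2)] by (auto simp: topspace_presum)
        fix m \<beta>
        have "{a. (m, \<beta>, a) \<in> {n} \<times> {\<alpha>} \<times> V} = (if m = n \<and> \<beta> = \<alpha> then V else {})"
          by auto
        then show "openin (Y m) {a. (m, \<beta>, a) \<in> {n} \<times> {\<alpha>} \<times> V}"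
          using TV(2) by simp
      qed
      moreover have "T \<times> ({n} \<times> {\<alpha>} \<times> V) \<subseteq> {x \<in> topspace ?P. ?G x \<in> W}"
        using TV(5) \<alpha> by (fastforce simp: topspace_presum)
      ultimately show "\<exists>U V. openin ?I U \<and> openin (presum F Y) V \<and> t \<in> U \<and> x \<in> V \<and>
          U \<times> V \<subseteq> {x \<in> topspace ?P. ?G x \<in> W}"
        using TV x by (intro exI[of _ T] exI[of _ "{n} \<times> {\<alpha>} \<times> V"]) auto
    qed
  qed
  then have "continuous_map ?P ?R (?H \<circ> (\<lambda>(t, x). (t, real_rel F Y Ym `` {x})))"
    by (rule continuous_map_eq) (auto simp: realization_map_natural[OF nat])
  then have "continuous_map (prod_topology ?I (realization F Y Ym)) ?R ?H"
    by (rule continuous_compose_quotient_map[OF qm])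
  then show ?thesis
    unfolding homotopic_with_def by (intro exI[of _ ?H]) auto
qed

section \<open>The probability-law map is a homotopy equivalence\<close>

context prob_space
begin

lemma topspace_nabla_quotient: "topspace (nabla M n) = rv M n // ae_rel M n"
  using prob_space_axioms by (rule topspace_nabla)

lemma class_in_nabla: "f \<in> rv M n \<Longrightarrow> ae_rel M n `` {f} \<in> topspace (nabla M n)"
  by (simp add: topspace_nabla_quotient quotientI)

lemma rep_nabla:
  assumes "A \<in> topspace (nabla M n)"
  shows "rep A \<in> rv M n" "ae_rel M n `` {rep A} = A"
  using rep_in[of A M n] assms by (simp_all add: topspace_nabla_quotient)

lemma class_eqI:
  assumes "f \<in> rv M n" "g \<in> rv M n" "AE t in M. f t = g t"
  shows "ae_rel M n `` {f} = ae_rel M n `` {g}"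
  using assms by (intro equiv_class_eq[OF equiv_ae_rel]) (simp add: ae_rel_def)

lemma rv_le: "f \<in> rv M n \<Longrightarrow> t \<in> space M \<Longrightarrow> f t \<le> n"
  by (auto simp: rv_def dest: measurable_space)

lemma rvI:
  assumes "\<And>t. t \<in> space M \<Longrightarrow> f t \<le> n" "\<And>i. i \<le> n \<Longrightarrow> {t \<in> space M. f t = i} \<in> sets M"
  shows "f \<in> rv M n"
proof -
  have "f -` {i} \<inter> space M = {t \<in> space M. f t = i}" for i
    by auto
  then show ?thesis
    unfolding rv_def using assms by (subst measurable_count_space_eq2) auto
qed

lemma nabla_dist_class_le:
  assumes f: "f \<in> rv M n" and g: "g \<in> rv M n" and S: "S \<in> sets M"
    and sub: "\<And>t. t \<in> space M \<Longrightarrow> f t \<noteq> g t \<Longrightarrow> t \<in> S"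
  shows "nabla_dist M (ae_rel M n `` {f}) (ae_rel M n `` {g}) \<le> prob S"
  unfolding nabla_dist_class[OF f g] using S sub by (intro finite_measure_mono) auto

text \<open>Continuity into \<open>\<nabla>\<^sub>n\<close> follows from a continuous bound on the distance of the values.\<close>

lemma continuous_map_into_nabla:
  assumes top: "\<And>x. x \<in> topspace X \<Longrightarrow> f x \<in> topspace (nabla M n)"
    and bound: "\<And>x. x \<in> topspace X \<Longrightarrow> \<exists>D. continuous_map X euclideanreal D \<and> D x = 0 \<and>
                  (\<forall>y\<in>topspace X. nabla_dist M (f x) (f y) \<le> D y)"
  shows "continuous_map X (nabla M n) f"
proof -
  interpret N: Metric_space "rv M n // ae_rel M n" "nabla_dist M"
    using prob_space_axioms by (rule Metric_space_nabla)
  show ?thesis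
    unfolding nabla_def N.continuous_map_to_metric
  proof (intro ballI allI impI)
    fix x and \<epsilon> :: real
    assume x: "x \<in> topspace X" and \<epsilon>: "0 < \<epsilon>"
    obtain D where D: "continuous_map X euclideanreal D" "D x = 0"
      and le: "\<And>y. y \<in> topspace X \<Longrightarrow> nabla_dist M (f x) (f y) \<le> D y"
      using bound[OF x] by blast
    have "openin X {y \<in> topspace X. D y \<in> {..<\<epsilon>}}"
      by (rule openin_continuous_map_preimage[OF D(1)]) auto
    moreover have "f y \<in> N.mball (f x) \<epsilon>" if "y \<in> topspace X" "D y < \<epsilon>" for y
      using le[OF that(1)] that top x by (auto simp: topspace_nabla_quotient)
    ultimately show "\<exists>U. openin X U \<and> x \<in> U \<and> (\<forall>y\<in>U. f y \<in> N.mball (f x) \<epsilon>)"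
      using x D \<epsilon> by (intro exI[of _ "{y \<in> topspace X. D y \<in> {..<\<epsilon>}}"]) auto
  qed
qed

lemma continuous_map_nabla_real:
  fixes f :: "('a \<Rightarrow> nat) set \<Rightarrow> real"
  assumes "\<And>A B. A \<in> topspace (nabla M n) \<Longrightarrow> B \<in> topspace (nabla M n) \<Longrightarrow> \<bar>f A - f B\<bar> \<le> nabla_dist M A B"
  shows "continuous_map (nabla M n) euclideanreal f"
proof -
  interpret N: Metric_space "rv M n // ae_rel M n" "nabla_dist M"
    using prob_space_axioms by (rule Metric_space_nabla)
  have "continuous_map (nabla M n) (Met_TC.mtopology) f"
    unfolding Met_TC.continuous_map_to_metric
  proof (intro ballI allI impI)
    fix A and \<epsilon> :: real
    assume A: "A \<in> topspace (nabla M n)" and \<epsilon>: "0 < \<epsilon>"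
    have "f B \<in> Met_TC.mball (f A) \<epsilon>" if "B \<in> N.mball A \<epsilon>" for B
      using assms[of A B] that A by (auto simp: topspace_nabla_quotient dist_real_def)
    then show "\<exists>U. openin (nabla M n) U \<and> A \<in> U \<and> (\<forall>B\<in>U. f B \<in> Met_TC.mball (f A) \<epsilon>)"
      using A \<epsilon> by (intro exI[of _ "N.mball A \<epsilon>"]) (auto simp: nabla_def)
  qed
  then show ?thesis
    by simp
qed

lemma continuous_nabla_dist:
  assumes "A \<in> topspace (nabla M n)"
  shows "continuous_map (nabla M n) euclideanreal (nabla_dist M A)"
proof (rule continuous_map_nabla_real)
  interpret N: Metric_space "rv M n // ae_rel M n" "nabla_dist M"
    using prob_space_axioms by (rule Metric_space_nabla)
  fix B C assume "B \<in> topspace (nabla M n)" "C \<in> topspace (nabla M n)"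
  then show "\<bar>nabla_dist M A B - nabla_dist M A C\<bar> \<le> nabla_dist M B C"
    using N.triangle[of A B C] N.triangle[of A C B] N.commute[of B C] assms
    by (simp add: topspace_nabla_quotient abs_le_iff)
qed

lemma nabla_dist_self: "A \<in> topspace (nabla M n) \<Longrightarrow> nabla_dist M A A = 0"
  by (simp add: nabla_dist_def)

lemma prob_diff_le_nabla_dist:
  assumes A: "A \<in> topspace (nabla M n)" and B: "B \<in> topspace (nabla M n)" and S: "S \<in> sets M"
  shows "\<bar>prob ({t \<in> space M. rep A t = i} \<inter> S) - prob ({t \<in> space M. rep B t = i} \<inter> S)\<bar> \<le> nabla_dist M A B"
proof -
  have le: "prob ({t \<in> space M. rep A t = i} \<inter> S) \<le> prob ({t \<in> space M. rep B t = i} \<inter> S) + nabla_dist M A B"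
    if A: "A \<in> topspace (nabla M n)" and B: "B \<in> topspace (nabla M n)" for A B
  proof -
    note [measurable] = rv_measurable[OF rep_nabla(1)[OF A]] rv_measurable[OF rep_nabla(1)[OF B]] S
    note neq = rv_neq_measurable[OF rep_nabla(1)[OF A] rep_nabla(1)[OF B]]
    have "{t \<in> space M. rep B t = i} \<inter> S \<in> sets M"
      by measurable
    moreover from this have "prob ({t \<in> space M. rep A t = i} \<inter> S) \<le>
        prob (({t \<in> space M. rep B t = i} \<inter> S) \<union> {t \<in> space M. rep A t \<noteq> rep B t})"
      using neq by (intro finite_measure_mono) auto
    ultimately show ?thesis
      unfolding nabla_dist_def using measure_Un_le[OF _ neq] by fastforce
  qed
  have "nabla_dist M A B = nabla_dist M B A"
    by (simp add: nabla_dist_def eq_commute)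
  then show ?thesis
    using le[OF A B] le[OF B A] by linarith
qed

lemma law_diff_le_nabla_dist:
  assumes "A \<in> topspace (nabla M n)" "B \<in> topspace (nabla M n)"
  shows "\<bar>law M n A i - law M n B i\<bar> \<le> nabla_dist M A B"
  using prob_diff_le_nabla_dist[OF assms sets.top, of i]
  by (simp add: law_def Int_absorb2 Collect_restrict)

lemma law_simplex: "A \<in> topspace (nabla M n) \<Longrightarrow> law M n A \<in> standard_simplex n"
  using law_in_simplex[OF prob_space_axioms, of A n] by (simp add: simplex_top_def)

lemma natural_family_law: "natural_family (nabla M) (nabla_map M) simplex_top simplex_top_map (law M)"
  unfolding natural_family_def
proof (intro conjI allI ballI)
  fix n
  have "continuous_map (nabla M n) euclideanreal (\<lambda>A. law M n A i)" for i
    by (rule continuous_map_nabla_real) (rule law_diff_le_nabla_dist)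
  then show "continuous_map (nabla M n) (simplex_top n) (law M n)"
    by (auto simp: simplex_top_def continuous_map_in_subtopology continuous_map_componentwise_UNIV law_simplex)
qed (rule law_natural[OF prob_space_axioms])

lemma nabla_map_nabla:
  assumes "\<sigma> \<in> Delta_hom n m" "A \<in> topspace (nabla M n)"
  shows "nabla_map M n m \<sigma> A \<in> topspace (nabla M m)"
  unfolding nabla_map_def by (intro class_in_nabla nabla_map_rv[OF assms(1)] rep_nabla(1)[OF assms(2)])

lemma continuous_nabla_map:
  assumes \<sigma>: "\<sigma> \<in> Delta_hom n m"
  shows "continuous_map (nabla M n) (nabla M m) (nabla_map M n m \<sigma>)"
proof (rule continuous_map_into_nabla)
  show "nabla_map M n m \<sigma> A \<in> topspace (nabla M m)" if "A \<in> topspace (nabla M n)" for A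
    using \<sigma> that by (rule nabla_map_nabla)
  fix A assume A: "A \<in> topspace (nabla M n)"
  have "nabla_dist M (nabla_map M n m \<sigma> A) (nabla_map M n m \<sigma> B) \<le> nabla_dist M A B"
    if B: "B \<in> topspace (nabla M n)" for B
    unfolding nabla_map_def nabla_dist_def[of M A B]
    using rep_nabla(1)[OF A] rep_nabla(1)[OF B]
    by (intro nabla_dist_class_le nabla_map_rv[OF \<sigma>] rv_neq_measurable) auto
  then show "\<exists>D. continuous_map (nabla M n) euclideanreal D \<and> D A = 0 \<and>
      (\<forall>B\<in>topspace (nabla M n). nabla_dist M (nabla_map M n m \<sigma> A) (nabla_map M n m \<sigma> B) \<le> D B)"
    using continuous_nabla_dist[OF A] nabla_dist_self[OF A] by blast
qed

lemma nabla_map_compose: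
  assumes \<sigma>: "\<sigma> \<in> Delta_hom l n" and \<tau>: "\<tau> \<in> Delta_hom n m" and A: "A \<in> topspace (nabla M l)"
  shows "nabla_map M l m (compose {..l} \<tau> \<sigma>) A = nabla_map M n m \<tau> (nabla_map M l n \<sigma> A)"
proof -
  note rv = rep_nabla(1)[OF A]
  have "nabla_map M n m \<tau> (nabla_map M l n \<sigma> A) = ae_rel M m `` {\<tau> \<circ> (\<sigma> \<circ> rep A)}"
    unfolding nabla_map_def[of M l n] by (rule nabla_map_class[OF \<tau> nabla_map_rv[OF \<sigma> rv]])
  also have "\<dots> = ae_rel M m `` {compose {..l} \<tau> \<sigma> \<circ> rep A}"
    using rv_le[OF rv]
    by (intro class_eqI nabla_map_rv[OF \<tau>] nabla_map_rv[OF \<sigma>] nabla_map_rv[OF Delta_hom_compose[OF \<sigma> \<tau>]] rv AE_I2)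
      (simp add: compose_def)
  finally show ?thesis
    by (simp add: nabla_map_def)
qed

lemma nabla_map_fixed:
  assumes \<sigma>: "\<sigma> \<in> Delta_hom n n" and A: "A \<in> topspace (nabla M n)"
    and fixed: "\<And>i. i \<le> n \<Longrightarrow> 0 < law M n A i \<Longrightarrow> \<sigma> i = i"
  shows "nabla_map M n n \<sigma> A = A"
proof -
  note rv = rep_nabla(1)[OF A]
  note [measurable] = rv_measurable[OF rv]
  have "AE t in M. rep A t \<noteq> i" if "\<not> 0 < law M n A i" for i
  proof -
    have "prob {t \<in> space M. rep A t = i} = 0"
      using that measure_nonneg[of M "{t \<in> space M. rep A t = i}"] by (simp add: law_def)
    then show ?thesis
      using AE_space by (subst (asm) prob_eq_0) (auto elim: eventually_elim2)
  qed
  then have "AE t in M. 0 < law M n A i \<or> rep A t \<noteq> i" for i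
    by (cases "0 < law M n A i") auto
  then have "AE t in M. \<forall>i. 0 < law M n A i \<or> rep A t \<noteq> i"
    by (simp add: AE_all_countable)
  then have "AE t in M. (\<sigma> \<circ> rep A) t = rep A t"
    using AE_space by eventually_elim (use fixed rv_le[OF rv] in auto)
  then have "ae_rel M n `` {\<sigma> \<circ> rep A} = ae_rel M n `` {rep A}"
    by (intro class_eqI nabla_map_rv[OF \<sigma>] rv)
  then show ?thesis
    by (simp add: nabla_map_def rep_nabla(2)[OF A])
qed

end

context uniform_rv
begin

lemma prob_interval:
  assumes "0 \<le> a" "a \<le> b" "b \<le> 1"
  shows "prob {\<omega> \<in> space M. a \<le> U \<omega> \<and> U \<omega> < b} = b - a"
proof -
  have "{\<omega> \<in> space M. a \<le> U \<omega> \<and> U \<omega> < b} = {\<omega> \<in> space M. U \<omega> < b} - {\<omega> \<in> space M. U \<omega> < a}"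
    by auto
  then show ?thesis
    using assms by (simp add: finite_measure_Diff U_uniform Collect_mono_iff)
qed

lemma step_U_iff:
  assumes "x \<in> standard_simplex n"
  shows "step x (U \<omega>) = i \<longleftrightarrow> psum x i - x i \<le> U \<omega> \<and> U \<omega> < psum x i"
  using step_eqD[OF assms U_ge_0 U_less_1] step_eqI[OF assms U_less_1] by blast

lemma step_U_rv:
  assumes "x \<in> standard_simplex n"
  shows "(\<lambda>\<omega>. step x (U \<omega>)) \<in> rv M n"
  using step_le[OF assms U_less_1] by (intro rvI) (simp_all add: step_U_iff[OF assms])

text \<open>The random variable with law \<open>x\<close> that is an increasing function of \<open>U\<close>.\<close>

definition quantile_rv :: "nat \<Rightarrow> (nat \<Rightarrow> real) \<Rightarrow> ('w \<Rightarrow> nat) set" where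
  "quantile_rv n x = ae_rel M n `` {\<lambda>\<omega>. step x (U \<omega>)}"

lemma law_quantile_rv:
  assumes x: "x \<in> standard_simplex n"
  shows "law M n (quantile_rv n x) = x"
proof
  fix i
  have "law M n (quantile_rv n x) i = prob {\<omega> \<in> space M. psum x i - x i \<le> U \<omega> \<and> U \<omega> < psum x i}"
    unfolding quantile_rv_def law_class[OF step_U_rv[OF x]] by (simp add: step_U_iff[OF x])
  also have "\<dots> = psum x i - (psum x i - x i)"
  proof (rule prob_interval)
    show "0 \<le> psum x i - x i"
      by (cases i) (use psum_bounds(1)[OF x] in \<open>simp_all add: psum_def\<close>)
  qed (use psum_bounds[OF x] x in \<open>auto simp: standard_simplex_def\<close>)
  finally show "law M n (quantile_rv n x) i = x i"
    by simp
qed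

lemma prob_step_differ:
  assumes x: "x \<in> standard_simplex n" and y: "y \<in> standard_simplex n"
  shows "prob {\<omega> \<in> space M. step x (U \<omega>) \<noteq> step y (U \<omega>)} \<le> (\<Sum>i\<le>n. \<bar>psum x i - psum y i\<bar>)"
proof -
  define S where "S i = {\<omega> \<in> space M. min (psum x i) (psum y i) \<le> U \<omega> \<and> U \<omega> < max (psum x i) (psum y i)}" for i
  have [measurable]: "S i \<in> sets M" for i
    unfolding S_def by measurable
  have "prob {\<omega> \<in> space M. step x (U \<omega>) \<noteq> step y (U \<omega>)} \<le> prob (\<Union>i\<in>{..n}. S i)"
    using step_differ_subset[OF x y U_less_1]
    by (intro finite_measure_mono) (fastforce simp: S_def, measurable)
  also have "\<dots> \<le> (\<Sum>i\<le>n. prob (S i))"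
    by (rule measure_UNION_le) auto
  also have "\<dots> = (\<Sum>i\<le>n. \<bar>psum x i - psum y i\<bar>)"
    unfolding S_def using psum_bounds[OF x] psum_bounds[OF y]
    by (intro sum.cong refl, subst prob_interval) auto
  finally show ?thesis .
qed

lemma natural_family_quantile_rv:
  "natural_family simplex_top simplex_top_map (nabla M) (nabla_map M) quantile_rv"
  unfolding natural_family_def
proof (intro conjI allI ballI)
  fix n
  show "continuous_map (simplex_top n) (nabla M n) (quantile_rv n)"
  proof (rule continuous_map_into_nabla; unfold topspace_simplex_top)
    show "quantile_rv n x \<in> topspace (nabla M n)" if "x \<in> standard_simplex n" for x
      unfolding quantile_rv_def using that by (intro class_in_nabla step_U_rv)
    fix x assume x: "x \<in> standard_simplex n"
    have "nabla_dist M (quantile_rv n x) (quantile_rv n y) \<le> (\<Sum>i\<le>n. \<bar>psum x i - psum y i\<bar>)"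
      if y: "y \<in> standard_simplex n" for y
      unfolding quantile_rv_def nabla_dist_class[OF step_U_rv[OF x] step_U_rv[OF y]]
      by (rule prob_step_differ[OF x y])
    then show "\<exists>D. continuous_map (simplex_top n) euclideanreal D \<and> D x = 0 \<and>
        (\<forall>y\<in>standard_simplex n. nabla_dist M (quantile_rv n x) (quantile_rv n y) \<le> D y)"
      using continuous_sum_psum_diff[OF continuous_map_id[unfolded id_def], of n "psum x"]
      by (intro exI[of _ "\<lambda>y. \<Sum>i\<le>n. \<bar>psum x i - psum y i\<bar>"]) auto
  qed
next
  fix n m \<sigma> x assume \<sigma>: "\<sigma> \<in> Delta_hom n m" and "x \<in> topspace (simplex_top n)"
  then have x: "x \<in> standard_simplex n"
    by (simp add: topspace_simplex_top)
  have "\<sigma> \<circ> (\<lambda>\<omega>. step x (U \<omega>)) = (\<lambda>\<omega>. step (simplex_top_map n m \<sigma> x) (U \<omega>))"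
    by (simp add: fun_eq_iff step_natural[OF \<sigma> x U_ge_0 U_less_1])
  then show "quantile_rv m (simplex_top_map n m \<sigma> x) = nabla_map M n m \<sigma> (quantile_rv n x)"
    unfolding quantile_rv_def by (simp add: nabla_map_class[OF \<sigma> step_U_rv[OF x]])
qed

text \<open>The homotopy from the identity to the increasing rearrangement: at time \<open>t\<close> the variable is
  rearranged on the event \<open>U < t\<close>, of measure \<open>t\<close>, and kept elsewhere.\<close>

definition rearrange :: "real \<Rightarrow> nat \<Rightarrow> ('w \<Rightarrow> nat) set \<Rightarrow> ('w \<Rightarrow> nat) set" where
  "rearrange t n A = ae_rel M n `` {\<lambda>\<omega>. if U \<omega> < t then step (law M n A) (U \<omega>) else rep A \<omega>}"

lemma rearrange_rv:
  assumes A: "A \<in> topspace (nabla M n)"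
  shows "(\<lambda>\<omega>. if U \<omega> < t then step (law M n A) (U \<omega>) else rep A \<omega>) \<in> rv M n"
  using step_U_rv[OF law_simplex[OF A]] rep_nabla(1)[OF A] unfolding rv_def by measurable

lemma rearrange_nabla: "A \<in> topspace (nabla M n) \<Longrightarrow> rearrange t n A \<in> topspace (nabla M n)"
  unfolding rearrange_def by (intro class_in_nabla rearrange_rv)

lemma rearrange_0: "A \<in> topspace (nabla M n) \<Longrightarrow> rearrange 0 n A = A"
  using rep_nabla(2)[of A n] U_ge_0 by (simp add: rearrange_def not_less[symmetric] leD)

lemma rearrange_1: "rearrange 1 n A = quantile_rv n (law M n A)"
  by (simp add: rearrange_def quantile_rv_def U_less_1)

lemma continuous_rearrange:
  "continuous_map (prod_topology (top_of_set {0..1}) (nabla M n)) (nabla M n) (\<lambda>(t, A). rearrange t n A)"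
    (is "continuous_map ?P _ _")
proof (rule continuous_map_into_nabla)
  show "(case p of (t, A) \<Rightarrow> rearrange t n A) \<in> topspace (nabla M n)" if "p \<in> topspace ?P" for p
    using that by (auto intro: rearrange_nabla)
  fix p assume p: "p \<in> topspace ?P"
  obtain t A where tA: "p = (t, A)"
    by (cases p)
  have t: "t \<in> {0..1}" and A: "A \<in> topspace (nabla M n)"
    using p tA by auto
  define D where "D = (\<lambda>(s, B). \<bar>t - s\<bar> + nabla_dist M A B + (\<Sum>i\<le>n. \<bar>psum (law M n A) i - psum (law M n B) i\<bar>))"
  have "continuous_map ?P euclideanreal (\<lambda>q. \<bar>t - fst q\<bar>)"
    by (intro continuous_map_real_abs continuous_map_diff continuous_map_fst_of continuous_map_const[THEN iffD2])
      (auto simp: continuous_map_fst_of intro: continuous_map_into_fulltopology[OF continuous_map_fst])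
  moreover have "continuous_map ?P euclideanreal (\<lambda>q. nabla_dist M A (snd q))"
    using continuous_map_compose[OF continuous_map_snd continuous_nabla_dist[OF A]] by (simp add: o_def)
  moreover have "continuous_map ?P euclideanreal (\<lambda>q. \<Sum>i\<le>n. \<bar>psum (law M n A) i - psum (law M n (snd q)) i\<bar>)"
  proof (rule continuous_sum_psum_diff)
    show "continuous_map ?P (simplex_top n) (\<lambda>q. law M n (snd q))"
      using natural_family_law
      by (intro continuous_map_compose[OF continuous_map_snd, unfolded o_def]) (simp add: natural_family_def)
  qed
  ultimately have cont: "continuous_map ?P euclideanreal D"
    unfolding D_def case_prod_unfold by (intro continuous_map_add)
  have "nabla_dist M (rearrange t n A) (rearrange s n B) \<le> D (s, B)"
    if s: "s \<in> {0..1}" and B: "B \<in> topspace (nabla M n)" for s B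
  proof -
    let ?S1 = "{\<omega> \<in> space M. min s t \<le> U \<omega> \<and> U \<omega> < max s t}"
    let ?S2 = "{\<omega> \<in> space M. rep A \<omega> \<noteq> rep B \<omega>}"
    let ?S3 = "{\<omega> \<in> space M. step (law M n A) (U \<omega>) \<noteq> step (law M n B) (U \<omega>)}"
    have S: "?S1 \<in> sets M" "?S2 \<in> sets M" "?S3 \<in> sets M"
      using rv_neq_measurable[OF rep_nabla(1)[OF A] rep_nabla(1)[OF B]]
        rv_neq_measurable[OF step_U_rv[OF law_simplex[OF A]] step_U_rv[OF law_simplex[OF B]]]
      by auto
    have "nabla_dist M (rearrange t n A) (rearrange s n B) \<le> prob (?S1 \<union> ?S2 \<union> ?S3)"
      unfolding rearrange_def
    proof (rule nabla_dist_class_le[OF rearrange_rv[OF A] rearrange_rv[OF B]])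
      show "?S1 \<union> ?S2 \<union> ?S3 \<in> sets M"
        using S by auto
    qed (auto split: if_splits)
    also have "\<dots> \<le> prob ?S1 + prob ?S2 + prob ?S3"
      using S measure_Un_le[of "?S1 \<union> ?S2" M ?S3] measure_Un_le[of ?S1 M ?S2] by simp
    also have "\<dots> \<le> D (s, B)"
      using prob_interval[of "min s t" "max s t"] s t prob_step_differ[OF law_simplex[OF A] law_simplex[OF B]]
      by (auto simp: D_def nabla_dist_def)
    finally show ?thesis .
  qed
  then show "\<exists>D. continuous_map ?P euclideanreal D \<and> D p = 0 \<and>
      (\<forall>q\<in>topspace ?P. nabla_dist M (case p of (t, A) \<Rightarrow> rearrange t n A) (case q of (t, A) \<Rightarrow> rearrange t n A) \<le> D q)"
    using cont nabla_dist_self[OF A] tA by (intro exI[of _ D]) (auto simp: D_def)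
qed

lemma natural_family_rearrange:
  assumes "t \<in> {0..1}"
  shows "natural_family (nabla M) (nabla_map M) (nabla M) (nabla_map M) (rearrange t)"
  unfolding natural_family_def
proof (intro conjI allI ballI)
  fix n
  have "continuous_map (nabla M n) (prod_topology (top_of_set {0..1}) (nabla M n)) (\<lambda>A. (t, A))"
    using assms by (simp add: continuous_map_pairwise o_def)
  from continuous_map_compose[OF this continuous_rearrange]
  show "continuous_map (nabla M n) (nabla M n) (rearrange t n)"
    by (simp add: o_def)
next
  fix n m \<sigma> A assume \<sigma>: "\<sigma> \<in> Delta_hom n m" and A: "A \<in> topspace (nabla M n)"
  note law = law_natural[OF prob_space_axioms \<sigma> A]
  have "AE \<omega> in M. (\<sigma> \<circ> rep A) \<omega> = rep (nabla_map M n m \<sigma> A) \<omega>"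
    unfolding nabla_map_def by (rule rep_class(2)[OF nabla_map_rv[OF \<sigma> rep_nabla(1)[OF A]]])
  then have "AE \<omega> in M. (if U \<omega> < t then step (law M m (nabla_map M n m \<sigma> A)) (U \<omega>) else rep (nabla_map M n m \<sigma> A) \<omega>)
      = (\<sigma> \<circ> (\<lambda>\<omega>. if U \<omega> < t then step (law M n A) (U \<omega>) else rep A \<omega>)) \<omega>"
    by eventually_elim (simp add: law step_natural[OF \<sigma> law_simplex[OF A] U_ge_0 U_less_1])
  then show "rearrange t m (nabla_map M n m \<sigma> A) = nabla_map M n m \<sigma> (rearrange t n A)"
    unfolding rearrange_def nabla_map_class[OF \<sigma> rearrange_rv[OF A]]
    by (intro class_eqI rearrange_rv nabla_map_nabla[OF \<sigma> A] nabla_map_rv[OF \<sigma>] A)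
qed

lemma homotopy_equivalence_law_map:
  "homotopy_equivalence_map (L_space M F) (geom_realization F) (law_map M F)"
proof -
  define s where "s = realization_map F (nabla M) (nabla_map M) quantile_rv"
  have law: "continuous_map (L_space M F) (geom_realization F) (law_map M F)"
    unfolding L_space_def geom_realization_def law_map_def
    by (rule continuous_realization_map[OF natural_family_law])
  have s: "continuous_map (geom_realization F) (L_space M F) s"
    unfolding L_space_def geom_realization_def s_def
    by (rule continuous_realization_map[OF natural_family_quantile_rv])
  have "law_map M F (s z) = z" if "z \<in> topspace (geom_realization F)" for z
    using that unfolding geom_realization_def
    by (elim realization_cases) (simp add: law_map_def s_def realization_map_natural[OF natural_family_law]
        realization_map_natural[OF natural_family_quantile_rv] law_quantile_rv topspace_simplex_top)
  then have 1: "homotopic_with (\<lambda>_. True) (geom_realization F) (geom_realization F) (law_map M F \<circ> s) id"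
    using continuous_map_compose[OF s law] by (intro homotopic_with_equal) auto
  have hom: "homotopic_with (\<lambda>_. True) (L_space M F) (L_space M F)
      (realization_map F (nabla M) (nabla_map M) (rearrange 0)) (realization_map F (nabla M) (nabla_map M) (rearrange 1))"
    unfolding L_space_def by (rule homotopic_realization_map[OF continuous_rearrange natural_family_rearrange])
  have eqs: "realization_map F (nabla M) (nabla_map M) (rearrange 0) z = id z"
    "realization_map F (nabla M) (nabla_map M) (rearrange 1) z = (s \<circ> law_map M F) z"
    if "z \<in> topspace (L_space M F)" for z
    using that unfolding L_space_def
    by (auto elim!: realization_cases simp: law_map_def s_def realization_map_natural[OF natural_family_law]
        realization_map_natural[OF natural_family_quantile_rv] realization_map_natural[OF natural_family_rearrange]
        rearrange_0 rearrange_1)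
  have "homotopic_with (\<lambda>_. True) (L_space M F) (L_space M F) id (s \<circ> law_map M F)"
    by (rule homotopic_with_eq[OF hom]) (simp_all add: eqs)
  then have 2: "homotopic_with (\<lambda>_. True) (L_space M F) (L_space M F) (s \<circ> law_map M F) id"
    by (simp add: homotopic_with_sym)
  show ?thesis
    unfolding homotopy_equivalence_map_def using law s 1 2 by blast
qed

end

section \<open>The Kan property\<close>

context uniform_rv
begin

text \<open>The function \<open>u \<mapsto> \<lambda>(B \<inter> {U < u})\<close> is increasing and continuous, so composed with \<open>U\<close> it
  distributes the measure of \<open>B\<close> uniformly over \<open>[0, \<lambda>(B)]\<close>.\<close>

definition mass_below :: "'w set \<Rightarrow> real \<Rightarrow> real" where
  "mass_below B u = prob (B \<inter> {\<omega> \<in> space M. U \<omega> < u})"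

lemma mass_below_nonneg: "0 \<le> mass_below B u"
  by (simp add: mass_below_def)

lemma mass_below_mono:
  assumes "B \<in> sets M" "u \<le> v"
  shows "mass_below B u \<le> mass_below B v"
  unfolding mass_below_def using assms by (intro finite_measure_mono) auto

lemma mass_below_le: "B \<in> sets M \<Longrightarrow> mass_below B u \<le> prob B"
  unfolding mass_below_def by (intro finite_measure_mono) auto

lemma mass_below_lipschitz:
  assumes B: "B \<in> sets M" and uv: "0 \<le> u" "u \<le> v" "v \<le> 1"
  shows "mass_below B v \<le> mass_below B u + (v - u)"
proof -
  have "mass_below B v \<le> prob ((B \<inter> {\<omega> \<in> space M. U \<omega> < u}) \<union> {\<omega> \<in> space M. u \<le> U \<omega> \<and> U \<omega> < v})"
    unfolding mass_below_def using B by (intro finite_measure_mono) auto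
  also have "\<dots> \<le> mass_below B u + prob {\<omega> \<in> space M. u \<le> U \<omega> \<and> U \<omega> < v}"
    unfolding mass_below_def using B by (intro measure_Un_le) auto
  finally show ?thesis
    using prob_interval[OF uv] by simp
qed

lemma mass_below_measurable:
  assumes "B \<in> sets M"
  shows "(\<lambda>\<omega>. mass_below B (U \<omega>)) \<in> borel_measurable M"
proof -
  have "mono (mass_below B)"
    using mass_below_mono[OF assms] by (simp add: mono_def)
  then show ?thesis
    by (intro measurable_compose[OF U_measurable] borel_measurable_mono)
qed

lemma prob_mass_below_less:
  assumes B: "B \<in> sets M" and b: "0 \<le> b" "b \<le> prob B"
  shows "prob {\<omega> \<in> B. mass_below B (U \<omega>) < b} = b"
proof -
  have Bsp: "B \<subseteq> space M"
    using B by (rule sets.sets_into_space)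
  have ends: "mass_below B 0 = 0" "mass_below B 1 = prob B"
    using U_ge_0 U_less_1 Bsp by (simp_all add: mass_below_def not_less[symmetric] leD Int_absorb2)
  have lip: "\<bar>mass_below B v - mass_below B u\<bar> \<le> \<bar>v - u\<bar>" if "u \<in> {0..1}" "v \<in> {0..1}" for u v
    using mass_below_lipschitz[OF B, of u v] mass_below_lipschitz[OF B, of v u]
      mass_below_mono[OF B, of u v] mass_below_mono[OF B, of v u] that
    by (cases "u \<le> v") auto
  have cont: "continuous_on {0..1} (mass_below B)"
    unfolding continuous_on_iff
  proof (intro ballI allI impI)
    fix u e :: real assume "u \<in> {0..1}" "0 < e"
    then show "\<exists>d>0. \<forall>v\<in>{0..1}. dist v u < d \<longrightarrow> dist (mass_below B v) (mass_below B u) < e"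
      using lip by (intro exI[of _ e]) (fastforce simp: dist_real_def)
  qed
  \<comment> \<open>\<open>c\<close> is the least \<open>u\<close> at which the mass below reaches \<open>b\<close>, so that the event is \<open>U < c\<close>\<close>
  define K where "K = {u \<in> {0..1}. mass_below B u = b}"
  have "K \<noteq> {}"
    using IVT'[of "mass_below B" 0 b 1] ends b cont by (auto simp: K_def)
  moreover have "compact K"
  proof -
    have "closed ({0..1} \<inter> mass_below B -` {b})"
      using cont by (intro continuous_closed_preimage) auto
    moreover have "K = {0..1} \<inter> mass_below B -` {b}"
      by (auto simp: K_def)
    ultimately show ?thesis
      using compact_Int_closed[OF compact_Icc, of "{0..1} \<inter> mass_below B -` {b}" 0 1] by (simp add: Int_absorb1)
  qed
  ultimately obtain c where c: "c \<in> K" "\<And>u. u \<in> K \<Longrightarrow> c \<le> u"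
    using compact_attains_inf by metis
  have "mass_below B (U \<omega>) < b \<longleftrightarrow> U \<omega> < c" for \<omega>
  proof
    show "U \<omega> < c" if "mass_below B (U \<omega>) < b"
      using mass_below_mono[OF B, of c "U \<omega>"] c(1) that by (force simp: K_def)
    show "mass_below B (U \<omega>) < b" if "U \<omega> < c"
    proof -
      have "mass_below B (U \<omega>) \<le> b"
        using mass_below_mono[OF B, of "U \<omega>" c] c(1) that by (simp add: K_def)
      moreover have "mass_below B (U \<omega>) \<noteq> b"
        using c(2)[of "U \<omega>"] that U_ge_0[of \<omega>] U_less_1[of \<omega>] by (auto simp: K_def)
      ultimately show ?thesis
        by simp
    qed
  qed
  then have "{\<omega> \<in> B. mass_below B (U \<omega>) < b} = B \<inter> {\<omega> \<in> space M. U \<omega> < c}"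
    using Bsp by auto
  then show ?thesis
    using c(1) by (simp add: K_def mass_below_def)
qed

lemma prob_mass_below_between:
  assumes B: "B \<in> sets M" and ab: "a \<le> b"
  shows "prob {\<omega> \<in> B. a \<le> mass_below B (U \<omega>) \<and> mass_below B (U \<omega>) < b} \<le> b - a"
proof -
  have Bsp: "B \<subseteq> space M"
    using B by (rule sets.sets_into_space)
  have prob: "prob {\<omega> \<in> B. mass_below B (U \<omega>) < c} = max 0 (min c (prob B))" for c
  proof -
    consider "c < 0" | "prob B < c" | "0 \<le> c" "c \<le> prob B"
      by linarith
    then show ?thesis
    proof cases
      case 1
      then have "\<not> mass_below B u < c" for u
        using mass_below_nonneg[of B u] by linarith
      then have "{\<omega> \<in> B. mass_below B (U \<omega>) < c} = {}"
        by blast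
      then show ?thesis
        using 1 by (simp only: measure_empty)
    next
      case 2
      then have "mass_below B u < c" for u
        using mass_below_le[OF B, of u] by linarith
      then have "{\<omega> \<in> B. mass_below B (U \<omega>) < c} = B"
        by blast
      then show ?thesis
        using 2 measure_nonneg[of M B] by simp
    next
      case 3
      then show ?thesis
        using prob_mass_below_less[OF B, of c] by simp
    qed
  qed
  have meas: "{\<omega> \<in> B. mass_below B (U \<omega>) < c} \<in> sets M" for c
  proof -
    have "{\<omega> \<in> B. mass_below B (U \<omega>) < c} = B \<inter> {\<omega> \<in> space M. mass_below B (U \<omega>) < c}"
      using Bsp by auto
    then show ?thesis
      using B mass_below_measurable[OF B] by simp
  qed
  have "{\<omega> \<in> B. a \<le> mass_below B (U \<omega>) \<and> mass_below B (U \<omega>) < b} =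
      {\<omega> \<in> B. mass_below B (U \<omega>) < b} - {\<omega> \<in> B. mass_below B (U \<omega>) < a}"
    by auto
  also have "prob \<dots> = max 0 (min b (prob B)) - max 0 (min a (prob B))"
    using ab by (subst finite_measure_Diff) (auto simp: meas prob)
  also have "\<dots> \<le> b - a"
    using ab measure_nonneg[of M B] by (auto simp: max_def min_def)
  finally show ?thesis .
qed

text \<open>The event that the random variable takes the value \<open>i\<close>.\<close>

definition fibre :: "('w \<Rightarrow> nat) set \<Rightarrow> nat \<Rightarrow> 'w set" where
  "fibre A i = {\<omega> \<in> space M. rep A \<omega> = i}"

text \<open>The smallest probability of a value other than \<open>k\<close>. It vanishes exactly on the union of the
  faces of \<open>\<nabla>\<^sub>n\<close> opposite to the vertices \<open>i \<noteq> k\<close>.\<close>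

definition low :: "nat \<Rightarrow> nat \<Rightarrow> ('w \<Rightarrow> nat) set \<Rightarrow> real" where
  "low n k A = Min (law M n A ` ({..n} - {k}))"

text \<open>For each value \<open>i \<noteq> k\<close> the initial part of measure \<open>low n k A\<close> of its fibre, in the order given
  by \<open>U\<close>, is sent to \<open>k\<close>. A value of probability \<open>low n k A\<close> then disappears.\<close>

definition push :: "nat \<Rightarrow> nat \<Rightarrow> ('w \<Rightarrow> nat) set \<Rightarrow> 'w \<Rightarrow> nat" where
  "push n k A = (\<lambda>\<omega>. if rep A \<omega> \<noteq> k \<and> mass_below (fibre A (rep A \<omega>)) (U \<omega>) < low n k A then k else rep A \<omega>)"

text \<open>The retraction of \<open>\<nabla>\<^sub>n\<close> onto the union of its faces opposite to the vertices \<open>i \<noteq> k\<close>.\<close>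

definition horn_retraction :: "nat \<Rightarrow> nat \<Rightarrow> ('w \<Rightarrow> nat) set \<Rightarrow> ('w \<Rightarrow> nat) set" where
  "horn_retraction n k A = ae_rel M n `` {push n k A}"

lemma fibre_sets: "A \<in> topspace (nabla M n) \<Longrightarrow> fibre A i \<in> sets M"
  using rv_measurable[OF rep_nabla(1)] unfolding fibre_def by measurable

lemma prob_fibre: "prob (fibre A i) = law M n A i"
  by (simp add: fibre_def law_def)

lemma low_attained:
  assumes "1 \<le> n"
  obtains i where "i \<le> n" "i \<noteq> k" "low n k A = law M n A i"
proof -
  have ne: "{..n} - {k} \<noteq> {}"
  proof
    assume "{..n} - {k} = {}"
    then have "{0, 1} \<subseteq> {k}"
      using assms by auto
    then show False
      by auto
  qed
  have "low n k A \<in> law M n A ` ({..n} - {k})"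
    unfolding low_def by (rule Min_in) (use ne in auto)
  then show thesis
    using that by auto
qed

lemma low_le: "i \<le> n \<Longrightarrow> i \<noteq> k \<Longrightarrow> low n k A \<le> law M n A i"
  unfolding low_def by (rule Min_le) auto

lemma low_diff_le_nabla_dist:
  assumes n: "1 \<le> n" and A: "A \<in> topspace (nabla M n)" and B: "B \<in> topspace (nabla M n)"
  shows "\<bar>low n k A - low n k B\<bar> \<le> nabla_dist M A B"
proof -
  obtain i where i: "i \<le> n" "i \<noteq> k" "low n k A = law M n A i"
    using low_attained[OF n] .
  obtain j where j: "j \<le> n" "j \<noteq> k" "low n k B = law M n B j"
    using low_attained[OF n] .
  show ?thesis
    using low_le[OF i(1,2), of B] low_le[OF j(1,2), of A] i j
      law_diff_le_nabla_dist[OF A B, of i] law_diff_le_nabla_dist[OF A B, of j] by linarith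
qed

lemma push_rv:
  assumes k: "k \<le> n" and A: "A \<in> topspace (nabla M n)"
  shows "push n k A \<in> rv M n"
proof -
  have "{\<omega> \<in> space M. rep A \<omega> \<noteq> k \<and> mass_below (fibre A (rep A \<omega>)) (U \<omega>) < low n k A} =
      (\<Union>j\<in>{..n} - {k}. fibre A j \<inter> {\<omega> \<in> space M. mass_below (fibre A j) (U \<omega>) < low n k A})"
    using rv_le[OF rep_nabla(1)[OF A]] by (auto simp: fibre_def)
  also have "\<dots> \<in> sets M"
    using fibre_sets[OF A] mass_below_measurable[OF fibre_sets[OF A]] by (intro sets.finite_UN) auto
  finally show ?thesis
    using k rep_nabla(1)[OF A] unfolding push_def rv_def by (intro measurable_If) auto
qed

lemma horn_retraction_nabla:
  "k \<le> n \<Longrightarrow> A \<in> topspace (nabla M n) \<Longrightarrow> horn_retraction n k A \<in> topspace (nabla M n)"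
  unfolding horn_retraction_def by (intro class_in_nabla push_rv)

lemma horn_retraction_fixed:
  assumes A: "A \<in> topspace (nabla M n)" and i: "i \<le> n" "i \<noteq> k" "law M n A i = 0"
  shows "horn_retraction n k A = A"
proof -
  have "low n k A \<le> 0"
    using low_le[OF i(1,2), of A] i(3) by simp
  then have "\<not> mass_below B u < low n k A" for B u
    using mass_below_nonneg[of B u] by linarith
  then have "push n k A = rep A"
    by (simp add: push_def)
  then show ?thesis
    by (simp add: horn_retraction_def rep_nabla(2)[OF A])
qed

lemma horn_retraction_in_horn:
  assumes n: "1 \<le> n" and k: "k \<le> n" and A: "A \<in> topspace (nabla M n)"
  obtains i where "i \<le> n" "i \<noteq> k" "law M n (horn_retraction n k A) i = 0"
proof -
  obtain i where i: "i \<le> n" "i \<noteq> k" "low n k A = law M n A i"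
    using low_attained[OF n] .
  note B = fibre_sets[OF A, of i]
  have "law M n (horn_retraction n k A) i = prob {\<omega> \<in> space M. push n k A \<omega> = i}"
    unfolding horn_retraction_def by (rule law_class[OF push_rv[OF k A]])
  also have "{\<omega> \<in> space M. push n k A \<omega> = i} = fibre A i - {\<omega> \<in> fibre A i. mass_below (fibre A i) (U \<omega>) < low n k A}"
    using i(2) by (auto simp: push_def fibre_def)
  also have "prob \<dots> = prob (fibre A i) - prob {\<omega> \<in> fibre A i. mass_below (fibre A i) (U \<omega>) < low n k A}"
  proof (rule finite_measure_Diff[OF B])
    have "{\<omega> \<in> fibre A i. mass_below (fibre A i) (U \<omega>) < low n k A} =
        fibre A i \<inter> {\<omega> \<in> space M. mass_below (fibre A i) (U \<omega>) < low n k A}"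
      by (auto simp: fibre_def)
    then show "{\<omega> \<in> fibre A i. mass_below (fibre A i) (U \<omega>) < low n k A} \<in> sets M"
      using B mass_below_measurable[OF B] by simp
  qed auto
  also have "\<dots> = 0"
    using prob_mass_below_less[OF B, of "low n k A"] i(3) by (simp add: prob_fibre[of A i n] law_def)
  finally show thesis
    using that i by blast
qed

lemma continuous_horn_retraction:
  assumes n: "1 \<le> n" and k: "k \<le> n"
  shows "continuous_map (nabla M n) (nabla M n) (horn_retraction n k)"
proof (rule continuous_map_into_nabla)
  show "horn_retraction n k A \<in> topspace (nabla M n)" if "A \<in> topspace (nabla M n)" for A
    using k that by (rule horn_retraction_nabla)
  fix A assume A: "A \<in> topspace (nabla M n)"
  define D where "D B = nabla_dist M A B + (\<Sum>i\<le>n. 4 * nabla_dist M A B)" for B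
  have "nabla_dist M (horn_retraction n k A) (horn_retraction n k B) \<le> D B"
    if B: "B \<in> topspace (nabla M n)" for B
  proof -
    define d where "d = nabla_dist M A B"
    \<comment> \<open>if the variables agree at a point but their images do not, the mass below is within \<open>2 * d\<close> of the threshold\<close>
    define R where "R i = {\<omega> \<in> fibre A i. low n k A - 2 * d \<le> mass_below (fibre A i) (U \<omega>) \<and>
        mass_below (fibre A i) (U \<omega>) < low n k A + 2 * d}" for i
    let ?N = "{\<omega> \<in> space M. rep A \<omega> \<noteq> rep B \<omega>}"
    have d: "0 \<le> d" and low: "\<bar>low n k A - low n k B\<bar> \<le> d"
      using low_diff_le_nabla_dist[OF n A B] by (auto simp: d_def nabla_dist_def)
    have mass: "\<bar>mass_below (fibre A i) u - mass_below (fibre B i) u\<bar> \<le> d" for i u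
      unfolding mass_below_def fibre_def d_def by (rule prob_diff_le_nabla_dist[OF A B]) measurable
    have R: "R i \<in> sets M" for i
    proof -
      note [measurable] = mass_below_measurable[OF fibre_sets[OF A, of i]] fibre_sets[OF A, of i]
      have "R i = fibre A i \<inter> {\<omega> \<in> space M. low n k A - 2 * d \<le> mass_below (fibre A i) (U \<omega>) \<and>
          mass_below (fibre A i) (U \<omega>) < low n k A + 2 * d}"
        by (auto simp: R_def fibre_def)
      then show ?thesis
        by simp
    qed
    have N: "?N \<in> sets M"
      by (rule rv_neq_measurable[OF rep_nabla(1)[OF A] rep_nabla(1)[OF B]])
    have "nabla_dist M (horn_retraction n k A) (horn_retraction n k B) \<le> prob (?N \<union> (\<Union>i\<in>{..n}. R i))"
      unfolding horn_retraction_def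
    proof (rule nabla_dist_class_le[OF push_rv[OF k A] push_rv[OF k B]])
      show "?N \<union> (\<Union>i\<in>{..n}. R i) \<in> sets M"
        using N R by auto
      fix \<omega> assume \<omega>: "\<omega> \<in> space M" and differ: "push n k A \<omega> \<noteq> push n k B \<omega>"
      show "\<omega> \<in> ?N \<union> (\<Union>i\<in>{..n}. R i)"
      proof (cases "rep A \<omega> = rep B \<omega>")
        case True
        define i where "i = rep A \<omega>"
        have "(mass_below (fibre A i) (U \<omega>) < low n k A) \<noteq> (mass_below (fibre B i) (U \<omega>) < low n k B)"
          using differ True by (auto simp: push_def i_def split: if_splits)
        then have "\<omega> \<in> R i"
          using mass[of i "U \<omega>"] low \<omega> by (auto simp: R_def fibre_def i_def)
        then show ?thesis
          using rv_le[OF rep_nabla(1)[OF A] \<omega>] by (auto simp: i_def)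
      qed (use \<omega> in auto)
    qed
    also have "\<dots> \<le> prob ?N + prob (\<Union>i\<in>{..n}. R i)"
      using N R by (intro measure_Un_le) auto
    also have "\<dots> \<le> d + (\<Sum>i\<le>n. prob (R i))"
      using R by (intro add_mono measure_UNION_le) (auto simp: d_def nabla_dist_def)
    also have "\<dots> \<le> d + (\<Sum>i\<le>n. 4 * d)"
    proof (intro add_left_mono sum_mono)
      fix i
      show "prob (R i) \<le> 4 * d"
        using prob_mass_below_between[OF fibre_sets[OF A, of i], of "low n k A - 2 * d" "low n k A + 2 * d"] d
        by (simp add: R_def)
    qed
    finally show ?thesis
      by (simp add: D_def d_def)
  qed
  moreover have "continuous_map (nabla M n) euclideanreal D"
    unfolding D_def using continuous_nabla_dist[OF A]
    by (intro continuous_map_add continuous_map_sum continuous_map_real_mult_left) auto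
  ultimately show "\<exists>D. continuous_map (nabla M n) euclideanreal D \<and> D A = 0 \<and>
      (\<forall>B\<in>topspace (nabla M n). nabla_dist M (horn_retraction n k A) (horn_retraction n k B) \<le> D B)"
    using nabla_dist_self[OF A] by (intro exI[of _ D]) (simp add: D_def)
qed

end

text \<open>A retraction in the simplex category of \<open>[n]\<close> onto a nonempty subset \<open>S\<close>: the greatest element
  of \<open>S\<close> below \<open>j\<close>, or \<open>Min S\<close> if there is none.\<close>

definition vertex_retraction :: "nat \<Rightarrow> nat set \<Rightarrow> nat \<Rightarrow> nat" where
  "vertex_retraction n S = (\<lambda>j\<in>{..n}. if \<exists>s\<in>S. s \<le> j then Max {s \<in> S. s \<le> j} else Min S)"

lemma vertex_retraction:
  assumes S: "S \<subseteq> {..n}" "S \<noteq> {}"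
  shows "vertex_retraction n S \<in> Delta_hom n n"
    and "\<And>j. j \<in> S \<Longrightarrow> vertex_retraction n S j = j"
    and "\<And>j. j \<le> n \<Longrightarrow> vertex_retraction n S j \<in> S"
proof -
  have fin: "finite S"
    using S finite_subset by blast
  let ?r = "\<lambda>j. if \<exists>s\<in>S. s \<le> j then Max {s \<in> S. s \<le> j} else Min S"
  have Max: "Max {s \<in> S. s \<le> j} \<in> {s \<in> S. s \<le> j}" if "\<exists>s\<in>S. s \<le> j" for j
    by (rule Max_in) (use fin that in auto)
  have in_S: "?r j \<in> S" for j
    using Max Min_in[OF fin S(2)] by auto
  show "vertex_retraction n S j \<in> S" if "j \<le> n" for j
    using in_S that by (simp add: vertex_retraction_def)
  show "vertex_retraction n S j = j" if "j \<in> S" for j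
  proof -
    have "Max {s \<in> S. s \<le> j} = j"
      using that fin by (intro Max_eqI) auto
    then show ?thesis
      using that S by (auto simp: vertex_retraction_def)
  qed
  show "vertex_retraction n S \<in> Delta_hom n n"
    unfolding vertex_retraction_def
  proof (rule Delta_homI)
    show "?r j \<le> n" if "j \<le> n" for j
      using subsetD[OF S(1) in_S[of j]] unfolding atMost_iff .
    show "?r i \<le> ?r j" if "i \<le> j" "j \<le> n" for i j
    proof (cases "\<exists>s\<in>S. s \<le> i")
      case True
      then have "\<exists>s\<in>S. s \<le> j"
        using that(1) order_trans by blast
      moreover have "Max {s \<in> S. s \<le> i} \<le> Max {s \<in> S. s \<le> j}"
        using Max[OF True] fin that by (intro Max_ge) auto
      ultimately show ?thesis
        using True by simp
    next
      case False
      then have "?r i = Min S"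
        by simp
      also have "\<dots> \<le> ?r j"
        using in_S fin by (intro Min_le)
      finally show ?thesis .
    qed
  qed
qed

context uniform_rv
begin

lemma simplicial_set_Sing_RV: "simplicial_set (Sing_RV M X)"
  unfolding simplicial_set_def
proof (intro conjI allI ballI)
  fix n m \<sigma> assume \<sigma>: "\<sigma> \<in> Delta_hom n m"
  show "act (Sing_RV M X) n m \<sigma> \<in> simplices (Sing_RV M X) m \<rightarrow> simplices (Sing_RV M X) n"
    using continuous_map_compose[OF continuous_nabla_map[OF \<sigma>]]
    by (auto simp: Sing_RV_def)
next
  fix n f assume f: "f \<in> simplices (Sing_RV M X) n"
  have id: "restrict id {..n} \<in> Delta_hom n n"
    by (rule Delta_homI) auto
  have "nabla_map M n n (restrict id {..n}) A = A" if "A \<in> topspace (nabla M n)" for A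
    by (rule nabla_map_fixed[OF id that]) simp
  then show "act (Sing_RV M X) n n (restrict id {..n}) f = f"
    using f by (auto simp: Sing_RV_def extensional_def restrict_def)
next
  fix l n m \<sigma> \<tau> f
  assume "\<sigma> \<in> Delta_hom l n" "\<tau> \<in> Delta_hom n m" "f \<in> simplices (Sing_RV M X) m"
  then show "act (Sing_RV M X) l m (compose {..l} \<tau> \<sigma>) f =
      act (Sing_RV M X) l n \<sigma> (act (Sing_RV M X) n m \<tau> f)"
    by (auto simp: Sing_RV_def restrict_def fun_eq_iff nabla_map_compose nabla_map_nabla)
qed

text \<open>The horn defines the map \<open>A \<mapsto> f n r A\<close> on the union of the faces, where \<open>r\<close> retracts \<open>[n]\<close> onto the
  support of \<open>A\<close>. On the face opposite to \<open>i\<close> it agrees with \<open>f n e A\<close> for the fixed retraction \<open>e\<close> onto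
  \<open>[n] \<setminus> {i}\<close>, hence is continuous there, and the faces form a finite closed cover.\<close>

lemma horn_filler:
  assumes n: "1 \<le> n" and k: "k \<le> n" and f: "simplicial_map (horn n k) (Sing_RV M X) f"
  obtains g where "simplicial_map (std_sset n) (Sing_RV M X) g"
    "\<And>m \<tau>. \<tau> \<in> simplices (horn n k) m \<Longrightarrow> g m \<tau> = f m \<tau>"
proof -
  have horn: "\<tau> \<in> simplices (horn n k) m \<longleftrightarrow> \<tau> \<in> Delta_hom m n \<and> (\<exists>i\<le>n. i \<noteq> k \<and> i \<notin> \<tau> ` {..m})" for m \<tau>
    by (simp add: horn_def)
  have f_cont: "f m \<tau> \<in> extensional (topspace (nabla M m))" "continuous_map (nabla M m) X (f m \<tau>)"
    if "\<tau> \<in> simplices (horn n k) m" for m \<tau>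
    using f that by (auto simp: simplicial_map_def Sing_RV_def)
  have f_nat: "f l (compose {..l} \<tau> \<sigma>) A = f m \<tau> (nabla_map M l m \<sigma> A)"
    if "\<sigma> \<in> Delta_hom l m" "\<tau> \<in> simplices (horn n k) m" "A \<in> topspace (nabla M l)" for l m \<sigma> \<tau> A
  proof -
    have "f l (act (horn n k) l m \<sigma> \<tau>) = act (Sing_RV M X) l m \<sigma> (f m \<tau>)"
      using f that unfolding simplicial_map_def by blast
    then show ?thesis
      using that(3) by (simp add: horn_def std_sset_def Sing_RV_def)
  qed
  define e where "e i = vertex_retraction n ({..n} - {i})" for i
  have e: "e i \<in> simplices (horn n k) n" "e i \<in> Delta_hom n n" "\<And>j. j \<le> n \<Longrightarrow> j \<noteq> i \<Longrightarrow> e i j = j"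
    if i: "i \<le> n" "i \<noteq> k" for i
  proof -
    have ne: "{..n} - {i} \<noteq> {}"
      using i k by auto
    note r = vertex_retraction[OF Diff_subset ne]
    show "e i \<in> Delta_hom n n" "\<And>j. j \<le> n \<Longrightarrow> j \<noteq> i \<Longrightarrow> e i j = j"
      using r by (simp_all add: e_def)
    moreover have "i \<notin> e i ` {..n}"
    proof -
      have "e i j \<noteq> i" if "j \<le> n" for j
        using r(3)[OF that] unfolding e_def by blast
      then show ?thesis
        by (metis atMost_iff imageE)
    qed
    ultimately show "e i \<in> simplices (horn n k) n"
      using i by (auto simp: horn)
  qed
  define \<phi> where "\<phi> A = f n (vertex_retraction n {j. j \<le> n \<and> 0 < law M n A j}) A" for A
  have \<phi>_eq: "\<phi> A = f n (e i) A"
    if i: "i \<le> n" "i \<noteq> k" and A: "A \<in> topspace (nabla M n)" and zero: "law M n A i = 0" for i A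
  proof -
    define S where "S = {j. j \<le> n \<and> 0 < law M n A j}"
    have ne: "S \<noteq> {}"
    proof
      assume "S = {}"
      then have "(\<Sum>j\<le>n. law M n A j) \<le> 0"
        by (intro sum_nonpos) (force simp: S_def not_less)
      then show False
        using law_simplex[OF A] by (simp add: standard_simplex_def)
    qed
    have sub: "S \<subseteq> {..n}"
      by (auto simp: S_def)
    note p = vertex_retraction[OF sub ne]
    have "compose {..n} (e i) (vertex_retraction n S) = vertex_retraction n S"
    proof (rule extensionalityI[of _ "{..n}"])
      fix j assume "j \<in> {..n}"
      then have "vertex_retraction n S j \<in> S"
        using p(3) by simp
      moreover have "i \<notin> S"
        using zero by (simp add: S_def)
      ultimately have "vertex_retraction n S j \<noteq> i" "vertex_retraction n S j \<le> n"
        using sub by auto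
      then show "compose {..n} (e i) (vertex_retraction n S) j = vertex_retraction n S j"
        using e(3)[OF i, of "vertex_retraction n S j"] \<open>j \<in> {..n}\<close> by (simp add: compose_def)
    qed (auto simp: Delta_homD(4)[OF p(1)])
    then have "\<phi> A = f n (e i) (nabla_map M n n (vertex_retraction n S) A)"
      using f_nat[OF p(1) e(1)[OF i] A] by (simp add: \<phi>_def S_def)
    also have "nabla_map M n n (vertex_retraction n S) A = A"
      using p(1,2) by (intro nabla_map_fixed A) (auto simp: S_def)
    finally show ?thesis .
  qed
  define \<Phi> where "\<Phi> A = \<phi> (horn_retraction n k A)" for A
  note ret = continuous_horn_retraction[OF n k]
  note ret_nabla = horn_retraction_nabla[OF k]
  have \<Phi>_closed: "\<Phi> A \<in> topspace X" "\<exists>i\<in>{..n} - {k}. law M n (horn_retraction n k A) i = 0 \<and> \<Phi> A = f n (e i) (horn_retraction n k A)"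
    if A: "A \<in> topspace (nabla M n)" for A
  proof -
    obtain i where i: "i \<le> n" "i \<noteq> k" "law M n (horn_retraction n k A) i = 0"
      using horn_retraction_in_horn[OF n k A] .
    then have eq: "\<Phi> A = f n (e i) (horn_retraction n k A)"
      unfolding \<Phi>_def using ret_nabla[OF A] by (intro \<phi>_eq)
    then show "\<Phi> A \<in> topspace X"
      using continuous_map_funspace[OF f_cont(2)[OF e(1)[OF i(1,2)]]] ret_nabla[OF A] by (auto simp: Pi_iff)
    show "\<exists>i\<in>{..n} - {k}. law M n (horn_retraction n k A) i = 0 \<and> \<Phi> A = f n (e i) (horn_retraction n k A)"
      using i eq by auto
  qed
  have \<Phi>_cont: "continuous_map (nabla M n) X \<Phi>"
    unfolding continuous_map_closedin
  proof (intro conjI ballI allI impI)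
    show "\<Phi> \<in> topspace (nabla M n) \<rightarrow> topspace X"
      using \<Phi>_closed(1) by blast
    fix C assume C: "closedin X C"
    let ?F = "\<lambda>i. {A \<in> topspace (nabla M n). law M n (horn_retraction n k A) i \<in> {0}} \<inter>
        {A \<in> topspace (nabla M n). f n (e i) (horn_retraction n k A) \<in> C}"
    have "{A \<in> topspace (nabla M n). \<Phi> A \<in> C} = (\<Union>i\<in>{..n} - {k}. ?F i)"
      using \<Phi>_closed(2) \<phi>_eq[OF _ _ ret_nabla] by (fastforce simp: \<Phi>_def)
    also have "closedin (nabla M n) \<dots>"
    proof (intro closedin_Union ballI)
      fix T assume "T \<in> ?F ` ({..n} - {k})"
      then obtain i where i: "i \<le> n" "i \<noteq> k" "T = ?F i"
        by auto
      have "continuous_map (nabla M n) euclideanreal (\<lambda>A. law M n A i)"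
        by (rule continuous_map_nabla_real) (rule law_diff_le_nabla_dist)
      from continuous_map_compose[OF ret this]
      have "closedin (nabla M n) {A \<in> topspace (nabla M n). law M n (horn_retraction n k A) i \<in> {0}}"
        by (intro closedin_continuous_map_preimage[where Y = euclideanreal]) (auto simp: o_def)
      moreover from continuous_map_compose[OF ret f_cont(2)[OF e(1)[OF i(1,2)]]]
      have "closedin (nabla M n) {A \<in> topspace (nabla M n). f n (e i) (horn_retraction n k A) \<in> C}"
        using C by (intro closedin_continuous_map_preimage[where Y = X]) (auto simp: o_def)
      ultimately show "closedin (nabla M n) T"
        unfolding i(3) by (rule closedin_Int)
    qed auto
    finally show "closedin (nabla M n) {A \<in> topspace (nabla M n). \<Phi> A \<in> C}" .
  qed
  define g where "g m \<tau> = restrict (\<lambda>A. \<Phi> (nabla_map M m n \<tau> A)) (topspace (nabla M m))" for m \<tau>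
  show thesis
  proof (rule that[of g])
    show "simplicial_map (std_sset n) (Sing_RV M X) g"
      unfolding simplicial_map_def
    proof (intro conjI allI ballI)
      fix m
      show "g m \<in> simplices (std_sset n) m \<rightarrow> simplices (Sing_RV M X) m"
        using continuous_map_compose[OF continuous_nabla_map \<Phi>_cont]
        by (auto simp: g_def std_sset_def Sing_RV_def o_def)
    next
      fix l m \<sigma> \<tau>
      assume "\<sigma> \<in> Delta_hom l m" "\<tau> \<in> simplices (std_sset n) m"
      then show "g l (act (std_sset n) l m \<sigma> \<tau>) = act (Sing_RV M X) l m \<sigma> (g m \<tau>)"
        by (auto simp: g_def std_sset_def Sing_RV_def restrict_def fun_eq_iff nabla_map_compose nabla_map_nabla)
    qed
  next
    fix m \<tau> assume \<tau>: "\<tau> \<in> simplices (horn n k) m"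
    then have \<tau>_hom: "\<tau> \<in> Delta_hom m n"
      by (simp add: horn)
    obtain i where i: "i \<le> n" "i \<noteq> k" "i \<notin> \<tau> ` {..m}"
      using \<tau> by (auto simp: horn)
    show "g m \<tau> = f m \<tau>"
    proof (rule extensionalityI[of _ "topspace (nabla M m)"])
      show "g m \<tau> \<in> extensional (topspace (nabla M m))"
        by (simp add: g_def)
      show "f m \<tau> \<in> extensional (topspace (nabla M m))"
        by (rule f_cont(1)[OF \<tau>])
      fix A assume A: "A \<in> topspace (nabla M m)"
      let ?B = "nabla_map M m n \<tau> A"
      have B: "?B \<in> topspace (nabla M n)"
        by (rule nabla_map_nabla[OF \<tau>_hom A])
      have "law M n ?B i = simplex_top_map m n \<tau> (law M m A) i"
        by (simp add: law_natural[OF prob_space_axioms \<tau>_hom A])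
      also have "\<dots> = 0"
        unfolding simplex_top_map_def using i(3) by (intro sum.neutral) auto
      finally have zero: "law M n ?B i = 0" .
      have "g m \<tau> A = \<phi> ?B"
        using A horn_retraction_fixed[OF B i(1,2) zero] by (simp add: g_def \<Phi>_def)
      also have "\<dots> = f n (e i) ?B"
        by (rule \<phi>_eq[OF i(1,2) B zero])
      also have "\<dots> = f m (compose {..m} (e i) \<tau>) A"
        by (rule f_nat[OF \<tau>_hom e(1)[OF i(1,2)] A, symmetric])
      also have "compose {..m} (e i) \<tau> = \<tau>"
      proof (rule extensionalityI[of _ "{..m}"])
        fix j assume j: "j \<in> {..m}"
        then have "\<tau> j \<noteq> i" "\<tau> j \<le> n"
          using i(3) Delta_homD(1)[OF \<tau>_hom] by auto
        then show "compose {..m} (e i) \<tau> j = \<tau> j"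
          using e(3)[OF i(1,2)] j by (simp add: compose_def)
      qed (auto simp: Delta_homD(4)[OF \<tau>_hom])
      finally show "g m \<tau> A = f m \<tau> A" .
    qed
  qed
qed

lemma kan_complex_Sing_RV: "kan_complex (Sing_RV M X)"
  unfolding kan_complex_def
proof (intro conjI allI impI)
  fix n k f assume "1 \<le> n \<and> k \<le> n \<and> simplicial_map (horn n k) (Sing_RV M X) f"
  then show "\<exists>g. simplicial_map (std_sset n) (Sing_RV M X) g \<and>
      (\<forall>m. \<forall>\<tau>\<in>simplices (horn n k) m. g m \<tau> = f m \<tau>)"
    using horn_filler[of n k X f] by metis
qed (rule simplicial_set_Sing_RV)

end

section \<open>Parametrizing a simplex by a disc\<close>

text \<open>The isomorphism from \<open>\<real>\<^sup>n\<close> to the vectors with \<open>n + 1\<close> coordinates of sum zero, the direction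
  space of the simplex. Only the coordinates \<open>i \<le> n\<close> matter.\<close>

definition hat :: "nat \<Rightarrow> (nat \<Rightarrow> real) \<Rightarrow> nat \<Rightarrow> real" where
  "hat n x i = (if i < n then x i else - (\<Sum>j<n. x j))"

text \<open>The gauge of the simplex centred at its barycentre: barycentre plus \<open>hat n x\<close> lies in \<open>\<Delta>\<^sub>n\<close> if and
  only if this is at most 1.\<close>

definition gauge_simplex :: "nat \<Rightarrow> (nat \<Rightarrow> real) \<Rightarrow> real" where
  "gauge_simplex n x = Max ((\<lambda>i. - ((real n + 1) * hat n x i)) ` {..n})"

text \<open>The Euclidean norm, the gauge of the disc.\<close>

definition norm2 :: "nat \<Rightarrow> (nat \<Rightarrow> real) \<Rightarrow> real" where
  "norm2 n x = sqrt (\<Sum>i<n. (x i)\<^sup>2)"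

text \<open>The radial map from the disc to the simplex, scaling each ray by the quotient of the two gauges.
  At the origin the quotient is \<open>0 / 0 = 0\<close>, and the value is the barycentre.\<close>

definition disc_map :: "nat \<Rightarrow> (nat \<Rightarrow> real) \<Rightarrow> nat \<Rightarrow> real" where
  "disc_map n x i = (if i \<le> n then 1 / (real n + 1) + norm2 n x / gauge_simplex n x * hat n x i else 0)"

lemma sum_hat: "(\<Sum>i\<le>n. hat n x i) = 0"
proof -
  have "(\<Sum>i\<le>n. hat n x i) = (\<Sum>i<n. hat n x i) + hat n x n"
    by (simp add: lessThan_Suc_atMost[symmetric])
  then show ?thesis
    by (simp add: hat_def)
qed

lemma gauge_simplex_ge: "i \<le> n \<Longrightarrow> - ((real n + 1) * hat n x i) \<le> gauge_simplex n x"
  unfolding gauge_simplex_def by (intro Max_ge) auto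

lemma gauge_simplex_attained:
  obtains i where "i \<le> n" "gauge_simplex n x = - ((real n + 1) * hat n x i)"
proof -
  have "gauge_simplex n x \<in> (\<lambda>i. - ((real n + 1) * hat n x i)) ` {..n}"
    unfolding gauge_simplex_def by (rule Max_in) auto
  then show thesis
    using that by auto
qed

lemma abs_hat_le_gauge:
  assumes "i \<le> n"
  shows "\<bar>hat n x i\<bar> \<le> gauge_simplex n x"
proof -
  let ?g = "gauge_simplex n x"
  have low: "- ?g \<le> (real n + 1) * hat n x j" if "j \<le> n" for j
    using gauge_simplex_ge[OF that, of x] by simp
  have "0 \<le> (\<Sum>j\<le>n. ?g)"
  proof -
    have "(\<Sum>j\<le>n. - ?g) \<le> (\<Sum>j\<le>n. (real n + 1) * hat n x j)"
      using low by (intro sum_mono) auto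
    then show ?thesis
      by (simp add: sum_hat flip: sum_distrib_left)
  qed
  then have g0: "0 \<le> ?g"
    by (simp add: zero_le_mult_iff)
  have "(real n + 1) * - ?g \<le> - ?g"
    using g0 by (simp add: algebra_simps)
  also have "\<dots> \<le> (real n + 1) * hat n x i"
    using low[OF assms] .
  finally have 1: "- ?g \<le> hat n x i"
    by (rule mult_left_le_imp_le) simp
  have "(\<Sum>j\<in>{..n} - {i}. - ?g) \<le> (\<Sum>j\<in>{..n} - {i}. (real n + 1) * hat n x j)"
    using low by (intro sum_mono) auto
  also have "\<dots> = (\<Sum>j\<le>n. (real n + 1) * hat n x j) - ((real n + 1) * hat n x i)"
    using assms by (simp add: sum_diff1)
  also have "\<dots> = - ((real n + 1) * hat n x i)"
    by (simp add: sum_hat flip: sum_distrib_left)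
  finally have "(real n + 1) * hat n x i \<le> real n * ?g"
    using assms by (simp add: card_Diff_singleton)
  also have "\<dots> \<le> (real n + 1) * ?g"
    using g0 by (simp add: algebra_simps)
  finally have 2: "hat n x i \<le> ?g"
    by (rule mult_left_le_imp_le) simp
  show ?thesis
    using 1 2 by simp
qed

lemma gauge_simplex_nonneg: "0 \<le> gauge_simplex n x"
  using abs_hat_le_gauge[of 0 n x] by linarith

lemma norm2_nonneg: "0 \<le> norm2 n x"
  by (simp add: norm2_def sum_nonneg)

lemma norm2_eq_0: "norm2 n x = 0 \<longleftrightarrow> (\<forall>i<n. x i = 0)"
  by (auto simp: norm2_def sum_nonneg_eq_0_iff)

lemma gauge_simplex_pos: "0 < gauge_simplex n x \<longleftrightarrow> 0 < norm2 n x"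
proof -
  have "gauge_simplex n x = 0 \<longleftrightarrow> norm2 n x = 0"
  proof
    assume g: "gauge_simplex n x = 0"
    have "x i = 0" if "i < n" for i
      using abs_hat_le_gauge[of i n x] that g by (simp add: hat_def)
    then show "norm2 n x = 0"
      by (simp add: norm2_eq_0)
  next
    assume "norm2 n x = 0"
    then have "hat n x i = 0" for i
      by (simp add: norm2_eq_0 hat_def)
    then show "gauge_simplex n x = 0"
      by (simp add: gauge_simplex_def)
  qed
  then show ?thesis
    using norm2_nonneg[of n x] gauge_simplex_nonneg[of n x] by auto
qed

lemma hat_scale: "hat n (\<lambda>i. c * x i) i = c * hat n x i"
  by (simp add: hat_def sum_distrib_left)

lemma gauge_simplex_scale:
  assumes "0 \<le> c"
  shows "gauge_simplex n (\<lambda>i. c * x i) = c * gauge_simplex n x"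
proof -
  have "mono ((*) c)"
    using assms by (simp add: mono_def mult_left_mono)
  from mono_Max_commute[OF this, of "(\<lambda>i. - ((real n + 1) * hat n x i)) ` {..n}"]
  show ?thesis
    by (simp add: gauge_simplex_def hat_scale image_image mult.left_commute)
qed

lemma norm2_scale:
  assumes "0 \<le> c"
  shows "norm2 n (\<lambda>i. c * x i) = c * norm2 n x"
  using assms by (simp add: norm2_def power_mult_distrib real_sqrt_mult flip: sum_distrib_left)

text \<open>The least coordinate of \<open>disc_map n x\<close> is \<open>(1 - norm2 n x) / (n + 1)\<close>; so the norm of \<open>x\<close> can
  be read off from the image, and \<open>x\<close> lies on the sphere exactly if its image lies on the boundary.\<close>

lemma disc_map_ge:
  assumes "i \<le> n"
  shows "(1 - norm2 n x) / (real n + 1) \<le> disc_map n x i"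
proof (cases "0 < gauge_simplex n x")
  case True
  have "- gauge_simplex n x \<le> (real n + 1) * hat n x i"
    using gauge_simplex_ge[OF assms, of x] by simp
  then have "norm2 n x / gauge_simplex n x * - gauge_simplex n x \<le>
      norm2 n x / gauge_simplex n x * ((real n + 1) * hat n x i)"
    using norm2_nonneg[of n x] True by (intro mult_left_mono) auto
  then have "- norm2 n x \<le> norm2 n x / gauge_simplex n x * hat n x i * (real n + 1)"
    using True by (simp add: mult_ac)
  then have "- norm2 n x / (real n + 1) \<le> norm2 n x / gauge_simplex n x * hat n x i"
    by (subst pos_divide_le_eq) auto
  then show ?thesis
    using assms by (simp add: disc_map_def diff_divide_distrib)
next
  case False
  then have "norm2 n x = 0"
    using gauge_simplex_pos norm2_nonneg[of n x] by (metis less_eq_real_def)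
  then show ?thesis
    using assms by (simp add: disc_map_def)
qed

lemma disc_map_attained:
  obtains i where "i \<le> n" "disc_map n x i = (1 - norm2 n x) / (real n + 1)"
proof (cases "0 < gauge_simplex n x")
  case True
  obtain i where i: "i \<le> n" "gauge_simplex n x = - ((real n + 1) * hat n x i)"
    using gauge_simplex_attained .
  then have h: "hat n x i = - gauge_simplex n x / (real n + 1)"
    by (simp add: field_simps)
  show thesis
    by (rule that[OF i(1)]) (use True i(1) in \<open>simp add: disc_map_def h diff_divide_distrib\<close>)
next
  case False
  then have "norm2 n x = 0"
    using gauge_simplex_pos norm2_nonneg[of n x] by (metis less_eq_real_def)
  then show thesis
    by (intro that[of 0]) (simp_all add: disc_map_def)
qed

lemma closed_disc_iff: "x \<in> closed_disc n \<longleftrightarrow> (\<forall>i\<ge>n. x i = 0) \<and> norm2 n x \<le> 1"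
  by (simp add: closed_disc_def topspace_Euclidean_space norm2_def)

lemma open_disc_iff: "x \<in> open_disc n \<longleftrightarrow> (\<forall>i\<ge>n. x i = 0) \<and> norm2 n x < 1"
  by (simp add: open_disc_def topspace_Euclidean_space norm2_def)

lemma disc_map_simplex:
  assumes x: "x \<in> closed_disc n"
  shows "disc_map n x \<in> standard_simplex n"
proof -
  have nonneg: "0 \<le> disc_map n x i" for i
  proof (cases "i \<le> n")
    case True
    have "0 \<le> (1 - norm2 n x) / (real n + 1)"
      using x by (simp add: closed_disc_iff)
    then show ?thesis
      using disc_map_ge[OF True, of x] by linarith
  qed (simp add: disc_map_def)
  have "(\<Sum>i\<le>n. disc_map n x i) = (\<Sum>i\<le>n. 1 / (real n + 1) + norm2 n x / gauge_simplex n x * hat n x i)"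
    by (simp add: disc_map_def)
  also have "\<dots> = 1"
    by (simp only: sum.distrib flip: sum_distrib_left) (simp add: sum_hat add.commute)
  finally have sum: "(\<Sum>i\<le>n. disc_map n x i) = 1" .
  have "disc_map n x i \<le> 1" for i
  proof (cases "i \<le> n")
    case True
    then have "disc_map n x i \<le> (\<Sum>i\<le>n. disc_map n x i)"
      using nonneg by (intro member_le_sum) auto
    then show ?thesis
      by (simp add: sum)
  qed (simp add: disc_map_def)
  then show ?thesis
    using nonneg sum by (simp add: standard_simplex_def disc_map_def)
qed

lemma disc_map_open_simplex_iff:
  assumes x: "x \<in> closed_disc n"
  shows "disc_map n x \<in> open_simplex n \<longleftrightarrow> x \<in> open_disc n"
proof
  assume "disc_map n x \<in> open_simplex n"
  moreover obtain i where "i \<le> n" "disc_map n x i = (1 - norm2 n x) / (real n + 1)"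
    using disc_map_attained .
  ultimately have "0 < (1 - norm2 n x) / (real n + 1)"
    by (metis (no_types, lifting) open_simplex_def mem_Collect_eq)
  then show "x \<in> open_disc n"
    using x by (simp add: closed_disc_iff open_disc_iff zero_less_divide_iff)
next
  assume "x \<in> open_disc n"
  then have "0 < (1 - norm2 n x) / (real n + 1)"
    by (simp add: open_disc_iff)
  then have "0 < disc_map n x i" if "i \<le> n" for i
    using disc_map_ge[OF that, of x] by linarith
  then show "disc_map n x \<in> open_simplex n"
    using disc_map_simplex[OF x] by (simp add: open_simplex_def)
qed

lemma disc_map_inj:
  assumes x: "x \<in> closed_disc n" and y: "y \<in> closed_disc n" and eq: "disc_map n x = disc_map n y"
  shows "x = y"
proof -
  have le: "norm2 n x \<le> norm2 n y" if "disc_map n x = disc_map n y" for x y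
  proof -
    obtain i where i: "i \<le> n" "disc_map n x i = (1 - norm2 n x) / (real n + 1)"
      using disc_map_attained .
    then have "(1 - norm2 n y) / (real n + 1) \<le> (1 - norm2 n x) / (real n + 1)"
      using disc_map_ge[OF i(1), of y] that by simp
    then show ?thesis
      by (simp add: divide_le_cancel)
  qed
  have norm_eq: "norm2 n x = norm2 n y"
    using le[OF eq] le[OF eq[symmetric]] by simp
  have low: "x i = y i" if "i < n" for i
  proof (cases "norm2 n x = 0")
    case True
    then have "norm2 n y = 0"
      using norm_eq by simp
    then show ?thesis
      using True that by (simp add: norm2_eq_0)
  next
    case False
    let ?a = "inverse (gauge_simplex n x)" and ?b = "inverse (gauge_simplex n y)"
    have pos: "0 < norm2 n x" "0 < norm2 n y" "0 < ?a" "0 < ?b"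
      using False norm_eq norm2_nonneg[of n x] by (auto simp: gauge_simplex_pos)
    have scaled: "?a * x j = ?b * y j" if "j < n" for j
    proof -
      have "norm2 n x / gauge_simplex n x * x j = norm2 n y / gauge_simplex n y * y j"
        using fun_cong[OF eq, of j] that by (simp add: disc_map_def hat_def)
      then have "norm2 n y * (?a * x j) = norm2 n y * (?b * y j)"
        using norm_eq by (simp add: divide_inverse mult_ac)
      then show ?thesis
        using pos(2) by simp
    qed
    have "?a * norm2 n x = norm2 n (\<lambda>j. ?a * x j)"
      using pos by (simp add: norm2_scale)
    also have "\<dots> = norm2 n (\<lambda>j. ?b * y j)"
      using scaled by (simp add: norm2_def)
    also have "\<dots> = ?b * norm2 n y"
      using pos by (simp add: norm2_scale)
    finally have "?a = ?b"
      using norm_eq pos by simp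
    then show ?thesis
      using scaled[OF that] pos(3) by simp
  qed
  show ?thesis
  proof
    fix i
    show "x i = y i"
      using low[of i] x y by (cases "i < n") (auto simp: closed_disc_iff)
  qed
qed

lemma disc_map_surj:
  assumes y: "y \<in> standard_simplex n"
  obtains x where "x \<in> closed_disc n" "disc_map n x = y"
proof -
  define v where "v = (\<lambda>i. if i < n then y i - 1 / (real n + 1) else 0)"
  have y_sum: "(\<Sum>i\<le>n. y i) = 1" and y0: "\<And>i. 0 \<le> y i" "\<And>i. n < i \<Longrightarrow> y i = 0"
    using y by (auto simp: standard_simplex_def)
  have hat_v: "hat n v i = y i - 1 / (real n + 1)" if "i \<le> n" for i
  proof (cases "i < n")
    case False
    then have "i = n"
      using that by simp
    moreover have "(\<Sum>j<n. v j) = (\<Sum>j<n. y j) - real n / (real n + 1)"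
      by (simp add: v_def sum_subtractf)
    moreover have "(\<Sum>j<n. y j) = 1 - y n"
      using y_sum by (simp add: lessThan_Suc_atMost[symmetric])
    ultimately show ?thesis
      by (simp add: hat_def field_simps)
  qed (simp add: hat_def v_def)
  have gauge_le: "gauge_simplex n v \<le> 1"
  proof -
    obtain i where i: "i \<le> n" "gauge_simplex n v = - ((real n + 1) * hat n v i)"
      using gauge_simplex_attained .
    have "- ((real n + 1) * (y i - 1 / (real n + 1))) = 1 - (real n + 1) * y i"
      by (simp add: field_simps)
    then show ?thesis
      using i hat_v y0(1)[of i] by simp
  qed
  show thesis
  proof (cases "norm2 n v = 0")
    case True
    then have "y i = 1 / (real n + 1)" if "i \<le> n" for i
      using hat_v[OF that] by (simp add: norm2_eq_0 hat_def split: if_splits)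
    then have "disc_map n (\<lambda>_. 0) = y"
      using y0(2) by (auto simp: disc_map_def hat_def fun_eq_iff)
    then show thesis
      by (intro that[of "\<lambda>_. 0"]) (simp_all add: closed_disc_iff norm2_def)
  next
    case False
    then have pos: "0 < norm2 n v" "0 < gauge_simplex n v"
      using norm2_nonneg[of n v] by (auto simp: gauge_simplex_pos)
    define c where "c = gauge_simplex n v / norm2 n v"
    have c: "0 < c"
      using pos by (simp add: c_def)
    show thesis
    proof (rule that[of "\<lambda>i. c * v i"])
      have norm: "norm2 n (\<lambda>i. c * v i) = gauge_simplex n v"
        using pos c by (simp add: norm2_scale) (simp add: c_def)
      then show "(\<lambda>i. c * v i) \<in> closed_disc n"
        using gauge_le by (simp add: closed_disc_iff v_def)
      have "norm2 n (\<lambda>i. c * v i) / gauge_simplex n (\<lambda>i. c * v i) * c = 1"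
        using pos c unfolding norm by (simp add: gauge_simplex_scale)
      then show "disc_map n (\<lambda>i. c * v i) = y"
        using hat_v y0(2) by (auto simp: disc_map_def hat_scale fun_eq_iff simp flip: mult.assoc)
    qed
  qed
qed

lemma continuous_on_Max_atMost:
  fixes f :: "nat \<Rightarrow> 'b::topological_space \<Rightarrow> real"
  assumes "\<And>i. continuous_on S (f i)"
  shows "continuous_on S (\<lambda>x. Max ((\<lambda>i. f i x) ` {..n}))"
proof (induction n)
  case (Suc n)
  have "Max ((\<lambda>i. f i x) ` {..Suc n}) = max (f (Suc n) x) (Max ((\<lambda>i. f i x) ` {..n}))" for x
    by (simp add: atMost_Suc)
  then show ?case
    using Suc assms by (simp add: continuous_on_max)
qed (simp add: assms)

lemma continuous_on_hat: "continuous_on S (\<lambda>x. hat n x i)"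
  unfolding hat_def
  by (cases "i < n") (auto intro!: continuous_intros continuous_on_product_coordinates[THEN continuous_on_subset])

lemma continuous_on_gauge: "continuous_on S (gauge_simplex n)"
  unfolding gauge_simplex_def by (intro continuous_on_Max_atMost continuous_intros continuous_on_hat)

lemma continuous_on_norm2: "continuous_on S (norm2 n)"
  unfolding norm2_def
  by (auto intro!: continuous_intros continuous_on_product_coordinates[THEN continuous_on_subset])

text \<open>Away from the origin this is a quotient of continuous functions; at the origin it is squeezed
  by \<open>norm2\<close>.\<close>

lemma continuous_on_disc_map_coord:
  assumes i: "i \<le> n"
  shows "continuous_on UNIV (\<lambda>x. norm2 n x / gauge_simplex n x * hat n x i)" (is "continuous_on UNIV ?k")
  unfolding continuous_on_eq_continuous_at[OF open_UNIV]
proof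
  fix x :: "nat \<Rightarrow> real"
  note cont = continuous_on_norm2[of UNIV n, unfolded continuous_on_eq_continuous_at[OF open_UNIV], rule_format, of x]
    continuous_on_gauge[of UNIV n, unfolded continuous_on_eq_continuous_at[OF open_UNIV], rule_format, of x]
    continuous_on_hat[of UNIV n i, unfolded continuous_on_eq_continuous_at[OF open_UNIV], rule_format, of x]
  have bound: "\<bar>?k z\<bar> \<le> norm2 n z" for z
  proof (cases "0 < gauge_simplex n z")
    case True
    have "\<bar>?k z\<bar> = norm2 n z * (\<bar>hat n z i\<bar> / gauge_simplex n z)"
      using True norm2_nonneg[of n z] by (simp add: abs_mult)
    also have "\<dots> \<le> norm2 n z * 1"
      using True abs_hat_le_gauge[OF i, of z] norm2_nonneg[of n z] by (intro mult_left_mono) auto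
    finally show ?thesis
      by simp
  next
    case False
    then have "gauge_simplex n z = 0"
      using gauge_simplex_nonneg[of n z] by simp
    then show ?thesis
      by (simp add: norm2_nonneg)
  qed
  show "isCont ?k x"
  proof (cases "norm2 n x = 0")
    case False
    then have "gauge_simplex n x \<noteq> 0"
      using gauge_simplex_pos[of n x] norm2_nonneg[of n x] by auto
    then show ?thesis
      using cont by (intro continuous_intros) auto
  next
    case True
    have "((\<lambda>z. norm2 n z) \<longlongrightarrow> 0) (at x)"
      using cont(1) True by (simp add: isCont_def)
    then have "(?k \<longlongrightarrow> 0) (at x)"
      by (rule tendsto_rabs_zero_cancel[OF tendsto_sandwich[OF _ _ tendsto_const, rotated 2]])
        (use bound in auto)
    then show ?thesis
      using True by (simp add: isCont_def)
  qed
qed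

lemma subtopology_closed_disc:
  "subtopology (Euclidean_space n) (closed_disc n) = subtopology (powertop_real UNIV) (closed_disc n)"
proof -
  have "{x. \<forall>i\<ge>n. x i = 0} \<inter> closed_disc n = closed_disc n"
    by (auto simp: closed_disc_iff)
  then show ?thesis
    by (simp add: Euclidean_space_def subtopology_subtopology)
qed

lemma continuous_disc_map:
  "continuous_map (subtopology (Euclidean_space n) (closed_disc n)) (simplex_top n) (disc_map n)"
proof -
  have sub: "subtopology (Euclidean_space n) (closed_disc n) = top_of_set (closed_disc n)"
    by (simp add: subtopology_closed_disc euclidean_product_topology)
  have "continuous_on (closed_disc n) (\<lambda>x. disc_map n x i)" for i
  proof (cases "i \<le> n")
    case True
    have "continuous_on (closed_disc n) (\<lambda>x. 1 / (real n + 1) + norm2 n x / gauge_simplex n x * hat n x i)"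
      by (intro continuous_on_add continuous_on_const continuous_on_subset[OF continuous_on_disc_map_coord[OF True]]) simp
    then show ?thesis
      using True by (simp add: disc_map_def)
  qed (simp add: disc_map_def)
  then have "continuous_on (closed_disc n) (disc_map n)"
    by (rule continuous_on_coordinatewise_then_product)
  then show ?thesis
    using disc_map_simplex unfolding simplex_top_def sub
    by (auto simp: continuous_map_in_subtopology euclidean_product_topology)
qed

lemma compact_closed_disc: "compact_space (subtopology (Euclidean_space n) (closed_disc n))"
proof -
  have box: "compactin (powertop_real UNIV) (PiE UNIV (\<lambda>_. {-1..1}))"
    by (simp add: compactin_PiE)
  have "closedin (powertop_real UNIV) (closed_disc n)"
  proof -
    have "closed {x. norm2 n x \<le> 1}"
      using continuous_on_norm2[of UNIV n] by (intro closed_Collect_le continuous_intros)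
    moreover have "closed {x. x i = (0::real)}" for i :: nat
      by (intro closed_Collect_eq continuous_intros continuous_on_product_coordinates)
    moreover have "closed_disc n = (\<Inter>i\<in>{n..}. {x. x i = 0}) \<inter> {x. norm2 n x \<le> 1}"
      by (auto simp: closed_disc_iff)
    ultimately have "closed (closed_disc n)"
      by auto
    then show ?thesis
      by (simp add: euclidean_product_topology)
  qed
  moreover have "closed_disc n \<subseteq> PiE UNIV (\<lambda>_. {-1..1})"
  proof
    fix x assume x: "x \<in> closed_disc n"
    have "\<bar>x i\<bar> \<le> 1" for i
    proof (cases "i < n")
      case True
      then have "(x i)\<^sup>2 \<le> (\<Sum>i<n. (x i)\<^sup>2)"
        by (intro member_le_sum) auto
      also have "\<dots> \<le> 1"
        using x by (simp add: closed_disc_def)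
      finally show ?thesis
        by (simp add: abs_square_le_1)
    qed (use x in \<open>simp add: closed_disc_iff\<close>)
    then show "x \<in> PiE UNIV (\<lambda>_. {-1..1})"
      by (auto simp: abs_le_iff)
  qed
  ultimately have "compactin (powertop_real UNIV) (closed_disc n)"
    by (intro closed_compactin[OF box])
  then show ?thesis
    by (simp add: subtopology_closed_disc compact_space_subtopology)
qed

section \<open>Normal forms of the points of the geometric realization\<close>

text \<open>Not induced from a simplex of smaller dimension by any morphism at all. This is equivalent to the
  usual notion, which considers surjections only, since every morphism factors through a surjection onto
  its image.\<close>

definition nondegenerate :: "'a sset \<Rightarrow> nat \<Rightarrow> 'a \<Rightarrow> bool" where
  "nondegenerate F m \<beta> \<longleftrightarrow> \<beta> \<in> simplices F m \<and>
     \<not> (\<exists>k<m. \<exists>\<sigma>\<in>Delta_hom m k. \<exists>\<gamma>\<in>simplices F k. \<beta> = act F m k \<sigma> \<gamma>)"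

text \<open>The point of \<open>|F|\<close> represented by \<open>(\<alpha>, a)\<close>.\<close>

definition pt :: "'a sset \<Rightarrow> nat \<Rightarrow> 'a \<Rightarrow> (nat \<Rightarrow> real) \<Rightarrow> (nat \<times> 'a \<times> (nat \<Rightarrow> real)) set" where
  "pt F n \<alpha> a = real_rel F simplex_top simplex_top_map `` {(n, \<alpha>, a)}"

text \<open>The characteristic map of the cell of \<open>\<alpha>\<close>.\<close>

definition cell :: "'a sset \<Rightarrow> nat \<Rightarrow> 'a \<Rightarrow> (nat \<Rightarrow> real) \<Rightarrow> (nat \<times> 'a \<times> (nat \<Rightarrow> real)) set" where
  "cell F n \<alpha> x = pt F n \<alpha> (disc_map n x)"

text \<open>A cell of dimension \<open>n\<close> for every nondegenerate \<open>n\<close>-simplex.\<close>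

definition cells :: "'a sset \<Rightarrow> (nat \<times> ((nat \<Rightarrow> real) \<Rightarrow> (nat \<times> 'a \<times> (nat \<Rightarrow> real)) set)) set" where
  "cells F = {(n, cell F n \<alpha>) | n \<alpha>. nondegenerate F n \<alpha>}"

lemma open_simplex_subset: "b \<in> open_simplex m \<Longrightarrow> b \<in> standard_simplex m"
  by (simp add: open_simplex_def)

locale sset =
  fixes F :: "'a sset"
  assumes simplicial_set: "simplicial_set F"
begin

lemma act_closed: "\<sigma> \<in> Delta_hom n m \<Longrightarrow> \<alpha> \<in> simplices F m \<Longrightarrow> act F n m \<sigma> \<alpha> \<in> simplices F n"
  using simplicial_set unfolding simplicial_set_def by blast

lemma act_id: "\<alpha> \<in> simplices F n \<Longrightarrow> act F n n (restrict id {..n}) \<alpha> = \<alpha>"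
  using simplicial_set unfolding simplicial_set_def by blast

lemma act_compose:
  "\<sigma> \<in> Delta_hom l n \<Longrightarrow> \<tau> \<in> Delta_hom n m \<Longrightarrow> \<alpha> \<in> simplices F m \<Longrightarrow>
    act F l m (compose {..l} \<tau> \<sigma>) \<alpha> = act F l n \<sigma> (act F n m \<tau> \<alpha>)"
  using simplicial_set unfolding simplicial_set_def by blast

lemma act_eq_id:
  assumes "\<tau> \<in> Delta_hom n n" "\<And>i. i \<le> n \<Longrightarrow> \<tau> i = i" "\<alpha> \<in> simplices F n"
  shows "act F n n \<tau> \<alpha> = \<alpha>"
proof -
  have "\<tau> = restrict id {..n}"
    using assms(2) Delta_homD(4)[OF assms(1)] by (auto simp: fun_eq_iff extensional_def restrict_def)
  then show ?thesis
    using act_id[OF assms(3)] by simp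
qed

text \<open>If \<open>\<tau>\<close> identifies two elements, it identifies two neighbours \<open>i\<close>, \<open>i + 1\<close> and factors as \<open>\<tau> \<circ> d \<circ> s\<close>
  through \<open>[m - 1]\<close>.\<close>

lemma nondegenerate_inj:
  assumes nd: "nondegenerate F m \<beta>" and \<tau>: "\<tau> \<in> Delta_hom m n" and \<alpha>: "\<alpha> \<in> simplices F n"
    and eq: "\<beta> = act F m n \<tau> \<alpha>"
  shows "inj_on \<tau> {..m}"
proof (rule ccontr)
  assume "\<not> ?thesis"
  then obtain i j where "i \<le> m" "j \<le> m" "i \<noteq> j" "\<tau> i = \<tau> j"
    by (auto simp: inj_on_def)
  then obtain i j where ij: "i < j" "j \<le> m" "\<tau> i = \<tau> j"
    by (metis linorder_neqE_nat)
  then have eq_i: "\<tau> (Suc i) = \<tau> i"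
    using Delta_homD(2)[OF \<tau>, of i "Suc i"] Delta_homD(2)[OF \<tau>, of "Suc i" j] by simp
  define s where "s = (\<lambda>x\<in>{..m}. if x \<le> i then x else x - 1)"
  define d where "d = (\<lambda>x\<in>{..m - 1}. if x \<le> i then x else x + 1)"
  have s: "s \<in> Delta_hom m (m - 1)" and d: "d \<in> Delta_hom (m - 1) m"
    unfolding s_def d_def using ij by (auto intro!: Delta_homI)
  have "compose {..m} \<tau> (compose {..m} d s) = \<tau>"
  proof (rule extensionalityI[of _ "{..m}"])
    fix x assume "x \<in> {..m}"
    then show "compose {..m} \<tau> (compose {..m} d s) x = \<tau> x"
      using ij eq_i by (cases "x = Suc i") (auto simp: compose_def s_def d_def)
  qed (auto simp: Delta_homD(4)[OF \<tau>])
  then have "\<beta> = act F m (m - 1) s (act F (m - 1) m d (act F m n \<tau> \<alpha>))"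
    using s d \<tau> \<alpha> eq by (metis act_closed act_compose Delta_hom_compose)
  moreover have "act F (m - 1) m d (act F m n \<tau> \<alpha>) \<in> simplices F (m - 1)"
    using act_closed d \<tau> \<alpha> by blast
  moreover have "m - 1 < m"
    using ij by simp
  ultimately show False
    using nd s unfolding nondegenerate_def by blast
qed

lemma pt_act:
  assumes "\<sigma> \<in> Delta_hom n m" "\<alpha> \<in> simplices F m" "a \<in> standard_simplex n"
  shows "pt F n (act F n m \<sigma> \<alpha>) a = pt F m \<alpha> (simplex_top_map n m \<sigma> a)"
  unfolding pt_def using assms by (intro real_rel_class_eq) (auto simp: topspace_simplex_top)

lemma topspace_geom:
  "topspace (geom_realization F) = {pt F n \<alpha> a | n \<alpha> a. \<alpha> \<in> simplices F n \<and> a \<in> standard_simplex n}"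
  by (simp add: geom_realization_def topspace_realization pt_def topspace_simplex_top)

lemma continuous_pt:
  "\<alpha> \<in> simplices F n \<Longrightarrow> continuous_map (simplex_top n) (geom_realization F) (pt F n \<alpha>)"
  unfolding geom_realization_def pt_def by (rule continuous_map_class)

text \<open>Sampling is well defined on \<open>|F|\<close>.\<close>

lemma sample_invariant:
  assumes "pt F n \<alpha> a = pt F n' \<alpha>' a'" and u: "sampling m u"
  shows "act F m n (sample m a u) \<alpha> = act F m n' (sample m a' u) \<alpha>'"
proof -
  define f where "f = (\<lambda>(n, \<alpha>, a). act F m n (sample m a u) \<alpha>)"
  have "f (n, \<alpha>, a) = f (n', \<alpha>', a')"
  proof (rule real_rel_invariant[OF assms(1)[unfolded pt_def]])
    fix n k \<sigma> \<alpha> a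
    assume \<sigma>: "\<sigma> \<in> Delta_hom n k" and \<alpha>: "\<alpha> \<in> simplices F k" and "a \<in> topspace (simplex_top n)"
    then have a: "a \<in> standard_simplex n"
      by (simp add: topspace_simplex_top)
    show "f (n, act F n k \<sigma> \<alpha>, a) = f (k, \<alpha>, simplex_top_map n k \<sigma> a)"
      by (simp add: f_def sample_natural[OF \<sigma> a u] act_compose[OF sample_hom[OF a u] \<sigma> \<alpha>])
  qed
  then show ?thesis
    by (simp add: f_def)
qed

lemma sample_spread_self:
  assumes b: "b \<in> open_simplex m" and t: "0 \<le> t" "t < 1" and \<beta>: "\<beta> \<in> simplices F m"
  shows "act F m m (sample m b (spread b t)) \<beta> = \<beta>"
  using step_spread[OF b t]
  by (intro act_eq_id sample_hom sampling_spread open_simplex_subset b t \<beta>) (simp add: sample_def)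

text \<open>Sampling both representatives at points that sample \<open>b\<close> to the identity of \<open>[m]\<close> exhibits \<open>\<beta>\<close> as
  \<open>\<alpha>\<close> acted on by an injective morphism \<open>[m] \<rightarrow> [n]\<close>. If \<open>m = n\<close>, that morphism is the identity for every
  choice of the points, which forces the step functions of \<open>a\<close> and \<open>b\<close> to agree.\<close>

lemma compare_normal_form:
  assumes \<alpha>: "\<alpha> \<in> simplices F n" and a: "a \<in> standard_simplex n"
    and \<beta>: "nondegenerate F m \<beta>" and b: "b \<in> open_simplex m" and eq: "pt F n \<alpha> a = pt F m \<beta> b"
  shows "m \<le> n" "\<exists>\<tau>\<in>Delta_hom m n. \<beta> = act F m n \<tau> \<alpha>" "m = n \<Longrightarrow> \<alpha> = \<beta> \<and> a = b"
proof -
  have \<beta>s: "\<beta> \<in> simplices F m"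
    using \<beta> by (simp add: nondegenerate_def)
  have hom: "sample m a (spread b t) \<in> Delta_hom m n"
    and act: "\<beta> = act F m n (sample m a (spread b t)) \<alpha>"
    and inj: "inj_on (sample m a (spread b t)) {..m}" if t: "0 \<le> t" "t < 1" for t
  proof -
    show hom: "sample m a (spread b t) \<in> Delta_hom m n"
      by (intro sample_hom[OF a] sampling_spread b t)
    show act: "\<beta> = act F m n (sample m a (spread b t)) \<alpha>"
      using sample_invariant[OF eq sampling_spread[OF b t]] sample_spread_self[OF b t \<beta>s] by simp
    show "inj_on (sample m a (spread b t)) {..m}"
      using nondegenerate_inj[OF \<beta> hom \<alpha> act] .
  qed
  show "\<exists>\<tau>\<in>Delta_hom m n. \<beta> = act F m n \<tau> \<alpha>"
    using hom[of 0] act[of 0] by auto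
  have "sample m a (spread b 0) ` {..m} \<subseteq> {..n}"
    using Delta_homD(1)[OF hom[of 0]] by auto
  then have "card {..m} \<le> card {..n}"
    using inj[of 0] by (intro card_inj_on_le) auto
  then show "m \<le> n"
    by simp
  assume "m = n"
  have id: "sample m a (spread b t) i = i" if "0 \<le> t" "t < 1" "i \<le> m" for t i
    using strict_mono_endo_eq_id[OF hom[OF that(1,2), folded \<open>m = n\<close>] inj[OF that(1,2)] that(3)] .
  have "\<beta> = \<alpha>"
    using act_eq_id[of "sample m a (spread b 0)" m \<alpha>] hom[of 0] act[of 0] id[of 0] \<alpha> \<open>m = n\<close> by simp
  moreover have "a = b"
  proof (rule simplex_eqI[OF a])
    show "b \<in> standard_simplex n"
      using open_simplex_subset[OF b] \<open>m = n\<close> by simp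
    fix v :: real assume "0 \<le> v" "v < 1"
    then obtain t where t: "0 \<le> t" "t < 1" "v = spread b t (step b v)" "step b v \<le> m"
      using ex_spread[OF b] by metis
    then show "step a v = step b v"
      using id[OF t(1,2,4)] by (simp add: sample_def)
  qed
  ultimately show "\<alpha> = \<beta> \<and> a = b"
    by simp
qed

text \<open>A representative of least dimension is in normal form.\<close>

lemma ex_normal_form:
  assumes \<alpha>: "\<alpha> \<in> simplices F n" and a: "a \<in> standard_simplex n"
  obtains m \<beta> b where "nondegenerate F m \<beta>" "b \<in> open_simplex m" "pt F n \<alpha> a = pt F m \<beta> b"
proof -
  define z where "z = pt F n \<alpha> a"
  define P where "P m \<longleftrightarrow> (\<exists>\<beta>\<in>simplices F m. \<exists>b\<in>standard_simplex m. z = pt F m \<beta> b)" for m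
  define m where "m = (LEAST m. P m)"
  have "P n"
    using \<alpha> a by (auto simp: P_def z_def)
  then have "P m"
    unfolding m_def by (rule LeastI)
  then obtain \<beta> b where \<beta>: "\<beta> \<in> simplices F m" and b: "b \<in> standard_simplex m" and z: "z = pt F m \<beta> b"
    by (auto simp: P_def)
  have least: "\<not> P k" if "k < m" for k
    using that unfolding m_def by (rule not_less_Least)
  have "nondegenerate F m \<beta>"
    unfolding nondegenerate_def
  proof (intro conjI \<beta> notI)
    assume "\<exists>k<m. \<exists>\<sigma>\<in>Delta_hom m k. \<exists>\<gamma>\<in>simplices F k. \<beta> = act F m k \<sigma> \<gamma>"
    then obtain k \<sigma> \<gamma> where k: "k < m" "\<sigma> \<in> Delta_hom m k" "\<gamma> \<in> simplices F k" "\<beta> = act F m k \<sigma> \<gamma>"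
      by blast
    then have "z = pt F k \<gamma> (simplex_top_map m k \<sigma> b)"
      using z pt_act b by simp
    then have "P k"
      using k simplex_top_map_simplex[OF k(2) b] by (auto simp: P_def)
    then show False
      using least k by blast
  qed
  moreover have "b \<in> open_simplex m"
  proof (rule ccontr)
    assume "b \<notin> open_simplex m"
    then obtain i where i: "i \<le> m" "b i = 0"
      using b by (fastforce simp: open_simplex_def standard_simplex_def order_less_le)
    have "m \<noteq> 0"
    proof
      assume "m = 0"
      then have "b 0 = 1"
        using b by (simp add: standard_simplex_def)
      then show False
        using i \<open>m = 0\<close> by simp
    qed
    \<comment> \<open>\<open>b\<close> lies on the face opposite to \<open>i\<close>; \<open>d \<circ> s\<close> fixes every vertex except \<open>i\<close>\<close>
    define s where "s = (\<lambda>x\<in>{..m}. if x < i then x else x - 1)"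
    define d where "d = (\<lambda>x\<in>{..m - 1}. if x < i then x else x + 1)"
    have s: "s \<in> Delta_hom m (m - 1)" and d: "d \<in> Delta_hom (m - 1) m"
      unfolding s_def d_def using i \<open>m \<noteq> 0\<close> by (auto intro!: Delta_homI)
    let ?b = "simplex_top_map m (m - 1) s b"
    have b': "?b \<in> standard_simplex (m - 1)"
      by (rule simplex_top_map_simplex[OF s b])
    have "simplex_top_map (m - 1) m d ?b = b"
    proof (rule simplex_eqI[OF simplex_top_map_simplex[OF d b'] b])
      fix u :: real assume u: "0 \<le> u" "u < 1"
      have "step (simplex_top_map (m - 1) m d ?b) u = d (s (step b u))"
        by (simp only: step_natural[OF d b' u] step_natural[OF s b u])
      moreover have "step b u \<le> m" "step b u \<noteq> i"
        using step_le[OF b u(2)] step_eqD(3)[OF b u] i by auto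
      ultimately show "step (simplex_top_map (m - 1) m d ?b) u = step b u"
        using i by (auto simp: s_def d_def)
    qed
    then have "z = pt F (m - 1) (act F (m - 1) m d \<beta>) ?b"
      using pt_act[OF d \<beta> b'] z by simp
    then have "P (m - 1)"
      using act_closed[OF d \<beta>] b' by (auto simp: P_def)
    then show False
      using least \<open>m \<noteq> 0\<close> by simp
  qed
  ultimately show thesis
    using that z by (simp add: z_def)
qed

end

section \<open>The geometric realization is a Hausdorff space\<close>

context uniform_rv
begin

lemma prob_interval_le:
  assumes "p \<le> q"
  shows "prob {\<omega> \<in> space M. p \<le> U \<omega> \<and> U \<omega> < q} \<le> q - p"
proof -
  let ?p = "max 0 (min 1 p)" and ?q = "max 0 (min 1 q)"
  have "prob {\<omega> \<in> space M. p \<le> U \<omega> \<and> U \<omega> < q} \<le> prob {\<omega> \<in> space M. ?p \<le> U \<omega> \<and> U \<omega> < ?q}"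
    using U_ge_0 U_less_1 by (intro finite_measure_mono) (auto simp: min_def max_def intro: less_imp_le)
  also have "\<dots> = ?q - ?p"
    using assms by (intro prob_interval) auto
  also have "\<dots> \<le> q - p"
    using assms by auto
  finally show ?thesis .
qed

lemma prob_spread_between:
  assumes b: "b \<in> open_simplex m" and i: "i \<le> m" and lh: "l \<le> h"
  shows "prob {\<omega> \<in> space M. l \<le> spread b (U \<omega>) i \<and> spread b (U \<omega>) i < h} \<le> (h - l) / b i"
proof -
  have bi: "0 < b i"
    using b i by (simp add: open_simplex_def)
  let ?c = "psum b i - b i"
  have "{\<omega> \<in> space M. l \<le> spread b (U \<omega>) i \<and> spread b (U \<omega>) i < h} =
      {\<omega> \<in> space M. (l - ?c) / b i \<le> U \<omega> \<and> U \<omega> < (h - ?c) / b i}"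
    using bi by (auto simp: spread_def field_simps)
  also have "prob \<dots> \<le> (h - ?c) / b i - (l - ?c) / b i"
    using lh bi by (intro prob_interval_le divide_right_mono) auto
  also have "\<dots> = (h - l) / b i"
    by (simp add: diff_divide_distrib)
  finally show ?thesis .
qed

lemma spread_measurable [measurable]: "(\<lambda>\<omega>. spread b (U \<omega>) i) \<in> borel_measurable M"
  unfolding spread_def by measurable

end

text \<open>A simplicial set together with a source of random sampling points for its realization.\<close>

locale uniform_sset = uniform_rv M U + sset F
  for M :: "'w measure" and U :: "'w \<Rightarrow> real" and F :: "'a sset"
begin

text \<open>The event that sampling \<open>(\<alpha>, a)\<close> at the random points \<open>spread b (U \<omega>)\<close> gives \<open>\<beta>\<close>. Its
  probability depends continuously on \<open>a\<close>. For \<open>\<beta>\<close> nondegenerate it equals 1 at the point represented by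
  \<open>(\<beta>, b)\<close>, and is smaller at all other points whose normal form has dimension at most \<open>m\<close>.\<close>

definition hit :: "nat \<Rightarrow> 'a \<Rightarrow> (nat \<Rightarrow> real) \<Rightarrow> nat \<Rightarrow> 'a \<Rightarrow> (nat \<Rightarrow> real) \<Rightarrow> 'w set" where
  "hit m \<beta> b n \<alpha> a = {\<omega> \<in> space M. act F m n (sample m a (spread b (U \<omega>))) \<alpha> = \<beta>}"

lemma sampling_spread_U: "b \<in> open_simplex m \<Longrightarrow> sampling m (spread b (U \<omega>))"
  using sampling_spread U_ge_0 U_less_1 by blast

lemma step_spread_U_sets:
  assumes b: "b \<in> open_simplex m" and a: "a \<in> standard_simplex n" and i: "i \<le> m"
  shows "{\<omega> \<in> space M. step a (spread b (U \<omega>) i) = j} \<in> sets M"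
proof -
  have "step a (spread b (U \<omega>) i) = j \<longleftrightarrow>
      psum a j - a j \<le> spread b (U \<omega>) i \<and> spread b (U \<omega>) i < psum a j" for \<omega>
  proof -
    note bounds = spread_bounds(3,4)[OF b U_ge_0[of \<omega>] U_less_1[of \<omega>] i]
    show ?thesis
      using step_eqD(1,2)[OF a bounds] step_eqI[OF a bounds(2)] by blast
  qed
  then show ?thesis
    by simp
qed

lemma hit_sets:
  assumes b: "b \<in> open_simplex m" and a: "a \<in> standard_simplex n"
  shows "hit m \<beta> b n \<alpha> a \<in> sets M"
proof -
  let ?T = "{\<tau> \<in> Delta_hom m n. act F m n \<tau> \<alpha> = \<beta>}"
  have hom: "sample m a (spread b (U \<omega>)) \<in> Delta_hom m n" for \<omega>
    by (rule sample_hom[OF a sampling_spread_U[OF b]])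
  have "hit m \<beta> b n \<alpha> a = (\<Union>\<tau>\<in>?T. {\<omega> \<in> space M. sample m a (spread b (U \<omega>)) = \<tau>})"
    using hom by (auto simp: hit_def)
  also have "\<dots> \<in> sets M"
  proof (intro sets.finite_UN)
    show "finite ?T"
      using finite_Delta_hom[of m n] by simp
    fix \<tau> assume "\<tau> \<in> ?T"
    then have "\<tau> \<in> extensional {..m}"
      using Delta_homD(4) by blast
    then have "sample m a (spread b (U \<omega>)) = \<tau> \<longleftrightarrow> (\<forall>i\<in>{..m}. step a (spread b (U \<omega>) i) = \<tau> i)" for \<omega>
      by (auto simp: sample_def extensional_def fun_eq_iff restrict_def)
    then show "{\<omega> \<in> space M. sample m a (spread b (U \<omega>)) = \<tau>} \<in> sets M"
      using step_spread_U_sets[OF b a] by (simp only:) (intro sets.sets_Collect_finite_All', auto)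
  qed
  finally show ?thesis .
qed

lemma prob_hit_diff:
  assumes b: "b \<in> open_simplex m" and a: "a \<in> standard_simplex n" and a': "a' \<in> standard_simplex n"
  shows "\<bar>prob (hit m \<beta> b n \<alpha> a) - prob (hit m \<beta> b n \<alpha> a')\<bar> \<le> (\<Sum>i\<le>m. \<Sum>j\<le>n. \<bar>psum a j - psum a' j\<bar> / b i)"
    (is "_ \<le> ?S a a'")
proof -
  have le: "prob (hit m \<beta> b n \<alpha> a) \<le> prob (hit m \<beta> b n \<alpha> a') + ?S a a'"
    if a: "a \<in> standard_simplex n" and a': "a' \<in> standard_simplex n" for a a'
  proof -
    define R where "R i j = {\<omega> \<in> space M. min (psum a j) (psum a' j) \<le> spread b (U \<omega>) i \<and>
        spread b (U \<omega>) i < max (psum a j) (psum a' j)}" for i j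
    have [measurable]: "R i j \<in> sets M" for i j
      unfolding R_def by measurable
    have "hit m \<beta> b n \<alpha> a \<subseteq> hit m \<beta> b n \<alpha> a' \<union> (\<Union>i\<in>{..m}. \<Union>j\<in>{..n}. R i j)"
    proof
      fix \<omega> assume \<omega>: "\<omega> \<in> hit m \<beta> b n \<alpha> a"
      show "\<omega> \<in> hit m \<beta> b n \<alpha> a' \<union> (\<Union>i\<in>{..m}. \<Union>j\<in>{..n}. R i j)"
      proof (cases "\<forall>i\<le>m. step a (spread b (U \<omega>) i) = step a' (spread b (U \<omega>) i)")
        case True
        then have "sample m a (spread b (U \<omega>)) = sample m a' (spread b (U \<omega>))"
          by (auto simp: sample_def)
        then show ?thesis
          using \<omega> by (simp add: hit_def)
      next
        case False
        then obtain i where i: "i \<le> m" "step a (spread b (U \<omega>) i) \<noteq> step a' (spread b (U \<omega>) i)"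
          by blast
        from step_differ_subset[OF a a' spread_bounds(4)[OF b U_ge_0 U_less_1 i(1)] i(2)]
        obtain j where "j \<le> n" "\<omega> \<in> R i j"
          using \<omega> by (auto simp: R_def hit_def)
        then show ?thesis
          using i(1) by auto
      qed
    qed
    then have "prob (hit m \<beta> b n \<alpha> a) \<le> prob (hit m \<beta> b n \<alpha> a' \<union> (\<Union>i\<in>{..m}. \<Union>j\<in>{..n}. R i j))"
      using hit_sets[OF b a'] by (intro finite_measure_mono) auto
    also have "\<dots> \<le> prob (hit m \<beta> b n \<alpha> a') + prob (\<Union>i\<in>{..m}. \<Union>j\<in>{..n}. R i j)"
      using hit_sets[OF b a'] by (intro measure_Un_le) auto
    also have "prob (\<Union>i\<in>{..m}. \<Union>j\<in>{..n}. R i j) \<le> (\<Sum>i\<le>m. prob (\<Union>j\<in>{..n}. R i j))"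
      by (intro measure_UNION_le) auto
    also have "\<dots> \<le> (\<Sum>i\<le>m. \<Sum>j\<le>n. prob (R i j))"
      by (intro sum_mono measure_UNION_le) auto
    also have "\<dots> \<le> ?S a a'"
    proof (intro sum_mono)
      fix i j assume "i \<in> {..m}"
      then have "prob (R i j) \<le> (max (psum a j) (psum a' j) - min (psum a j) (psum a' j)) / b i"
        unfolding R_def by (intro prob_spread_between[OF b]) auto
      also have "max (psum a j) (psum a' j) - min (psum a j) (psum a' j) = \<bar>psum a j - psum a' j\<bar>"
        by linarith
      finally show "prob (R i j) \<le> \<bar>psum a j - psum a' j\<bar> / b i" .
    qed
    finally show ?thesis
      by simp
  qed
  have "?S a' a = ?S a a'"
    by (simp add: abs_minus_commute)
  then show ?thesis
    using le[OF a a'] le[OF a' a] by linarith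
qed

lemma continuous_prob_hit:
  assumes b: "b \<in> open_simplex m"
  shows "continuous_map (simplex_top n) euclideanreal (\<lambda>a. prob (hit m \<beta> b n \<alpha> a))"
proof -
  have "continuous_map (simplex_top n) Met_TC.mtopology (\<lambda>a. prob (hit m \<beta> b n \<alpha> a))"
    unfolding Met_TC.continuous_map_to_metric
  proof (intro ballI allI impI)
    fix a and \<epsilon> :: real
    assume "a \<in> topspace (simplex_top n)" and \<epsilon>: "0 < \<epsilon>"
    then have a: "a \<in> standard_simplex n"
      by (simp add: topspace_simplex_top)
    define D where "D a' = (\<Sum>i\<le>m. \<Sum>j\<le>n. \<bar>psum a j - psum a' j\<bar> / b i)" for a'
    have "continuous_map (simplex_top n) euclideanreal D"
      unfolding D_def divide_inverse
      by (intro continuous_map_sum continuous_map_real_mult_right continuous_map_real_abs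
          continuous_map_diff continuous_psum) auto
    then have "openin (simplex_top n) {a' \<in> topspace (simplex_top n). D a' \<in> {..<\<epsilon>}}"
      by (rule openin_continuous_map_preimage) auto
    moreover have "dist (prob (hit m \<beta> b n \<alpha> a)) (prob (hit m \<beta> b n \<alpha> a')) < \<epsilon>"
      if "a' \<in> standard_simplex n" "D a' < \<epsilon>" for a'
      using prob_hit_diff[OF b a that(1), of \<beta> \<alpha>] that(2) by (simp add: D_def dist_real_def)
    ultimately show "\<exists>W. openin (simplex_top n) W \<and> a \<in> W \<and>
        (\<forall>a'\<in>W. prob (hit m \<beta> b n \<alpha> a') \<in> Met_TC.mball (prob (hit m \<beta> b n \<alpha> a)) \<epsilon>)"
      using a \<epsilon> by (intro exI[of _ "{a' \<in> topspace (simplex_top n). D a' \<in> {..<\<epsilon>}}"])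
        (auto simp: topspace_simplex_top D_def)
  qed
  then show ?thesis
    by simp
qed

text \<open>If the event is nonempty then \<open>m = n\<close> and \<open>\<gamma> = \<beta>\<close>, hence \<open>b \<noteq> c\<close>, and the step functions of \<open>b\<close> and
  \<open>c\<close> differ somewhere. Being right-continuous, they differ on an interval, which the event must avoid.\<close>

lemma prob_hit_less_1:
  assumes \<beta>: "nondegenerate F m \<beta>" and b: "b \<in> open_simplex m"
    and \<gamma>: "nondegenerate F n \<gamma>" and c: "c \<in> open_simplex n" and nm: "n \<le> m"
    and neq: "(n, \<gamma>, c) \<noteq> (m, \<beta>, b)"
  shows "prob (hit m \<beta> b n \<gamma> c) < 1"
proof (cases "hit m \<beta> b n \<gamma> c = {}")
  case False
  have \<gamma>s: "\<gamma> \<in> simplices F n" and cs: "c \<in> standard_simplex n" and bs: "b \<in> standard_simplex m"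
    using \<gamma> open_simplex_subset[OF c] open_simplex_subset[OF b] by (auto simp: nondegenerate_def)
  have hom: "sample m c (spread b (U \<omega>)) \<in> Delta_hom m n" for \<omega>
    by (rule sample_hom[OF cs sampling_spread_U[OF b]])
  have inj: "inj_on (sample m c (spread b (U \<omega>))) {..m}" if "\<omega> \<in> hit m \<beta> b n \<gamma> c" for \<omega>
    using that by (intro nondegenerate_inj[OF \<beta> hom \<gamma>s]) (simp add: hit_def)
  obtain \<omega>0 where \<omega>0: "\<omega>0 \<in> hit m \<beta> b n \<gamma> c"
    using False by blast
  have "sample m c (spread b (U \<omega>0)) ` {..m} \<subseteq> {..n}"
    using Delta_homD(1)[OF hom] by auto
  then have "card {..m} \<le> card {..n}"
    using inj[OF \<omega>0] by (intro card_inj_on_le) auto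
  then have mn: "m = n"
    using nm by simp
  have id: "step c (spread b (U \<omega>) i) = i" if "\<omega> \<in> hit m \<beta> b n \<gamma> c" "i \<le> m" for \<omega> i
    using strict_mono_endo_eq_id[OF hom[of \<omega>, folded mn] inj[OF that(1)] that(2)] that(2)
    by (simp add: sample_def)
  have "\<gamma> = act F m n (sample m c (spread b (U \<omega>0))) \<gamma>"
    using act_eq_id[of "sample m c (spread b (U \<omega>0))" m \<gamma>] hom[of \<omega>0] id[OF \<omega>0] \<gamma>s mn
    by (simp add: sample_def)
  then have "\<gamma> = \<beta>"
    using \<omega>0 by (simp add: hit_def)
  then have "b \<noteq> c"
    using neq mn by simp
  then obtain v where v: "0 \<le> v" "v < 1" "step b v \<noteq> step c v"
    using simplex_eqI[OF bs, of c] cs mn by blast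
  define i k where "i = step b v" and "k = step c v"
  obtain t where t: "0 \<le> t" "t < 1" "v = spread b t i" "i \<le> m"
    using ex_spread[OF b v(1,2)] unfolding i_def by metis
  have bi: "0 < b i"
    using b t(4) by (simp add: open_simplex_def)
  note k = step_eqD[OF cs v(1,2) k_def[symmetric]]
  \<comment> \<open>for \<open>U\<close> in \<open>[t, t + \<delta>)\<close>, \<open>step c\<close> still has the value \<open>k \<noteq> i\<close> at \<open>spread b U i\<close>\<close>
  define \<delta> where "\<delta> = min (1 - t) ((psum c k - v) / b i)"
  have \<delta>: "0 < \<delta>"
    using t k bi by (simp add: \<delta>_def)
  have disj: "\<omega> \<notin> hit m \<beta> b n \<gamma> c" if \<omega>: "t \<le> U \<omega>" "U \<omega> < t + \<delta>" for \<omega>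
  proof
    assume hit: "\<omega> \<in> hit m \<beta> b n \<gamma> c"
    have spread: "spread b (U \<omega>) i = v + (U \<omega> - t) * b i"
      using t(3) by (simp add: spread_def algebra_simps)
    have "v \<le> spread b (U \<omega>) i"
      using \<omega>(1) bi by (simp add: spread)
    moreover have "(U \<omega> - t) * b i < psum c k - v"
      using \<omega>(2) bi by (simp add: \<delta>_def pos_less_divide_eq[symmetric])
    then have "spread b (U \<omega>) i < psum c k"
      by (simp add: spread)
    ultimately have "step c (spread b (U \<omega>) i) = k"
      using k(1) spread_bounds(4)[OF b U_ge_0 U_less_1 t(4)] by (intro step_eqI[OF cs]) auto
    then show False
      using id[OF hit t(4)] v(3) by (simp add: i_def k_def)
  qed
  let ?S = "{\<omega> \<in> space M. t \<le> U \<omega> \<and> U \<omega> < t + \<delta>}"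
  have "prob (hit m \<beta> b n \<gamma> c) \<le> prob (space M - ?S)"
    using disj by (intro finite_measure_mono) (auto simp: hit_def)
  also have "\<dots> = 1 - prob ?S"
    by (rule prob_compl) measurable
  also have "prob ?S = \<delta>"
    using t \<delta> by (subst prob_interval) (auto simp: \<delta>_def)
  finally show ?thesis
    using \<delta> by simp
qed simp

lemma separate_normal_forms:
  assumes \<beta>: "nondegenerate F m \<beta>" and b: "b \<in> open_simplex m"
    and \<gamma>: "nondegenerate F n \<gamma>" and c: "c \<in> open_simplex n" and nm: "n \<le> m"
    and neq: "pt F m \<beta> b \<noteq> pt F n \<gamma> c"
  obtains f where "continuous_map (geom_realization F) euclideanreal f" "f (pt F n \<gamma> c) < f (pt F m \<beta> b)"
proof -
  define f where "f z = (case SOME p. z = pt F (fst p) (fst (snd p)) (snd (snd p)) of (n, \<alpha>, a) \<Rightarrow> prob (hit m \<beta> b n \<alpha> a))" for z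
  have f: "f (pt F n \<alpha> a) = prob (hit m \<beta> b n \<alpha> a)" for n \<alpha> a
  proof -
    define p where "p = (SOME p. pt F n \<alpha> a = pt F (fst p) (fst (snd p)) (snd (snd p)))"
    have "pt F n \<alpha> a = pt F (fst p) (fst (snd p)) (snd (snd p))"
      unfolding p_def by (rule someI[of _ "(n, \<alpha>, a)"]) simp
    from sample_invariant[OF this sampling_spread_U[OF b]]
    show ?thesis
      unfolding f_def p_def[symmetric] by (simp add: hit_def case_prod_unfold)
  qed
  show thesis
  proof (rule that[of f])
    show "continuous_map (geom_realization F) euclideanreal f"
      unfolding geom_realization_def
      by (rule continuous_map_from_realization) (simp add: f[unfolded pt_def] continuous_prob_hit[OF b])
    have "hit m \<beta> b m \<beta> b = space M"
      using sample_spread_self[OF b U_ge_0 U_less_1] \<beta> by (auto simp: hit_def nondegenerate_def)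
    moreover have "prob (hit m \<beta> b n \<gamma> c) < 1"
      using neq by (intro prob_hit_less_1[OF \<beta> b \<gamma> c nm]) auto
    ultimately show "f (pt F n \<gamma> c) < f (pt F m \<beta> b)"
      by (simp add: f prob_space)
  qed
qed

lemma Hausdorff_geom_realization_by_sampling: "Hausdorff_space (geom_realization F)"
  unfolding Hausdorff_space_def
proof (intro allI impI, elim conjE)
  fix x y assume x: "x \<in> topspace (geom_realization F)" and y: "y \<in> topspace (geom_realization F)" and neq: "x \<noteq> y"
  have normal: "\<exists>m \<beta> b. nondegenerate F m \<beta> \<and> b \<in> open_simplex m \<and> z = pt F m \<beta> b"
    if z: "z \<in> topspace (geom_realization F)" for z
  proof -
    obtain n \<alpha> a where "\<alpha> \<in> simplices F n" "a \<in> standard_simplex n" "z = pt F n \<alpha> a"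
      using z unfolding topspace_geom by blast
    then show ?thesis
      using ex_normal_form by metis
  qed
  have "\<exists>f. continuous_map (geom_realization F) euclideanreal f \<and> f x \<noteq> f y"
  proof -
    obtain m \<beta> b where mb: "nondegenerate F m \<beta>" "b \<in> open_simplex m" "x = pt F m \<beta> b"
      using normal[OF x] by blast
    obtain n \<gamma> c where nc: "nondegenerate F n \<gamma>" "c \<in> open_simplex n" "y = pt F n \<gamma> c"
      using normal[OF y] by blast
    show ?thesis
    proof (cases "n \<le> m")
      case True
      then show ?thesis
        using separate_normal_forms[OF mb(1,2) nc(1,2)] neq unfolding mb(3) nc(3) by (metis less_irrefl)
    next
      case False
      then have "m \<le> n"
        by simp
      then show ?thesis
        using separate_normal_forms[OF nc(1,2) mb(1,2)] neq unfolding mb(3) nc(3) by (metis less_irrefl)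
    qed
  qed
  then obtain f where f: "continuous_map (geom_realization F) euclideanreal f" "f x \<noteq> f y"
    by blast
  then obtain V W where VW: "open V" "open W" "f x \<in> V" "f y \<in> W" "V \<inter> W = {}"
    using hausdorff[OF f(2)] by blast
  show "\<exists>V W. openin (geom_realization F) V \<and> openin (geom_realization F) W \<and> x \<in> V \<and> y \<in> W \<and> disjnt V W"
    using openin_continuous_map_preimage[OF f(1), of V] openin_continuous_map_preimage[OF f(1), of W] VW x y
    by (intro exI[of _ "{z \<in> topspace (geom_realization F). f z \<in> V}"]
        exI[of _ "{z \<in> topspace (geom_realization F). f z \<in> W}"]) (auto simp: disjnt_iff)
qed

end

text \<open>Sampling only needs some uniform variable, so that \<open>|F|\<close> is Hausdorff independently of \<open>\<Omega>\<close>.\<close>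

lemma uniform_rv_interval:
  "uniform_rv (uniform_measure lborel {0..<1::real}) (\<lambda>t. if 0 \<le> t \<and> t < 1 then t else 0)"
proof -
  interpret prob_space "uniform_measure lborel {0..<1::real}"
    by (rule prob_space_uniform_measure) auto
  show ?thesis
  proof unfold_locales
    fix t :: real assume t: "0 \<le> t" "t \<le> 1"
    have "{0..<1} \<inter> {s \<in> space (uniform_measure lborel {0..<1::real}). (if 0 \<le> s \<and> s < 1 then s else 0) < t} = {0..<t}"
      using t by auto
    then show "prob {s \<in> space (uniform_measure lborel {0..<1::real}). (if 0 \<le> s \<and> s < 1 then s else 0) < t} = t"
      using t by (subst measure_uniform_measure) auto
  qed auto
qed

section \<open>The cell structure of the geometric realization\<close>

context sset
begin

lemma Hausdorff_geom_realization: "Hausdorff_space (geom_realization F)"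
proof -
  interpret uniform_rv "uniform_measure lborel {0..<1::real}" "\<lambda>t. if 0 \<le> t \<and> t < 1 then t else 0"
    by (rule uniform_rv_interval)
  interpret uniform_sset "uniform_measure lborel {0..<1::real}" "\<lambda>t. if 0 \<le> t \<and> t < 1 then t else 0" F ..
  show ?thesis
    by (rule Hausdorff_geom_realization_by_sampling)
qed

lemma continuous_cell:
  assumes "\<alpha> \<in> simplices F n"
  shows "continuous_map (subtopology (Euclidean_space n) (closed_disc n)) (geom_realization F) (cell F n \<alpha>)"
  using continuous_map_compose[OF continuous_disc_map continuous_pt[OF assms]]
  by (simp add: cell_def[abs_def] o_def)

lemma cell_image: "cell F n \<alpha> ` closed_disc n = pt F n \<alpha> ` standard_simplex n"
proof -
  have "disc_map n ` closed_disc n = standard_simplex n"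
    using disc_map_simplex disc_map_surj by (metis image_eqI image_subsetI subsetI subset_antisym)
  then show ?thesis
    unfolding cell_def by (metis image_image)
qed

lemma cell_open_image: "cell F n \<alpha> ` open_disc n = pt F n \<alpha> ` open_simplex n"
proof -
  have open_sub: "open_disc n \<subseteq> closed_disc n"
    by (auto simp: open_disc_iff closed_disc_iff)
  have "disc_map n ` open_disc n = open_simplex n"
  proof
    show "disc_map n ` open_disc n \<subseteq> open_simplex n"
      using disc_map_open_simplex_iff open_sub by blast
    show "open_simplex n \<subseteq> disc_map n ` open_disc n"
    proof
      fix y assume y: "y \<in> open_simplex n"
      obtain x where "x \<in> closed_disc n" "disc_map n x = y"
        using disc_map_surj[OF open_simplex_subset[OF y]] .
      then show "y \<in> disc_map n ` open_disc n"
        using y disc_map_open_simplex_iff[of x n] by blast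
    qed
  qed
  then show ?thesis
    unfolding cell_def by (metis image_image)
qed

lemma normal_form_unique:
  assumes \<alpha>: "nondegenerate F n \<alpha>" and a: "a \<in> open_simplex n"
    and \<beta>: "nondegenerate F m \<beta>" and b: "b \<in> open_simplex m" and eq: "pt F n \<alpha> a = pt F m \<beta> b"
  shows "n = m \<and> \<alpha> = \<beta> \<and> a = b"
proof -
  have \<alpha>s: "\<alpha> \<in> simplices F n" and \<beta>s: "\<beta> \<in> simplices F m"
    using \<alpha> \<beta> by (simp_all add: nondegenerate_def)
  note c = compare_normal_form[OF \<alpha>s open_simplex_subset[OF a] \<beta> b eq]
  have "n = m"
    using c(1) compare_normal_form(1)[OF \<beta>s open_simplex_subset[OF b] \<alpha> a eq[symmetric]] by simp
  then show ?thesis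
    using c(3) by simp
qed

lemma embedding_cell:
  assumes \<alpha>: "nondegenerate F n \<alpha>"
  shows "embedding_map (subtopology (Euclidean_space n) (open_disc n)) (geom_realization F) (cell F n \<alpha>)"
proof -
  let ?D = "subtopology (Euclidean_space n) (closed_disc n)"
  have \<alpha>s: "\<alpha> \<in> simplices F n"
    using \<alpha> by (simp add: nondegenerate_def)
  have open_sub: "open_disc n \<subseteq> closed_disc n"
    by (auto simp: open_disc_iff closed_disc_iff)
  have D: "topspace ?D = closed_disc n"
    by (auto simp: topspace_Euclidean_space closed_disc_def)
  have inj: "x = y" if "x \<in> closed_disc n" "y \<in> open_disc n" "cell F n \<alpha> x = cell F n \<alpha> y" for x y
  proof -
    have "disc_map n y \<in> open_simplex n"
      using disc_map_open_simplex_iff that(2) open_sub by blast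
    then have "disc_map n x = disc_map n y"
      using compare_normal_form(3)[OF \<alpha>s disc_map_simplex[OF that(1)] \<alpha>] that(3) by (simp add: cell_def)
    then show ?thesis
      using disc_map_inj that open_sub by blast
  qed
  let ?V = "cell F n \<alpha> ` open_disc n"
  have "closed_map ?D (geom_realization F) (cell F n \<alpha>)"
    by (rule continuous_imp_closed_map[OF continuous_cell[OF \<alpha>s] compact_closed_disc Hausdorff_geom_realization])
  moreover have "{x \<in> topspace ?D. cell F n \<alpha> x \<in> ?V} = open_disc n"
    unfolding D using inj open_sub by blast
  ultimately have "closed_map (subtopology ?D (open_disc n)) (subtopology (geom_realization F) ?V) (cell F n \<alpha>)"
    by (rule closed_map_restriction)
  moreover have sub: "subtopology ?D (open_disc n) = subtopology (Euclidean_space n) (open_disc n)"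
    using open_sub by (simp add: subtopology_subtopology Int_absorb1)
  moreover have top: "topspace (subtopology (Euclidean_space n) (open_disc n)) = open_disc n"
    by (auto simp: topspace_Euclidean_space open_disc_def)
  moreover have "continuous_map (subtopology (Euclidean_space n) (open_disc n)) (subtopology (geom_realization F) ?V) (cell F n \<alpha>)"
    unfolding continuous_map_in_subtopology top
    using continuous_map_from_subtopology[OF continuous_cell[OF \<alpha>s], of "open_disc n"] sub by auto
  moreover have "inj_on (cell F n \<alpha>) (open_disc n)"
    using inj open_sub by (meson inj_onI subsetD)
  ultimately have "embedding_map (subtopology (Euclidean_space n) (open_disc n)) (subtopology (geom_realization F) ?V) (cell F n \<alpha>)"
    by (intro injective_closed_imp_embedding_map) auto
  then show ?thesis
    by (simp add: embedding_map_in_subtopology)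
qed

lemma ex_smaller_normal_form:
  assumes \<alpha>: "\<alpha> \<in> simplices F n" and a: "a \<in> standard_simplex n"
  obtains m \<tau> b where "m \<le> n" "\<tau> \<in> Delta_hom m n" "nondegenerate F m (act F m n \<tau> \<alpha>)" "b \<in> open_simplex m"
    "pt F n \<alpha> a = pt F m (act F m n \<tau> \<alpha>) b" "m < n \<or> a \<in> open_simplex n"
proof -
  obtain m \<beta> b where mb: "nondegenerate F m \<beta>" "b \<in> open_simplex m" "pt F n \<alpha> a = pt F m \<beta> b"
    using ex_normal_form[OF \<alpha> a] .
  note c = compare_normal_form[OF \<alpha> a mb]
  obtain \<tau> where \<tau>: "\<tau> \<in> Delta_hom m n" "\<beta> = act F m n \<tau> \<alpha>"
    using c(2) by blast
  have "m < n \<or> a \<in> open_simplex n"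
    using c(1,3) mb(2) by (metis le_neq_implies_less)
  then show thesis
    using that[OF c(1) \<tau>(1)] mb unfolding \<tau>(2) by blast
qed

proposition CW_complex_geom_realization: "CW_complex (geom_realization F)"
  unfolding CW_complex_def
proof (intro conjI Hausdorff_geom_realization exI[of _ "cells F"])
  let ?X = "geom_realization F"
  show "\<forall>(n, \<phi>)\<in>cells F. continuous_map (subtopology (Euclidean_space n) (closed_disc n)) ?X \<phi> \<and>
      embedding_map (subtopology (Euclidean_space n) (open_disc n)) ?X \<phi>"
    using continuous_cell embedding_cell by (auto simp: cells_def nondegenerate_def)
  show "disjoint_family_on (\<lambda>(n, \<phi>). \<phi> ` open_disc n) (cells F)"
    unfolding disjoint_family_on_def
  proof (intro ballI impI)
    fix p q assume "p \<in> cells F" "q \<in> cells F" and neq: "p \<noteq> q"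
    then obtain n \<alpha> m \<beta> where p: "p = (n, cell F n \<alpha>)" "nondegenerate F n \<alpha>"
      and q: "q = (m, cell F m \<beta>)" "nondegenerate F m \<beta>"
      unfolding cells_def by blast
    have "pt F n \<alpha> a \<noteq> pt F m \<beta> b" if "a \<in> open_simplex n" "b \<in> open_simplex m" for a b
      using normal_form_unique[OF p(2) that(1) q(2) that(2)] neq p(1) q(1) by blast
    then show "(case p of (n, \<phi>) \<Rightarrow> \<phi> ` open_disc n) \<inter> (case q of (n, \<phi>) \<Rightarrow> \<phi> ` open_disc n) = {}"
      by (auto simp: p(1) q(1) cell_open_image)
  qed
  show "(\<Union>(n, \<phi>)\<in>cells F. \<phi> ` open_disc n) = topspace ?X"
  proof
    show "(\<Union>(n, \<phi>)\<in>cells F. \<phi> ` open_disc n) \<subseteq> topspace ?X"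
    proof clarify
      fix n \<phi> x assume "(n, \<phi>) \<in> cells F" and x: "x \<in> open_disc n"
      then obtain \<alpha> where \<alpha>: "nondegenerate F n \<alpha>" "\<phi> = cell F n \<alpha>"
        by (auto simp: cells_def)
      have "\<phi> x \<in> pt F n \<alpha> ` open_simplex n"
        using x unfolding \<alpha>(2) cell_open_image[symmetric] by (rule imageI)
      then show "\<phi> x \<in> topspace ?X"
        using \<alpha>(1) open_simplex_subset unfolding topspace_geom nondegenerate_def by blast
    qed
    show "topspace ?X \<subseteq> (\<Union>(n, \<phi>)\<in>cells F. \<phi> ` open_disc n)"
    proof
      fix z assume "z \<in> topspace ?X"
      then obtain n \<alpha> a where "\<alpha> \<in> simplices F n" "a \<in> standard_simplex n" "z = pt F n \<alpha> a"
        by (auto simp: topspace_geom)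
      then obtain m \<beta> b where mb: "nondegenerate F m \<beta>" "b \<in> open_simplex m" "z = pt F m \<beta> b"
        using ex_normal_form by metis
      then have "(m, cell F m \<beta>) \<in> cells F" "z \<in> cell F m \<beta> ` open_disc m"
        by (auto simp: cells_def cell_open_image)
      then show "z \<in> (\<Union>(n, \<phi>)\<in>cells F. \<phi> ` open_disc n)"
        by blast
    qed
  qed
  show "\<forall>(n, \<phi>)\<in>cells F. \<exists>D\<subseteq>cells F. finite D \<and> (\<forall>(m, \<psi>)\<in>D. m < n) \<and>
      \<phi> ` (closed_disc n - open_disc n) \<subseteq> (\<Union>(m, \<psi>)\<in>D. \<psi> ` open_disc m)"
  proof clarify
    fix n \<phi> assume "(n, \<phi>) \<in> cells F"
    then obtain \<alpha> where \<alpha>: "nondegenerate F n \<alpha>" "\<phi> = cell F n \<alpha>"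
      by (auto simp: cells_def)
    then have \<alpha>s: "\<alpha> \<in> simplices F n"
      by (simp add: nondegenerate_def)
    let ?I = "Sigma {..<n} (\<lambda>m. {\<tau> \<in> Delta_hom m n. nondegenerate F m (act F m n \<tau> \<alpha>)})"
    let ?D = "(\<lambda>(m, \<tau>). (m, cell F m (act F m n \<tau> \<alpha>))) ` ?I"
    have "\<phi> ` (closed_disc n - open_disc n) \<subseteq> (\<Union>(m, \<psi>)\<in>?D. \<psi> ` open_disc m)"
    proof clarify
      fix x assume x: "x \<in> closed_disc n" "x \<notin> open_disc n"
      obtain m \<tau> b where m: "m \<le> n" "\<tau> \<in> Delta_hom m n" "nondegenerate F m (act F m n \<tau> \<alpha>)" "b \<in> open_simplex m"
        "pt F n \<alpha> (disc_map n x) = pt F m (act F m n \<tau> \<alpha>) b" "m < n \<or> disc_map n x \<in> open_simplex n"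
        using ex_smaller_normal_form[OF \<alpha>s disc_map_simplex[OF x(1)]] .
      have "m < n"
        using m(6) x disc_map_open_simplex_iff[OF x(1)] by blast
      then have "(m, \<tau>) \<in> ?I"
        using m by simp
      moreover have "\<phi> x \<in> cell F m (act F m n \<tau> \<alpha>) ` open_disc m"
        using m(4,5) unfolding cell_open_image by (simp add: \<alpha>(2) cell_def)
      ultimately show "\<phi> x \<in> (\<Union>(m, \<psi>)\<in>?D. \<psi> ` open_disc m)"
        by (auto intro!: bexI[of _ "(m, \<tau>)"])
    qed
    moreover have "finite ?D"
      using finite_Delta_hom by (intro finite_imageI finite_SigmaI) auto
    moreover have "?D \<subseteq> cells F"
      by (auto simp: cells_def)
    moreover have "\<forall>(m, \<psi>)\<in>?D. m < n"
      by auto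
    ultimately show "\<exists>D\<subseteq>cells F. finite D \<and> (\<forall>(m, \<psi>)\<in>D. m < n) \<and>
        \<phi> ` (closed_disc n - open_disc n) \<subseteq> (\<Union>(m, \<psi>)\<in>D. \<psi> ` open_disc m)"
      by (intro exI[of _ ?D]) simp
  qed
  show "\<forall>S\<subseteq>topspace ?X. closedin ?X S \<longleftrightarrow> (\<forall>(n, \<phi>)\<in>cells F. closedin ?X (S \<inter> \<phi> ` closed_disc n))"
  proof (intro allI impI iffI)
    fix S assume S: "closedin ?X S"
    have "closedin ?X (cell F n \<alpha> ` closed_disc n)" if "nondegenerate F n \<alpha>" for n \<alpha>
    proof -
      have "topspace (subtopology (Euclidean_space n) (closed_disc n)) = closed_disc n"
        by (auto simp: topspace_Euclidean_space closed_disc_def)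
      moreover have "\<alpha> \<in> simplices F n"
        using that by (simp add: nondegenerate_def)
      ultimately have "compactin ?X (cell F n \<alpha> ` closed_disc n)"
        using image_compactin[OF _ continuous_cell] compact_closed_disc unfolding compact_space_def by metis
      then show ?thesis
        by (rule compactin_imp_closedin[OF Hausdorff_geom_realization])
    qed
    then show "\<forall>(n, \<phi>)\<in>cells F. closedin ?X (S \<inter> \<phi> ` closed_disc n)"
      using S by (auto simp: cells_def intro: closedin_Int)
  next
    fix S assume S: "S \<subseteq> topspace ?X" and cl: "\<forall>(n, \<phi>)\<in>cells F. closedin ?X (S \<inter> \<phi> ` closed_disc n)"
    have "closedin (simplex_top n) {a \<in> topspace (simplex_top n). pt F n \<alpha> a \<in> S}"
      if \<alpha>: "\<alpha> \<in> simplices F n" for n \<alpha>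
    proof -
      \<comment> \<open>finitely many closed cells cover the image of the simplex \<open>\<alpha>\<close>\<close>
      let ?I = "Sigma {..n} (\<lambda>m. {\<tau> \<in> Delta_hom m n. nondegenerate F m (act F m n \<tau> \<alpha>)})"
      let ?P = "\<lambda>(m, \<tau>). {a \<in> topspace (simplex_top n). pt F n \<alpha> a \<in> S \<inter> cell F m (act F m n \<tau> \<alpha>) ` closed_disc m}"
      have "closedin (simplex_top n) (\<Union>(?P ` ?I))"
      proof (intro closedin_Union)
        show "finite (?P ` ?I)"
          using finite_Delta_hom by (intro finite_imageI finite_SigmaI) auto
        fix T assume "T \<in> ?P ` ?I"
        then obtain m \<tau> where nd: "nondegenerate F m (act F m n \<tau> \<alpha>)" and T: "T = ?P (m, \<tau>)"
          by blast
        have "closedin ?X (S \<inter> cell F m (act F m n \<tau> \<alpha>) ` closed_disc m)"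
          using cl nd by (auto simp: cells_def)
        then show "closedin (simplex_top n) T"
          unfolding T by (simp only: prod.case) (rule closedin_continuous_map_preimage[OF continuous_pt[OF \<alpha>]])
      qed
      also have "\<Union>(?P ` ?I) = {a \<in> topspace (simplex_top n). pt F n \<alpha> a \<in> S}"
      proof
        show "{a \<in> topspace (simplex_top n). pt F n \<alpha> a \<in> S} \<subseteq> \<Union>(?P ` ?I)"
        proof clarify
          fix a assume "a \<in> topspace (simplex_top n)" and aS: "pt F n \<alpha> a \<in> S"
          then have a: "a \<in> standard_simplex n"
            by (simp add: topspace_simplex_top)
          obtain m \<tau> b where m: "m \<le> n" "\<tau> \<in> Delta_hom m n" "nondegenerate F m (act F m n \<tau> \<alpha>)" "b \<in> open_simplex m"
            "pt F n \<alpha> a = pt F m (act F m n \<tau> \<alpha>) b"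
            using ex_smaller_normal_form[OF \<alpha> a] .
          then have "(m, \<tau>) \<in> ?I"
            by simp
          moreover have "a \<in> ?P (m, \<tau>)"
            using a aS m(4,5) open_simplex_subset by (auto simp: cell_image topspace_simplex_top)
          ultimately show "a \<in> \<Union>(?P ` ?I)"
            by blast
        qed
      qed auto
      finally show ?thesis .
    qed
    then show "closedin ?X S"
      using S unfolding geom_realization_def closedin_realization pt_def by blast
  qed
qed

end

section \<open>The probability-law map, the homotopy type and the Kan property\<close>

theorem theorem1p2:
  fixes M :: "'w measure"
  assumes "prob_space M" and "complete_measure M" and "atomless M"
  shows "(\<forall>F :: 'a sset. simplicial_set F \<longrightarrow>
            homotopy_equivalence_map (L_space M F) (geom_realization F) (law_map M F) \<and>
            (\<exists>K :: (nat \<times> 'a \<times> (nat \<Rightarrow> real)) set topology.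
               CW_complex K \<and> L_space M F homotopy_equivalent_space K)) \<and>
         (\<forall>X :: 'x topology. kan_complex (Sing_RV M X))"
proof -
  interpret prob_space M
    by fact
  obtain U where "uniform_rv M U"
    using ex_uniform_rv[OF assms(3)] by blast
  then interpret uniform_rv M U .
  show ?thesis
  proof (intro conjI allI impI)
    fix F :: "'a sset" assume "simplicial_set F"
    then interpret sset F
      by unfold_locales
    show he: "homotopy_equivalence_map (L_space M F) (geom_realization F) (law_map M F)"
      by (rule homotopy_equivalence_law_map)
    then show "\<exists>K :: (nat \<times> 'a \<times> (nat \<Rightarrow> real)) set topology. CW_complex K \<and> L_space M F homotopy_equivalent_space K"
      using CW_complex_geom_realization
      unfolding homotopy_equivalence_map_def homotopy_equivalent_space_def by blast
  qed (rule kan_complex_Sing_RV)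
qed

end
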